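(* There is a randomized algorithm that, given an $n$-vertex simple undirected graph $G$ and an integer $d$, runs in time $d^{O(n/d)}\cdot n^{O(1)}$ and decides whether $G$ has a spanning tree of maximum degree at most $d$, with one-sided error: it never answers yes when no such spanning tree exists, and when one exists it answers yes with probability bounded below by a positive constant. *)

theory Defs
  imports "HOL-Probability.Probability"
begin

section \<open>Undirected graphs and spanning trees\<close>

text \<open>The notion of tree in the AFP entry Graph_Theory speaks about directed cycles only and is
  therefore not the one for undirected graphs. An undirected graph is given here by its vertex set
  and its set of two-element edges.\<close>

definition simple_graph :: "'a set \<Rightarrow> 'a set set \<Rightarrow> bool" where
  "simple_graph V E \<longleftrightarrow> finite V \<and> (\<forall>e\<in>E. \<exists>u\<in>V. \<exists>v\<in>V. u \<noteq> v \<and> e = {u, v})"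

definition walk :: "'a set set \<Rightarrow> 'a list \<Rightarrow> bool" where
  "walk E p \<longleftrightarrow> p \<noteq> [] \<and> successively (\<lambda>u v. {u, v} \<in> E) p"

definition connected_graph :: "'a set \<Rightarrow> 'a set set \<Rightarrow> bool" where
  "connected_graph V E \<longleftrightarrow>
     V \<noteq> {} \<and> (\<forall>u\<in>V. \<forall>v\<in>V. \<exists>p. walk E p \<and> hd p = u \<and> last p = v)"

text \<open>The closing edge joins the last vertex of the list to the first one; the first vertex is not
  repeated at the end.\<close>

definition cycle :: "'a set set \<Rightarrow> 'a list \<Rightarrow> bool" where
  "cycle E p \<longleftrightarrow> length p \<ge> 3 \<and> distinct p \<and> walk E p \<and> {last p, hd p} \<in> E"

definition tree :: "'a set \<Rightarrow> 'a set set \<Rightarrow> bool" where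
  "tree V T \<longleftrightarrow> simple_graph V T \<and> connected_graph V T \<and> (\<nexists>p. cycle T p)"

definition spanning_tree :: "'a set \<Rightarrow> 'a set set \<Rightarrow> 'a set set \<Rightarrow> bool" where
  "spanning_tree V E T \<longleftrightarrow> T \<subseteq> E \<and> tree V T"

definition degree :: "'a set set \<Rightarrow> 'a \<Rightarrow> nat" where
  "degree E v = card {e \<in> E. v \<in> e}"

definition max_degree :: "'a set \<Rightarrow> 'a set set \<Rightarrow> nat" where
  "max_degree V E = Max (degree E ` V)"


section \<open>Randomized random access machines\<close>

text \<open>Algorithms are programs of a random access machine in structured form. The memory consists of
  integer arrays, of which a program can mention only finitely many. A scalar is the cell with
  index 0 of an array. The arithmetic operations are addition and subtraction, each at unit cost on
  integers of any size. Multiplication is left out on purpose: with addition and subtraction only,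
  the length of the integers grows by a constant in each step, and the unit-cost machine is
  polynomially equivalent to the Turing machine, which would fail with unit-cost multiplication.\<close>

type_synonym vname = string
type_synonym state = "vname \<Rightarrow> int \<Rightarrow> int"

datatype aexp =
    Lit int
  | Get vname aexp
  | Add aexp aexp
  | Sub aexp aexp

datatype bexp =
    Less aexp aexp
  | Not bexp
  | And bexp bexp

datatype com =
    Skip
  | Assign vname aexp aexp
  | Flip vname aexp
  | Seq com com
  | If bexp com com
  | While bexp com

fun aval :: "aexp \<Rightarrow> state \<Rightarrow> int" where
  "aval (Lit k) s = k"
| "aval (Get x i) s = s x (aval i s)"
| "aval (Add a b) s = aval a s + aval b s"
| "aval (Sub a b) s = aval a s - aval b s"

fun bval :: "bexp \<Rightarrow> state \<Rightarrow> bool" where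
  "bval (Less a b) s \<longleftrightarrow> aval a s < aval b s"
| "bval (Not b) s \<longleftrightarrow> \<not> bval b s"
| "bval (And b c) s \<longleftrightarrow> bval b s \<and> bval c s"

fun acost :: "aexp \<Rightarrow> nat" where
  "acost (Lit k) = 1"
| "acost (Get x i) = acost i + 1"
| "acost (Add a b) = acost a + acost b + 1"
| "acost (Sub a b) = acost a + acost b + 1"

fun bcost :: "bexp \<Rightarrow> nat" where
  "bcost (Less a b) = acost a + acost b + 1"
| "bcost (Not b) = bcost b + 1"
| "bcost (And b c) = bcost b + bcost c + 1"

definition update :: "state \<Rightarrow> vname \<Rightarrow> int \<Rightarrow> int \<Rightarrow> state" where
  "update s x i k = s(x := (s x)(i := k))"

text \<open>\<open>exec c s \<omega> t s' \<omega>'\<close>: the program \<open>c\<close>, started in state \<open>s\<close> with the infinite sequence \<open>\<omega>\<close> of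
  future coin flips, halts after time \<open>t\<close> in state \<open>s'\<close>, and \<open>\<omega>'\<close> is the unused rest of \<open>\<omega>\<close>. A
  run that does not halt has no derivation.\<close>

inductive exec :: "com \<Rightarrow> state \<Rightarrow> bool stream \<Rightarrow> nat \<Rightarrow> state \<Rightarrow> bool stream \<Rightarrow> bool" where
  exec_Skip: "exec Skip s \<omega> 1 s \<omega>"
| exec_Assign:
    "exec (Assign x i a) s \<omega> (acost i + acost a + 1) (update s x (aval i s) (aval a s)) \<omega>"
| exec_Flip:
    "exec (Flip x i) s \<omega> (acost i + 1) (update s x (aval i s) (of_bool (shd \<omega>))) (stl \<omega>)"
| exec_Seq:
    "exec c1 s \<omega> t1 s1 \<omega>1 \<Longrightarrow> exec c2 s1 \<omega>1 t2 s2 \<omega>2 \<Longrightarrow> exec (Seq c1 c2) s \<omega> (t1 + t2) s2 \<omega>2"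
| exec_IfTrue:
    "bval b s \<Longrightarrow> exec c1 s \<omega> t s' \<omega>' \<Longrightarrow> exec (If b c1 c2) s \<omega> (bcost b + 1 + t) s' \<omega>'"
| exec_IfFalse:
    "\<not> bval b s \<Longrightarrow> exec c2 s \<omega> t s' \<omega>' \<Longrightarrow> exec (If b c1 c2) s \<omega> (bcost b + 1 + t) s' \<omega>'"
| exec_WhileFalse:
    "\<not> bval b s \<Longrightarrow> exec (While b c) s \<omega> (bcost b + 1) s \<omega>"
| exec_WhileTrue:
    "bval b s \<Longrightarrow> exec c s \<omega> t1 s1 \<omega>1 \<Longrightarrow> exec (While b c) s1 \<omega>1 t2 s2 \<omega>2 \<Longrightarrow>
     exec (While b c) s \<omega> (bcost b + 1 + t1 + t2) s2 \<omega>2"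

inductive_cases SkipE: "exec Skip s \<omega> t s' \<omega>'"
inductive_cases AssignE: "exec (Assign x i a) s \<omega> t s' \<omega>'"
inductive_cases FlipE: "exec (Flip x i) s \<omega> t s' \<omega>'"
inductive_cases SeqE: "exec (Seq c1 c2) s \<omega> t s' \<omega>'"
inductive_cases IfE: "exec (If b c1 c2) s \<omega> t s' \<omega>'"
inductive_cases WhileE: "exec (While b c) s \<omega> t s' \<omega>'"

lemma exec_deterministic:
  "exec c s \<omega> t s' \<omega>' \<Longrightarrow> exec c s \<omega> u r \<omega>'' \<Longrightarrow> t = u \<and> s' = r \<and> \<omega>' = \<omega>''"
proof (induction arbitrary: u r \<omega>'' rule: exec.induct)
  case (exec_Skip s \<omega>)
  from exec_Skip show ?case by (rule SkipE) simp
next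
  case (exec_Assign x i a s \<omega>)
  from exec_Assign show ?case by (rule AssignE) simp
next
  case (exec_Flip x i s \<omega>)
  from exec_Flip show ?case by (rule FlipE) simp
next
  case (exec_Seq c1 s \<omega> t1 s1 \<omega>1 c2 t2 s2 \<omega>2)
  from exec_Seq.prems show ?case
  proof (rule SeqE)
    fix t1' r1 \<nu> t2'
    assume *: "u = t1' + t2'" "exec c1 s \<omega> t1' r1 \<nu>" "exec c2 r1 \<nu> t2' r \<omega>''"
    from exec_Seq.IH(1)[OF *(2)] have "t1 = t1'" "s1 = r1" "\<omega>1 = \<nu>" by blast+
    with exec_Seq.IH(2)[of t2' r \<omega>''] * show ?case by blast
  qed
next
  case (exec_IfTrue b s c1 \<omega> t s' \<omega>' c2)
  from exec_IfTrue.prems show ?case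
    by (rule IfE) (use exec_IfTrue.IH exec_IfTrue.hyps(1) in fastforce)+
next
  case (exec_IfFalse b s c2 \<omega> t s' \<omega>' c1)
  from exec_IfFalse.prems show ?case
    by (rule IfE) (use exec_IfFalse.IH exec_IfFalse.hyps(1) in fastforce)+
next
  case (exec_WhileFalse b s c \<omega>)
  from exec_WhileFalse.prems show ?case
    by (rule WhileE) (use exec_WhileFalse.hyps in simp_all)
next
  case (exec_WhileTrue b s c \<omega> t1 s1 \<omega>1 t2 s2 \<omega>2)
  from exec_WhileTrue.prems show ?case
  proof (rule WhileE)
    assume "\<not> bval b s"
    with exec_WhileTrue.hyps(1) show ?case by blast
  next
    fix t1' r1 \<nu> t2'
    assume *: "u = Suc (bcost b + t1' + t2')" "exec c s \<omega> t1' r1 \<nu>"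
      "exec (While b c) r1 \<nu> t2' r \<omega>''"
    from exec_WhileTrue.IH(1)[OF *(2)] have "t1 = t1'" "s1 = r1" "\<omega>1 = \<nu>" by blast+
    with exec_WhileTrue.IH(2)[of t2' r \<omega>''] * show ?case by simp
  qed
qed

definition halts_within :: "com \<Rightarrow> state \<Rightarrow> bool stream \<Rightarrow> real \<Rightarrow> bool" where
  "halts_within c s \<omega> T \<longleftrightarrow> (\<exists>t s' \<omega>'. exec c s \<omega> t s' \<omega>' \<and> real t \<le> T)"

definition answers_yes :: "com \<Rightarrow> state \<Rightarrow> bool stream \<Rightarrow> bool" where
  "answers_yes c s \<omega> \<longleftrightarrow> (\<exists>t s' \<omega>'. exec c s \<omega> t s' \<omega>' \<and> s' ''answer'' 0 = 1)"

definition coin_space :: "bool stream measure" where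
  "coin_space = stream_space (measure_pmf (bernoulli_pmf (1/2)))"

definition prob_yes :: "com \<Rightarrow> state \<Rightarrow> real" where
  "prob_yes c s = measure coin_space {\<omega>. answers_yes c s \<omega>}"

text \<open>The input: the numbers \<open>n\<close> and \<open>d\<close> as scalars, and the adjacency matrix of the graph with
  vertices \<open>0, \<dots>, n - 1\<close>, row by row. All other cells are 0.\<close>

definition input_state :: "nat \<Rightarrow> int \<Rightarrow> nat set set \<Rightarrow> state" where
  "input_state n d E = (\<lambda>x i.
     if x = ''n'' \<and> i = 0 then int n
     else if x = ''d'' \<and> i = 0 then d
     else if x = ''adj'' \<and> (\<exists>u<n. \<exists>v<n. i = int (u * n + v) \<and> {u, v} \<in> E) then 1
     else 0)"

text \<open>A bound of the form \<open>d\<^bsup>O(n/d)\<^esup> \<cdot> n\<^bsup>O(1)\<^esup>\<close>, where \<open>C\<close>, \<open>a\<close> and \<open>b\<close> are the constants hidden by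
  the O-notation. The expression makes sense only for \<open>d \<ge> 1\<close>; for \<open>d \<le> 0\<close> the first factor is
  read as for \<open>d = 1\<close>, that is, as 1.\<close>

definition time_bound :: "real \<Rightarrow> real \<Rightarrow> nat \<Rightarrow> nat \<Rightarrow> int \<Rightarrow> real" where
  "time_bound C a b n d =
     C * real_of_int (max 1 d) powr (a * (real n / real_of_int (max 1 d))) * real n ^ b"

end

theory Submission
  imports Defs "HOL-Number_Theory.Cong" "Jordan_Normal_Form.Determinant"
begin

text \<open>Orienting a spanning tree towards a root turns it into a parent function, so spanning trees are
  counted by a determinant: with an additional sink as root, the Laplacian with edge weights
  \<open>x\<^sub>u x\<^sub>v\<close>, plus the identity for the edges of weight 1 into the sink, has as its determinant the
  generating function of the rooted forests by their degrees.

  If all degrees of a tree are at most \<open>d\<close>, next fit cuts the sequence of the vertices into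
  \<open>m = O(n/d)\<close> consecutive groups of degree sum at most \<open>d\<close>. Conversely, a group with degree sum at
  most \<open>d\<close> contains no vertex of larger degree. There are at most \<open>(d + 1)\<^sup>m\<close> sequences of group
  sizes, and all of them are tried. All vertices in group \<open>j\<close> get the same variable, for which
  \<open>R\<close> to the power \<open>(d + 1)\<^sup>j\<close> is substituted with a large \<open>R\<close>, so that the determinant becomes one
  integer whose digits in base \<open>R\<close> count forests. A spanning tree has total degree \<open>2 (n - 1)\<close> and
  other forests have less; since a carry in base \<open>d + 1\<close> decreases the number of summands, a
  position with digit sum \<open>2 (n - 1)\<close> in base \<open>d + 1\<close> can only be reached by spanning trees whose
  group degrees are all at most \<open>d\<close>. Only positions below \<open>(d + 1)\<^sup>m\<close> matter, so the determinant is
  computed modulo a power of 2; Gaussian elimination works there because all pivots stay odd. No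
  coin is flipped.\<close>

section \<open>Determinants and rooted forests\<close>

text \<open>With one variable per vertex, the degree vectors would fill \<open>(d + 1) ^ n\<close>
  positions. Sharing variables within groups leaves \<open>(d + 1) ^ m\<close>, and the groupings
  can be enumerated at the same price. Randomness is avoided because every coefficient of the
  generating function is a number of forests: nothing can cancel, so exact evaluation at a power of
  2 loses no information and a yes instance is accepted with probability 1. These numbers are below
  \<open>2 ^ (n * n)\<close>, hence \<open>R = 2 ^ (n * n)\<close> and a modulus of
  \<open>B = n * n * (d + 1) ^ m\<close> bits.

  The time analysis rests on one fact: no loop makes more than \<open>B\<close> iterations, so the
  time of the fixed program is polynomial in \<open>B\<close>. With \<open>m = 2 * k\<close> and
  \<open>k\<close> the ceiling of \<open>2 * n / (d + 1)\<close>, the number \<open>B\<close> has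
  the required form for \<open>d \<ge> 2\<close>, and this form is closed under taking powers. Crude
  methods such as bitwise multiplication and trying every grouping are therefore affordable.\<close>

definition det_of :: "nat \<Rightarrow> (nat \<Rightarrow> nat \<Rightarrow> int) \<Rightarrow> int" where
  "det_of n a = Determinant.det (Matrix.mat n n (\<lambda>(i, j). a i j))"

lemma det_of_leibniz:
  "det_of n a = (\<Sum>p | p permutes {0..<n}. signof p * (\<Prod>i = 0..<n. a i (p i)))"
proof -
  have "det_of n a = (\<Sum>p | p permutes {0..<n}. signof p *
      (\<Prod>i = 0..<n. Matrix.mat n n (\<lambda>(i, j). a i j) $$ (i, p i)))"
    unfolding det_of_def by (rule det_def') simp
  also have "\<dots> = (\<Sum>p | p permutes {0..<n}. signof p * (\<Prod>i = 0..<n. a i (p i)))"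
  proof (rule sum.cong[OF refl], goal_cases)
    case (1 p)
    then have "p i < n" if "i < n" for i
      using that permutes_in_image[of p "{0..<n}" i] by auto
    then show ?case
      by (auto intro!: prod.cong)
  qed
  finally show ?thesis .
qed

lemma det_of_cong_mod:
  assumes "\<And>i j. i < n \<Longrightarrow> j < n \<Longrightarrow> [a i j = b i j] (mod M)"
  shows "[det_of n a = det_of n b] (mod M)"
  unfolding det_of_leibniz
proof (intro cong_sum cong_mult cong_prod cong_refl)
  fix p i
  assume "p \<in> {p. p permutes {0..<n}}" "i \<in> {0..<n}"
  then show "[a i (p i) = b i (p i)] (mod M)"
    using permutes_in_image[of p "{0..<n}" i] by (auto intro: assms)
qed

lemma det_of_row_op:
  assumes "k < n" "i \<noteq> k"
  shows "det_of n (a(i := \<lambda>j. a i j + t * a k j)) = det_of n a"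
proof -
  let ?A = "Matrix.mat n n (\<lambda>(i, j). a i j)"
  have "Matrix.mat n n (\<lambda>(r, j). (a(i := \<lambda>j. a i j + t * a k j)) r j) = addrow t i k ?A"
    using assms by (intro eq_matI) (auto simp: mat_addrow_def)
  then show ?thesis
    unfolding det_of_def using det_addrow[OF assms, of ?A t] by (metis mat_carrier)
qed

lemma det_of_triangular_mod:
  assumes "\<And>i j. j < i \<Longrightarrow> i < n \<Longrightarrow> [a i j = 0] (mod M)"
  shows "[det_of n a = (\<Prod>i<n. a i i)] (mod M)"
proof -
  define b where "b = (\<lambda>i j. if j < i then 0 else a i j)"
  have "[det_of n a = det_of n b] (mod M)"
    by (rule det_of_cong_mod) (auto simp: b_def assms)
  also have "det_of n b = prod_list (diag_mat (Matrix.mat n n (\<lambda>(i, j). b i j)))"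
    unfolding det_of_def by (rule det_upper_triangular) (auto simp: b_def)
  also have "\<dots> = (\<Prod>i<n. a i i)"
    by (simp add: diag_mat_def b_def prod.list_conv_set_nth atLeast0LessThan)
  finally show ?thesis .
qed

text \<open>A parent function maps every vertex below \<open>n\<close> to a vertex or to the sink \<open>n\<close>.\<close>

definition reaches_sink :: "nat \<Rightarrow> (nat \<Rightarrow> nat) \<Rightarrow> nat \<Rightarrow> bool" where
  "reaches_sink n f v \<longleftrightarrow> (\<exists>k. (f ^^ k) v = n)"

text \<open>The extensional function space fixes the values outside \<open>{0..<n}\<close>, so that
  a forest is a single function and sums over this set count each forest once.\<close>

definition rooted_forests :: "nat \<Rightarrow> (nat \<Rightarrow> nat) set" where
  "rooted_forests n = {f \<in> {0..<n} \<rightarrow>\<^sub>E {0..n}. \<forall>v<n. reaches_sink n f v}"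

text \<open>The sink is excluded because an extensional \<open>f\<close> has no meaningful value at
  \<open>n\<close>.\<close>

lemma reaches_sink_step: "v \<noteq> n \<Longrightarrow> reaches_sink n f v \<longleftrightarrow> reaches_sink n f (f v)"
  unfolding reaches_sink_def
  by (metis funpow_0 funpow_Suc_right comp_apply not0_implies_Suc)

lemma reaches_sink_sink [simp]: "reaches_sink n f n"
  unfolding reaches_sink_def by (rule exI[of _ 0]) simp

text \<open>The distance to the sink is a rank that drops along parents. All later arguments use
  acyclicity in this form, by picking vertices of least or greatest rank.\<close>

lemma reaches_sink_rank:
  assumes "\<forall>v<n. reaches_sink n f v"
  obtains h :: "nat \<Rightarrow> nat" where "\<And>v. v < n \<Longrightarrow> h (f v) < h v"
proof -
  define h where "h v = (LEAST k. (f ^^ k) v = n)" for v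
  have "h (f v) < h v" if "v < n" for v
  proof -
    have "(f ^^ h v) v = n"
      using assms that unfolding reaches_sink_def h_def by (meson LeastI)
    moreover from this have "h v \<noteq> 0"
      using that by (metis funpow_0 less_irrefl)
    ultimately obtain k where "h v = Suc k" "(f ^^ k) (f v) = n"
      by (metis funpow_Suc_right comp_apply not0_implies_Suc)
    then show ?thesis
      unfolding h_def by (metis Least_le le_imp_less_Suc)
  qed
  then show thesis using that by blast
qed

lemma rank_reaches_sink:
  fixes h :: "nat \<Rightarrow> nat"
  assumes "\<And>v. v < n \<Longrightarrow> f v \<le> n" "\<And>v. v < n \<Longrightarrow> f v \<noteq> n \<Longrightarrow> h (f v) < h v"
  shows "v < n \<Longrightarrow> reaches_sink n f v"
proof (induction "h v" arbitrary: v rule: less_induct)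
  case less
  then show ?case
    using assms[of v] reaches_sink_step[of v n f]
    by (cases "f v = n") (auto simp: le_less)
qed

text \<open>Row \<open>v\<close> of the identity minus the matrix of the map
  \<open>v \<mapsto> t\<close>. The column of the sink is deleted: for \<open>t = n\<close> the
  second summand vanishes at every \<open>u < n\<close>.\<close>

definition step_row :: "nat \<Rightarrow> nat \<Rightarrow> nat \<Rightarrow> int" where
  "step_row v t u = of_bool (u = v) - of_bool (u = t)"

text \<open>Only the identity contributes to the Leibniz sum. In a nonzero term \<open>p v\<close>
  is \<open>v\<close> or \<open>f v\<close>; a moved vertex of least rank would go to its parent,
  which by injectivity is moved as well and has smaller rank.\<close>

lemma det_of_step_forest:
  assumes f: "f \<in> rooted_forests n"
  shows "det_of n (\<lambda>v. step_row v (f v)) = 1"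
proof -
  from f have "\<forall>v<n. reaches_sink n f v" by (simp add: rooted_forests_def)
  then obtain h :: "nat \<Rightarrow> nat" where h: "\<And>v. v < n \<Longrightarrow> h (f v) < h v"
    using reaches_sink_rank by blast
  have "(\<Prod>i = 0..<n. step_row i (f i) (p i)) = 0" if p: "p permutes {0..<n}" and "p \<noteq> id" for p
  proof (rule ccontr)
    assume "(\<Prod>i = 0..<n. step_row i (f i) (p i)) \<noteq> 0"
    then have nz0: "step_row v (f v) (p v) \<noteq> 0" if "v < n" for v using that by simp
    have nz: "p v = v \<or> p v = f v" if "v < n" for v
      using nz0[OF that] by (auto simp: step_row_def split: if_splits)
    have "\<exists>v. p v \<noteq> v" using \<open>p \<noteq> id\<close> by (auto simp: fun_eq_iff)
    then obtain v where v: "p v \<noteq> v" and least: "\<And>u. p u \<noteq> u \<Longrightarrow> h v \<le> h u"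
      using ex_has_least_nat[of "\<lambda>v. p v \<noteq> v" _ h] by blast
    have "v < n" using v p by (meson atLeastLessThan_iff le0 permutes_def)
    with nz v have "p v = f v" by blast
    moreover have "p (p v) \<noteq> p v" using v permutes_inj[OF p] by (metis injD)
    ultimately show False using least[of "p v"] h[OF \<open>v < n\<close>] by simp
  qed
  then have "det_of n (\<lambda>v. step_row v (f v)) =
      (\<Sum>p | p permutes {0..<n}. if p = id then 1 else 0)"
    unfolding det_of_leibniz
  proof (intro sum.cong refl, goal_cases)
    case (1 p)
    have "step_row i (f i) i = 1" if "i < n" for i
      using h[OF that] by (auto simp: step_row_def)
    with 1 show ?case by auto
  qed
  also have "\<dots> = 1" by (simp add: permutes_id finite_permutations)
  finally show ?thesis .
qed

text \<open>The indicator of the vertices that never reach the sink is a nonzero kernel vector,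
  since a vertex belongs to this set exactly if its parent does.\<close>

lemma det_of_step_cyclic:
  assumes f: "f \<in> {0..<n} \<rightarrow>\<^sub>E {0..n}" and nf: "f \<notin> rooted_forests n"
  shows "det_of n (\<lambda>v. step_row v (f v)) = 0"
proof -
  let ?A = "Matrix.mat n n (\<lambda>(v, u). step_row v (f v) u)"
  define y :: "nat \<Rightarrow> int" where "y v = of_bool (\<not> reaches_sink n f v)" for v
  from f nf obtain v where v: "v < n" "\<not> reaches_sink n f v"
    by (auto simp: rooted_forests_def)
  have "?A *\<^sub>v Matrix.vec n y = 0\<^sub>v n"
  proof (rule eq_vecI)
    fix i assume "i < dim_vec (0\<^sub>v n :: int vec)"
    then have i: "i < n" by simp
    then have "f i \<le> n" using f by auto
    have yf: "y i = (if f i = n then 0 else y (f i))"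
      using i reaches_sink_step[of i n f] by (auto simp: y_def)
    have "Matrix.vec_index (?A *\<^sub>v Matrix.vec n y) i = (\<Sum>j = 0..<n. step_row i (f i) j * y j)"
      using i by (simp add: scalar_prod_def)
    also have "\<dots> = (\<Sum>j = 0..<n. if j = i then y j else 0) - (\<Sum>j = 0..<n. if j = f i then y j else 0)"
      unfolding sum_subtractf[symmetric] by (rule sum.cong) (auto simp: step_row_def)
    also have "\<dots> = 0" using i \<open>f i \<le> n\<close> yf by auto
    finally show "Matrix.vec_index (?A *\<^sub>v Matrix.vec n y) i = Matrix.vec_index (0\<^sub>v n) i" using i by simp
  qed simp
  moreover have "Matrix.vec n y \<noteq> 0\<^sub>v n"
  proof
    assume "Matrix.vec n y = 0\<^sub>v n"
    then have "Matrix.vec_index (Matrix.vec n y) v = Matrix.vec_index (0\<^sub>v n) v" by simp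
    with v show False by (simp add: y_def)
  qed
  ultimately show ?thesis
    unfolding det_of_def using det_0_iff_vec_prod_zero[of ?A n] by (metis mat_carrier vec_carrier)
qed

text \<open>A rooted version of the matrix-tree theorem: the rows are multilinear in the weights, so the
  determinant splits into those of the matrices of single functions.\<close>

lemma matrix_forest:
  fixes w :: "nat \<Rightarrow> nat \<Rightarrow> int"
  shows "det_of n (\<lambda>v u. \<Sum>t = 0..n. w v t * step_row v t u) =
    (\<Sum>f\<in>rooted_forests n. \<Prod>v = 0..<n. w v (f v))"
proof -
  let ?F = "{0..<n} \<rightarrow>\<^sub>E {0..n}"
  have "det_of n (\<lambda>v u. \<Sum>t = 0..n. w v t * step_row v t u) =
      (\<Sum>p | p permutes {0..<n}. signof p *
        (\<Sum>f\<in>?F. \<Prod>v = 0..<n. w v (f v) * step_row v (f v) (p v)))"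
    unfolding det_of_leibniz by (subst prod_sum_PiE) auto
  also have "\<dots> = (\<Sum>f\<in>?F. (\<Prod>v = 0..<n. w v (f v)) * det_of n (\<lambda>v. step_row v (f v)))"
    unfolding det_of_leibniz sum_distrib_left
    by (subst sum.swap) (simp add: prod.distrib mult_ac)
  also have "\<dots> = (\<Sum>f\<in>?F. if f \<in> rooted_forests n then \<Prod>v = 0..<n. w v (f v) else 0)"
    by (intro sum.cong refl) (auto simp: det_of_step_forest det_of_step_cyclic)
  also have "\<dots> = (\<Sum>f\<in>?F \<inter> rooted_forests n. \<Prod>v = 0..<n. w v (f v))"
    by (subst sum.inter_restrict) (auto intro: finite_PiE)
  also have "?F \<inter> rooted_forests n = rooted_forests n"
    by (auto simp: rooted_forests_def)
  finally show ?thesis .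
qed

section \<open>Spanning trees as parent functions\<close>

definition forest_degree :: "nat \<Rightarrow> (nat \<Rightarrow> nat) \<Rightarrow> nat \<Rightarrow> nat" where
  "forest_degree n f v = of_bool (f v \<noteq> n) + card {u \<in> {0..<n}. f u = v}"

definition parent_forest :: "nat \<Rightarrow> nat set set \<Rightarrow> (nat \<Rightarrow> nat) \<Rightarrow> bool" where
  "parent_forest n E f \<longleftrightarrow> f \<in> rooted_forests n \<and> (\<forall>v<n. f v \<noteq> n \<longrightarrow> {v, f v} \<in> E)"

text \<open>Having \<open>n - 1\<close> edges that avoid the sink means having one root.
  Connectivity is put as a count because this count is half the total degree, which is what a digit
  sum can reveal.\<close>

definition parent_tree :: "nat \<Rightarrow> nat set set \<Rightarrow> (nat \<Rightarrow> nat) \<Rightarrow> bool" where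
  "parent_tree n E f \<longleftrightarrow> parent_forest n E f \<and> card {v \<in> {0..<n}. f v \<noteq> n} = n - 1"

definition parent_edges :: "nat \<Rightarrow> (nat \<Rightarrow> nat) \<Rightarrow> nat set set" where
  "parent_edges n f = {{v, f v} | v. v < n \<and> f v \<noteq> n}"

lemma rooted_forests_le: "f \<in> rooted_forests n \<Longrightarrow> v < n \<Longrightarrow> f v \<le> n"
  by (auto simp: rooted_forests_def)

text \<open>The handshake lemma with vertex weights. Weight 1 gives the total degree; the exponents
  of the variables as weights give the exponent of the monomial of a forest.\<close>

lemma sum_forest_degree_weighted:
  fixes c :: "nat \<Rightarrow> nat"
  assumes "f \<in> rooted_forests n"
  shows "(\<Sum>v = 0..<n. forest_degree n f v * c v) = (\<Sum>v = 0..<n. if f v = n then 0 else c v + c (f v))"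
proof -
  have "(\<Sum>v = 0..<n. card {u \<in> {0..<n}. f u = v} * c v) =
      (\<Sum>v = 0..<n. \<Sum>u = 0..<n. if f u = v then c v else 0)"
    by (auto simp: sum.inter_filter[symmetric] intro!: sum.cong)
  also have "\<dots> = (\<Sum>u = 0..<n. \<Sum>v = 0..<n. if f u = v then c v else 0)"
    by (rule sum.swap)
  also have "\<dots> = (\<Sum>u = 0..<n. if f u = n then 0 else c (f u))"
    using rooted_forests_le[OF assms] by (intro sum.cong) (auto simp: le_less)
  finally have *: "(\<Sum>v = 0..<n. card {u \<in> {0..<n}. f u = v} * c v) =
      (\<Sum>u = 0..<n. if f u = n then 0 else c (f u))" .
  have "(\<Sum>v = 0..<n. forest_degree n f v * c v) =
      (\<Sum>v = 0..<n. of_bool (f v \<noteq> n) * c v) + (\<Sum>v = 0..<n. card {u \<in> {0..<n}. f u = v} * c v)"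
    unfolding forest_degree_def add_mult_distrib by (rule sum.distrib)
  also have "\<dots> = (\<Sum>v = 0..<n. if f v = n then 0 else c v + c (f v))"
    unfolding * sum.distrib[symmetric] by (intro sum.cong) auto
  finally show ?thesis .
qed

lemma sum_forest_degree:
  assumes "f \<in> rooted_forests n"
  shows "(\<Sum>v = 0..<n. forest_degree n f v) = 2 * card {v \<in> {0..<n}. f v \<noteq> n}"
proof -
  have "(\<Sum>v = 0..<n. forest_degree n f v) = (\<Sum>v = 0..<n. if f v = n then 0 else 2)"
    using sum_forest_degree_weighted[OF assms, of "\<lambda>_. 1"] by (simp add: numeral_2_eq_2 cong: if_cong)
  also have "\<dots> = (\<Sum>v\<in>{v \<in> {0..<n}. f v \<noteq> n}. 2)"
    by (subst sum.inter_filter) (auto intro: sum.cong)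
  finally show ?thesis by simp
qed

text \<open>A vertex of least rank can only point to the sink.\<close>

lemma rooted_forest_has_root:
  assumes f: "f \<in> rooted_forests n" and n: "n \<ge> 1"
  shows "\<exists>v<n. f v = n"
proof -
  from f obtain h :: "nat \<Rightarrow> nat" where h: "\<And>v. v < n \<Longrightarrow> h (f v) < h v"
    using reaches_sink_rank[of n f] by (auto simp: rooted_forests_def)
  obtain v where v: "v < n" "\<And>u. u < n \<Longrightarrow> h v \<le> h u"
    using ex_has_least_nat[of "\<lambda>v. v < n" 0 h] n by auto
  have "f v \<le> n" using f v(1) by (rule rooted_forests_le)
  moreover have "\<not> f v < n" using h[OF v(1)] v(2)[of "f v"] by linarith
  ultimately show ?thesis using v(1) by auto
qed

lemma card_nonroots_le:
  assumes "f \<in> rooted_forests n" "n \<ge> 1"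
  shows "card {v \<in> {0..<n}. f v \<noteq> n} \<le> n - 1"
proof -
  obtain r where r: "r < n" "f r = n" using rooted_forest_has_root[OF assms] by blast
  have "{v \<in> {0..<n}. f v \<noteq> n} \<subseteq> {0..<n} - {r}" using r by auto
  then have "card {v \<in> {0..<n}. f v \<noteq> n} \<le> card ({0..<n} - {r})" by (intro card_mono) auto
  then show ?thesis using r by simp
qed

section \<open>Walks and cycles, and the equivalence of spanning trees with parent functions\<close>

definition joined :: "'a set set \<Rightarrow> 'a \<Rightarrow> 'a \<Rightarrow> bool" where
  "joined T u v \<longleftrightarrow> (\<exists>p. walk T p \<and> hd p = u \<and> last p = v)"

lemma joined_refl: "joined T u u"
  unfolding joined_def walk_def by (rule exI[of _ "[u]"]) simp

lemma joined_edge: "{u, v} \<in> T \<Longrightarrow> joined T u v"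
  unfolding joined_def walk_def by (rule exI[of _ "[u, v]"]) simp

lemma joined_sym: "joined T u v \<Longrightarrow> joined T v u"
  unfolding joined_def walk_def
  by (elim exE, rule_tac x = "rev p" in exI)
     (auto simp: successively_rev hd_rev last_rev insert_commute)

lemma joined_trans:
  assumes "joined T u v" "joined T v w"
  shows "joined T u w"
proof -
  obtain p p' where p: "walk T p" "hd p = u" "last p = v"
    and p': "walk T p'" "hd p' = v" "last p' = w"
    using assms unfolding joined_def by blast
  show ?thesis
  proof (cases "tl p' = []")
    case True
    with p' have "w = v" by (metis last_ConsL list.collapse walk_def)
    with assms show ?thesis by simp
  next
    case False
    then obtain x ps where x: "p' = v # x # ps"
      using p'(2) by (metis list.collapse list.sel(2))
    have "walk T (p @ tl p')"
      using p p' x unfolding walk_def by (auto simp: successively_append_iff)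
    then show ?thesis unfolding joined_def using p p' x
      by (intro exI[of _ "p @ tl p'"]) (auto simp: walk_def)
  qed
qed

lemma cycle_neighbours:
  assumes "cycle T p" "v \<in> set p"
  obtains x y where "x \<in> set p" "y \<in> set p" "x \<noteq> y" "{v, x} \<in> T" "{v, y} \<in> T"
proof -
  from assms have len: "length p \<ge> 3" and dist: "distinct p"
    and succ: "successively (\<lambda>u v. {u, v} \<in> T) p" and close: "{last p, hd p} \<in> T"
    unfolding cycle_def walk_def by auto
  obtain i where i: "i < length p" "p ! i = v" using assms(2) by (auto simp: in_set_conv_nth)
  \<comment> \<open>The positions before and after \<open>i\<close> in cyclic order; the closing
    edge serves the wrap-around, and length at least 3 makes the two positions distinct.\<close>
  define a where "a = (if i = 0 then length p - 1 else i - 1)"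
  define b where "b = (if i = length p - 1 then 0 else i + 1)"
  have step: "{p ! k, p ! Suc k} \<in> T" if "Suc k < length p" for k
    using succ that by (auto simp: successively_conv_nth)
  have close': "{p ! (length p - 1), p ! 0} \<in> T"
    using close len by (metis hd_conv_nth last_conv_nth list.size(3) not_numeral_le_zero)
  have ab: "a < length p" "b < length p" "a \<noteq> b" using i len by (auto simp: a_def b_def)
  have "{v, p ! a} \<in> T"
    using i step[of "i - 1"] close' by (cases "i = 0") (auto simp: a_def insert_commute)
  moreover have "{v, p ! b} \<in> T"
    using i step[of i] close' by (cases "i = length p - 1") (auto simp: b_def insert_commute)
  ultimately show thesis using that[of "p ! a" "p ! b"] ab dist by (auto simp: nth_eq_iff_index_eq)
qed

text \<open>A vertex of greatest rank on a cycle cannot be the parent of another vertex there, so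
  both of its neighbours on the cycle would have to be its own parent.\<close>

lemma parent_edges_acyclic:
  assumes f: "f \<in> rooted_forests n"
  shows "\<not> cycle (parent_edges n f) p"
proof
  assume c: "cycle (parent_edges n f) p"
  then have "set p \<noteq> {}" by (auto simp: cycle_def)
  from f obtain h :: "nat \<Rightarrow> nat" where h: "\<And>v. v < n \<Longrightarrow> h (f v) < h v"
    using reaches_sink_rank[of n f] by (auto simp: rooted_forests_def)
  obtain v where v: "v \<in> set p" "\<And>u. u \<in> set p \<Longrightarrow> h u \<le> h v"
    using Max_in[of "h ` set p"] Max_ge[of "h ` set p"] \<open>set p \<noteq> {}\<close> by fastforce
  have *: "x = f v" if "x \<in> set p" "{v, x} \<in> parent_edges n f" for x
  proof -
    from that(2) obtain u where u: "u < n" "{v, x} = {u, f u}" by (auto simp: parent_edges_def)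
    then have "x = f v \<or> (x < n \<and> f x = v)" by (auto simp: doubleton_eq_iff)
    then show ?thesis using h[of x] v(2)[OF that(1)] by auto
  qed
  obtain x y where "x \<in> set p" "y \<in> set p" "x \<noteq> y"
      "{v, x} \<in> parent_edges n f" "{v, y} \<in> parent_edges n f"
    using cycle_neighbours[OF c v(1)] .
  with * show False by metis
qed

text \<open>Nothing is assumed about \<open>f\<close>, so the edges to the parent and to the
  children may coincide; the inequality is the direction that transfers a degree bound.\<close>

lemma degree_parent_edges_le:
  assumes "v < n"
  shows "Defs.degree (parent_edges n f) v \<le> forest_degree n f v"
proof -
  let ?A = "if f v = n then {} else {{v, f v}}"
  let ?B = "(\<lambda>u. {u, f u}) ` {u \<in> {0..<n}. f u = v}"
  have "{e \<in> parent_edges n f. v \<in> e} \<subseteq> ?A \<union> ?B"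
    using assms by (auto simp: parent_edges_def)
  then have "Defs.degree (parent_edges n f) v \<le> card (?A \<union> ?B)"
    unfolding Defs.degree_def by (intro card_mono) auto
  also have "\<dots> \<le> card ?A + card ?B" by (rule card_Un_le)
  also have "\<dots> \<le> forest_degree n f v" unfolding forest_degree_def by (intro add_mono card_image_le) auto
  finally show ?thesis .
qed

text \<open>The edge count leaves a unique root, and following parents joins every vertex to
  it.\<close>

lemma parent_tree_spanning_tree:
  assumes f: "parent_tree n E f" and n: "n \<ge> 1" and E: "simple_graph {0..<n} E"
  shows "spanning_tree {0..<n} E (parent_edges n f)"
proof -
  let ?T = "parent_edges n f"
  have rf: "f \<in> rooted_forests n" and adj: "\<And>v. v < n \<Longrightarrow> f v \<noteq> n \<Longrightarrow> {v, f v} \<in> E"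
    and cd: "card {v \<in> {0..<n}. f v \<noteq> n} = n - 1"
    using f by (auto simp: parent_tree_def parent_forest_def)
  have sub: "?T \<subseteq> E" using adj by (auto simp: parent_edges_def)
  obtain r where r: "r < n" "f r = n" using rooted_forest_has_root[OF rf n] by blast
  have uniq: "v = r" if "v < n" "f v = n" for v
  proof (rule ccontr)
    assume "v \<noteq> r"
    have "{v \<in> {0..<n}. f v \<noteq> n} \<subseteq> {0..<n} - {r, v}" using r that by auto
    then have "n - 1 \<le> card ({0..<n} - {r, v})" unfolding cd[symmetric] by (intro card_mono) auto
    also have "\<dots> = n - 2" using r that \<open>v \<noteq> r\<close> by (subst card_Diff_subset) auto
    finally show False using \<open>v \<noteq> r\<close> r that by linarith
  qed
  obtain h :: "nat \<Rightarrow> nat" where h: "\<And>v. v < n \<Longrightarrow> h (f v) < h v"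
    using rf reaches_sink_rank[of n f] by (auto simp: rooted_forests_def)
  have to_r: "joined ?T v r" if "v < n" for v
    using that
  proof (induction "h v" arbitrary: v rule: less_induct)
    case less
    show ?case
    proof (cases "f v = n")
      case True
      then show ?thesis using uniq less.prems joined_refl by metis
    next
      case False
      then have "f v < n" using rooted_forests_le[OF rf less.prems] by simp
      then have "joined ?T (f v) r" using less.hyps h less.prems by simp
      moreover have "joined ?T v (f v)"
        using False less.prems by (intro joined_edge) (auto simp: parent_edges_def)
      ultimately show ?thesis by (rule joined_trans[rotated])
    qed
  qed
  have "connected_graph {0..<n} ?T"
    unfolding connected_graph_def joined_def[symmetric]
    using to_r n joined_trans joined_sym by (metis atLeastLessThan_iff atLeastLessThan_empty_iff
        le0 less_le_trans less_one not_less zero_less_one)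
  moreover have "simple_graph {0..<n} ?T"
    using E sub unfolding simple_graph_def by blast
  ultimately show ?thesis
    using sub parent_edges_acyclic[OF rf] by (auto simp: spanning_tree_def tree_def)
qed

text \<open>Root the tree at vertex 0 and let each other vertex choose a neighbour with a shorter
  shortest walk to 0. The number of vertices on a shortest walk is then a rank for the chosen parent
  function.\<close>

lemma spanning_tree_parent_tree:
  assumes T: "spanning_tree {0..<n} E T" and n: "n \<ge> 1"
  obtains f where "parent_tree n E f" "\<And>v. v < n \<Longrightarrow> forest_degree n f v \<le> Defs.degree T v"
proof -
  have TE: "T \<subseteq> E" and sg: "simple_graph {0..<n} T" and con: "connected_graph {0..<n} T"
    using T by (auto simp: spanning_tree_def tree_def)
  define P where "P v k \<longleftrightarrow> (\<exists>p. walk T p \<and> hd p = v \<and> last p = 0 \<and> length p = k)" for v :: nat and k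
  define h where "h v = (LEAST k. P v k)" for v
  have ex: "\<exists>k. P v k" if "v < n" for v
    using con that unfolding connected_graph_def P_def by fastforce
  have "\<exists>w. w < n \<and> {v, w} \<in> T \<and> h w < h v" if v: "v < n" "v \<noteq> 0" for v
  proof -
    have "P v (h v)" unfolding h_def using ex[OF v(1)] by (rule LeastI_ex)
    then obtain p where p: "walk T p" "hd p = v" "last p = 0" "length p = h v"
      unfolding P_def by blast
    have "tl p \<noteq> []"
      using p v by (metis last_ConsL list.collapse walk_def)
    then obtain w ps where pp: "p = v # w # ps"
      using p by (metis list.collapse list.sel(2))
    have vw: "{v, w} \<in> T" using p(1) pp by (simp add: walk_def)
    have "P w (length (w # ps))"
      unfolding P_def using p pp by (intro exI[of _ "w # ps"]) (auto simp: walk_def)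
    then have "h w \<le> length (w # ps)" unfolding h_def by (rule Least_le)
    then have "h w < h v" using p(4) pp by simp
    moreover have "w < n" using sg vw unfolding simple_graph_def
      by (metis atLeastLessThan_iff doubleton_eq_iff)
    ultimately show ?thesis using vw by blast
  qed
  then obtain g where g: "\<And>v. v < n \<Longrightarrow> v \<noteq> 0 \<Longrightarrow> g v < n \<and> {v, g v} \<in> T \<and> h (g v) < h v"
    by metis
  define f where "f = restrict (\<lambda>v. if v = 0 then n else g v) {0..<n}"
  have f0: "f 0 = n" using n by (simp add: f_def)
  have fv: "f v = g v" if "v < n" "v \<noteq> 0" for v using that by (simp add: f_def)
  have fn: "f v = n \<longleftrightarrow> v = 0" if "v < n" for v
    using g[of v] f0 fv that by (metis less_irrefl)
  have rf: "f \<in> rooted_forests n"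
    unfolding rooted_forests_def
  proof (intro CollectI conjI allI impI)
    show "f \<in> {0..<n} \<rightarrow>\<^sub>E {0..n}" using g by (fastforce simp: f_def)
    fix v assume "v < n"
    then show "reaches_sink n f v"
    proof (rule rank_reaches_sink[where h = h, rotated 2])
      show "f u \<le> n" if "u < n" for u using g[of u] n that by (cases "u = 0") (auto simp: f_def)
      show "h (f u) < h u" if "u < n" "f u \<noteq> n" for u
        using that g[of u] by (auto simp: fn fv)
    qed
  qed
  have adj: "{v, f v} \<in> T" if "v < n" "f v \<noteq> n" for v using g[of v] that by (auto simp: fn fv)
  have "{v \<in> {0..<n}. f v \<noteq> n} = {v \<in> {0..<n}. v \<noteq> 0}" by (rule Collect_cong) (use fn in auto)
  also have "\<dots> = {0..<n} - {0}" by auto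
  finally have nonroots: "{v \<in> {0..<n}. f v \<noteq> n} = {0..<n} - {0}" .
  have "parent_tree n E f"
    using nonroots rf adj TE n by (auto simp: parent_tree_def parent_forest_def)
  moreover have "forest_degree n f v \<le> Defs.degree T v" if v: "v < n" for v
  proof -
    let ?C = "{u \<in> {0..<n}. f u = v}"
    let ?A = "if f v = n then {} else {f v}"
    have down: "h (f v) < h v" if "f v \<noteq> n" using that v g[of v] by (auto simp: fn fv)
    have up: "h v < h u" if "u \<in> ?C" for u using that v g[of u] fn[of u] fv[of u] by auto
    \<comment> \<open>The rank separates the parent from the children, so the forest degree counts
      distinct neighbours in \<open>T\<close>.\<close>
    have disj: "?A \<inter> ?C = {}"
    proof (rule ccontr)
      assume "?A \<inter> ?C \<noteq> {}"
      then have "f v \<noteq> n" "f v \<in> ?C" by (auto split: if_splits)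
      then show False using down up[of "f v"] by (meson less_asym)
    qed
    define S where "S = ?A \<union> ?C"
    have "forest_degree n f v = card S"
      unfolding forest_degree_def S_def using disj by (subst card_Un_disjoint) auto
    also have "card S \<le> card {e \<in> T. v \<in> e}"
    proof (rule card_inj_on_le)
      show "inj_on (\<lambda>u. {u, v}) S" by (rule inj_onI) (metis doubleton_eq_iff)
      have "e \<in> Pow {0..<n}" if "e \<in> T" for e
        using bspec[OF conjunct2[OF sg[unfolded simple_graph_def]] that] by auto
      then have "T \<subseteq> Pow {0..<n}" by blast
      then show "finite {e \<in> T. v \<in> e}" by (rule_tac finite_subset[of _ "Pow {0..<n}"]) auto
      have "{u, v} \<in> T" if "u \<in> S" for u
      proof (cases "f u = v \<and> u < n")
        case True
        then show ?thesis using adj[of u] v by simp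
      next
        case False
        then have "u = f v" "f v \<noteq> n" using that by (auto simp: S_def split: if_splits)
        then show ?thesis using adj[OF v] by (simp add: insert_commute)
      qed
      then show "(\<lambda>u. {u, v}) ` S \<subseteq> {e \<in> T. v \<in> e}" by blast
    qed
    finally show ?thesis by (simp add: Defs.degree_def)
  qed
  ultimately show thesis by (rule that)
qed

text \<open>The bound \<open>d\<close> is an integer and may be negative; then both sides fail,
  because \<open>V\<close> is nonempty.\<close>

lemma max_degree_le_iff:
  assumes "finite V" "V \<noteq> {}"
  shows "int (max_degree V T) \<le> d \<longleftrightarrow> (\<forall>v\<in>V. int (Defs.degree T v) \<le> d)"
proof (cases "d \<ge> 0")
  case True
  then obtain k where "d = int k" using nonneg_int_cases by blast
  then show ?thesis unfolding max_degree_def using assms by simp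
next
  case False
  then show ?thesis using assms by auto
qed

theorem bounded_degree_tree_iff:
  assumes n: "n \<ge> 1" and E: "simple_graph {0..<n} E"
  shows "(\<exists>T. spanning_tree {0..<n} E T \<and> int (max_degree {0..<n} T) \<le> d) \<longleftrightarrow>
    (\<exists>f. parent_tree n E f \<and> (\<forall>v<n. int (forest_degree n f v) \<le> d))"
proof
  assume "\<exists>T. spanning_tree {0..<n} E T \<and> int (max_degree {0..<n} T) \<le> d"
  then obtain T where T: "spanning_tree {0..<n} E T" "\<And>v. v < n \<Longrightarrow> int (Defs.degree T v) \<le> d"
    using n by (auto simp: max_degree_le_iff)
  obtain f where "parent_tree n E f" "\<And>v. v < n \<Longrightarrow> forest_degree n f v \<le> Defs.degree T v"
    using spanning_tree_parent_tree[OF T(1) n] by blast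
  then show "\<exists>f. parent_tree n E f \<and> (\<forall>v<n. int (forest_degree n f v) \<le> d)"
    using T(2) by (metis of_nat_mono order_trans)
next
  assume "\<exists>f. parent_tree n E f \<and> (\<forall>v<n. int (forest_degree n f v) \<le> d)"
  then obtain f where f: "parent_tree n E f" "\<And>v. v < n \<Longrightarrow> int (forest_degree n f v) \<le> d" by blast
  have "int (Defs.degree (parent_edges n f) v) \<le> d" if "v < n" for v
    using degree_parent_edges_le[OF that, of f] f(2)[OF that] by linarith
  then show "\<exists>T. spanning_tree {0..<n} E T \<and> int (max_degree {0..<n} T) \<le> d"
    using parent_tree_spanning_tree[OF f(1) n E] n by (auto simp: max_degree_le_iff)
qed

section \<open>Digit expansions and groupings\<close>

text \<open>The digit expansion of a number to base \<open>q\<close>, as the list of the exponents with multiplicity.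
  It also encodes a grouping: the \<open>v\<close>-th element is the group of vertex \<open>v\<close>.\<close>

fun power_terms :: "nat \<Rightarrow> nat \<Rightarrow> nat \<Rightarrow> nat list" where
  "power_terms q 0 K = []"
| "power_terms q (Suc k) K = replicate (K div q ^ k) k @ power_terms q k (K mod q ^ k)"

lemma power_terms_less: "j \<in> set (power_terms q k K) \<Longrightarrow> j < k"
  by (induction k arbitrary: K) (auto split: if_splits, fastforce)

lemma power_terms_digit:
  assumes "R < q ^ k"
  shows "power_terms q (Suc k) (t * q ^ k + R) = replicate t k @ power_terms q k R"
proof -
  have "(t * b + R) div b = t" if "R < b" for b :: nat
    using that by (metis add.right_neutral div_less div_mult_self3 gr_implies_not0)
  from this[OF assms] show ?thesis using assms by simp
qed

lemma power_terms_zero: "power_terms q k 0 = []"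
  by (induction k) auto

text \<open>Among all representations of a number as a sum of powers of \<open>q\<close>, the digit expansion has the
  fewest terms, because every carry replaces \<open>q\<close> terms by one.\<close>

lemma length_power_terms_le:
  fixes e :: "nat \<Rightarrow> nat"
  assumes "2 \<le> q" "R < q ^ k" "(\<Sum>j<k. e j * q ^ j) = c * q ^ k + R"
  shows "length (power_terms q k R) + 2 * c \<le> (\<Sum>j<k. e j) \<and>
    (length (power_terms q k R) = (\<Sum>j<k. e j) \<longrightarrow> (\<forall>j<k. e j < q))"
  using assms(2,3)
\<comment> \<open>\<open>c\<close> is the carry out of the lowest \<open>k\<close> positions. One
  copy of \<open>c\<close> pays for the terms that the carry contributes to the next position; the
  second makes every carry a strict loss, so that equality forces all carries to be 0.\<close>
proof (induction k arbitrary: c R)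
  case 0
  then show ?case by simp
next
  case (Suc k)
  define S where "S = (\<Sum>j<k. e j * q ^ j)"
  define c' where "c' = S div q ^ k"
  define R' where "R' = S mod q ^ k"
  have q: "q ^ k > 0" using assms(1) by simp
  have S: "S = c' * q ^ k + R'" and R': "R' < q ^ k"
    unfolding c'_def R'_def using q by (simp_all only: div_mult_mod_eq mod_less_divisor)
  from Suc.IH[OF R' S[unfolded S_def]]
  have IH: "length (power_terms q k R') + 2 * c' \<le> (\<Sum>j<k. e j)"
    "length (power_terms q k R') = (\<Sum>j<k. e j) \<Longrightarrow> \<forall>j<k. e j < q" by auto
  have eq: "(c' + e k) * q ^ k + R' = (c * q) * q ^ k + R"
    using Suc.prems(2) S by (simp add: S_def[symmetric] algebra_simps)
  have R'eq: "R' = R mod q ^ k" using arg_cong[OF eq, of "\<lambda>x. x mod q ^ k"] R' by simp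
  have carry: "c' + e k = c * q + R div q ^ k"
    using arg_cong[OF eq, of "\<lambda>x. x div q ^ k"] R' q
    by (simp add: div_mult_self3 add.commute)
  have "2 * c \<le> c * q" using assms(1) by simp
  have len: "length (power_terms q (Suc k) R) = R div q ^ k + length (power_terms q k R')" by (simp add: R'eq)
  have top: "R div q ^ k < q" using Suc.prems(1) by (simp add: less_mult_imp_div_less)
  have "length (power_terms q (Suc k) R) + 2 * c \<le> (\<Sum>j<Suc k. e j)"
    unfolding len using IH(1) carry \<open>2 * c \<le> c * q\<close> by (simp only: sum.lessThan_Suc)
  moreover have "\<forall>j<Suc k. e j < q" if eq': "length (power_terms q (Suc k) R) = (\<Sum>j<Suc k. e j)"
  proof -
    have "c = 0" using calculation eq' by simp
    then have "length (power_terms q k R') = (\<Sum>j<k. e j)" "e k = R div q ^ k"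
      using eq' IH(1) carry unfolding len by auto
    then show ?thesis using IH(2) top by (simp add: less_Suc_eq)
  qed
  ultimately show ?case by simp
qed

text \<open>Digits below \<open>q\<close> cause no carry, so the expansion consists of exactly these
  digits.\<close>

lemma length_power_terms_sum:
  fixes e :: "nat \<Rightarrow> nat"
  assumes "2 \<le> q" "\<And>j. j < k \<Longrightarrow> e j < q"
  shows "(\<Sum>j<k. e j * q ^ j) < q ^ k \<and> length (power_terms q k (\<Sum>j<k. e j * q ^ j)) = (\<Sum>j<k. e j)"
  using assms(2)
proof (induction k)
  case (Suc k)
  let ?R = "\<Sum>j<k. e j * q ^ j"
  have IH: "?R < q ^ k" "length (power_terms q k ?R) = (\<Sum>j<k. e j)" using Suc by auto
  have "e k * q ^ k + ?R < (e k + 1) * q ^ k" using IH by simp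
  also have "\<dots> \<le> q * q ^ k" using Suc.prems[of k] by (intro mult_right_mono) auto
  finally have "e k * q ^ k + ?R < q ^ Suc k" by simp
  moreover have "length (power_terms q (Suc k) (e k * q ^ k + ?R)) = (\<Sum>j<Suc k. e j)"
    using IH by (subst power_terms_digit) auto
  ultimately show ?case by (simp add: add.commute)
qed simp

section \<open>Grouping the vertices by next fit\<close>

definition group_sum :: "nat \<Rightarrow> nat list \<Rightarrow> nat list \<Rightarrow> nat" where
  "group_sum j gs xs = sum_list (map snd (filter (\<lambda>(g, x). g = j) (zip gs xs)))"

lemma group_sum_append:
  "length gs = length xs \<Longrightarrow> group_sum j (gs @ gs') (xs @ xs') = group_sum j gs xs + group_sum j gs' xs'"
  by (simp add: group_sum_def)

lemma group_sum_replicate: "group_sum j (replicate (length xs) i) xs = (if i = j then sum_list xs else 0)"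
  by (induction xs) (auto simp: group_sum_def)

lemma group_sum_notin: "j \<notin> set gs \<Longrightarrow> group_sum j gs xs = 0"
  unfolding group_sum_def by (auto dest!: set_zip_leftD)

text \<open>\<open>zip\<close> discards surplus entries, so a grouping may be longer than the list
  of the vertices.\<close>

lemma group_sum_conv_sum:
  assumes "length gs \<ge> n"
  shows "group_sum j gs (map D [0..<n]) = (\<Sum>v | v < n \<and> gs ! v = j. D v)"
proof -
  have "zip gs (map D [0..<n]) = map (\<lambda>v. (gs ! v, D v)) [0..<n]"
    using assms by (intro nth_equalityI) auto
  then have "group_sum j gs (map D [0..<n]) = sum_list (map D (filter (\<lambda>v. gs ! v = j) [0..<n]))"
    by (simp add: group_sum_def filter_map o_def)
  also have "\<dots> = (\<Sum>v | v < n \<and> gs ! v = j. D v)"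
    by (subst sum_list_distinct_conv_sum_set) (auto intro: sum.cong)
  finally show ?thesis .
qed

lemma longest_prefix:
  fixes d :: nat
  obtains ys zs where "xs = ys @ zs" "sum_list ys \<le> d" "zs = [] \<or> sum_list ys + hd zs > d"
proof -
  have "\<exists>ys zs. xs = ys @ zs \<and> sum_list ys \<le> d \<and> (zs = [] \<or> sum_list ys + hd zs > d)"
  proof (induction xs arbitrary: d)
    case Nil
    then show ?case by simp
  next
    case (Cons x xs)
    show ?case
    proof (cases "x \<le> d")
      case True
      obtain ys zs where "xs = ys @ zs" "sum_list ys \<le> d - x" "zs = [] \<or> sum_list ys + hd zs > d - x"
        using Cons[of "d - x"] by blast
      then show ?thesis using True by (intro exI[of _ "x # ys"] exI[of _ zs]) auto
    next
      case False
      then show ?thesis by (intro exI[of _ "[]"] exI[of _ "x # xs"]) auto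
    qed
  qed
  then show thesis using that by blast
qed

text \<open>Next fit: a maximal block together with the element that no longer fits into it uses up
  more than \<open>d\<close>, so two groups pay for \<open>d + 1\<close> units.\<close>

lemma next_fit:
  assumes "1 \<le> d" "\<And>x. x \<in> set xs \<Longrightarrow> 1 \<le> x \<and> x \<le> d" "sum_list xs < k * (d + 1)"
  shows "\<exists>K < (d + 1) ^ (2 * k). length xs \<le> length (power_terms (d + 1) (2 * k) K) \<and>
    (\<forall>j. group_sum j (power_terms (d + 1) (2 * k) K) xs \<le> d)"
  using assms(2,3)
proof (induction k arbitrary: xs)
  case 0
  then show ?case by simp
next
  case (Suc k)
  let ?q = "d + 1"
  \<comment> \<open>As every element is at least 1, a group of sum at most \<open>d\<close> has at
    most \<open>d\<close> members, and its size is a legal digit in base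
    \<open>d + 1\<close>.\<close>
  have len: "length ys \<le> sum_list ys" if "set ys \<subseteq> set xs" for ys
    using that Suc.prems(1) by (induction ys) fastforce+
  have two: "2 * Suc k = Suc (Suc (2 * k))" by simp
  obtain ys zs where xs: "xs = ys @ zs" and ys: "sum_list ys \<le> d"
    and max: "zs = [] \<or> sum_list ys + hd zs > d" by (rule longest_prefix)
  have lys: "length ys \<le> d" using len[of ys] xs ys by simp
  show ?case
  proof (cases zs)
    case Nil
    \<comment> \<open>Everything left fits into one group: the top digit is its size, all lower
      digits are 0.\<close>
    let ?K = "length ys * ?q ^ (2 * k + 1)"
    have "?K < ?q * ?q ^ (2 * k + 1)" using lys by (intro mult_strict_right_mono) auto
    moreover have "power_terms ?q (2 * Suc k) ?K = replicate (length ys) (2 * k + 1)"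
      unfolding two using power_terms_digit[of 0 ?q "2 * k + 1" "length ys"] by (simp add: power_terms_zero)
    ultimately show ?thesis using xs Nil ys
      by (intro exI[of _ ?K]) (auto simp: group_sum_replicate)
  next
    case (Cons y ws)
    have y: "1 \<le> y" "y \<le> d" using Suc.prems(1) xs Cons by auto
    have "sum_list ws < k * (d + 1)" using Suc.prems(2) max xs Cons by auto
    then obtain K where K: "K < ?q ^ (2 * k)" "length ws \<le> length (power_terms ?q (2 * k) K)"
        "\<And>j. group_sum j (power_terms ?q (2 * k) K) ws \<le> d"
      using Suc.IH[of ws] Suc.prems(1) xs Cons by auto
    \<comment> \<open>The block \<open>ys\<close> is group \<open>2 * k + 1\<close>, the element
      \<open>y\<close> that did not fit is group \<open>2 * k\<close> on its own, and the induction
      hypothesis supplies the lower digits.\<close>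
    let ?R = "1 * ?q ^ (2 * k) + K"
    let ?K = "length ys * ?q ^ (Suc (2 * k)) + ?R"
    have "?R < 2 * ?q ^ (2 * k)" using K(1) by simp
    also have "\<dots> \<le> ?q * ?q ^ (2 * k)" using assms(1) by (intro mult_right_mono) auto
    finally have R: "?R < ?q ^ (Suc (2 * k))" by simp
    then have "?K < (length ys + 1) * ?q ^ (Suc (2 * k))" by simp
    also have "\<dots> \<le> ?q * ?q ^ (Suc (2 * k))" using lys by (intro mult_right_mono) auto
    finally have Kless: "?K < ?q ^ (2 * Suc k)" unfolding two by simp
    have deq: "power_terms ?q (2 * Suc k) ?K =
        replicate (length ys) (Suc (2 * k)) @ replicate (length [y]) (2 * k) @ power_terms ?q (2 * k) K"
      unfolding two power_terms_digit[OF R] power_terms_digit[OF K(1)] by simp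
    have notin: "i \<ge> 2 * k \<Longrightarrow> group_sum i (power_terms ?q (2 * k) K) ws = 0" for i
      using power_terms_less[of i ?q "2 * k" K] by (intro group_sum_notin) auto
    have "group_sum j (power_terms ?q (2 * Suc k) ?K) xs \<le> d" for j
    proof -
      have "group_sum j (power_terms ?q (2 * Suc k) ?K) xs =
          group_sum j (replicate (length ys) (Suc (2 * k))) ys +
          (group_sum j (replicate (length [y]) (2 * k)) [y] + group_sum j (power_terms ?q (2 * k) K) ws)"
        unfolding deq xs Cons
        by (subst group_sum_append, simp) (metis append_Cons append_Nil group_sum_append length_replicate)
      then show ?thesis unfolding group_sum_replicate
        using ys y K(3)[of j] notin[of j] by auto
    qed
    moreover have "length xs \<le> length (power_terms ?q (2 * Suc k) ?K)"
      unfolding deq using xs Cons K(2) by simp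
    ultimately show ?thesis using Kless by blast
  qed
qed

section \<open>Reading coefficients from blocks of bits\<close>

lemma power_sum_digit:
  fixes w :: "'a \<Rightarrow> nat" and B :: nat
  assumes F: "finite F" and B: "card F < B"
  shows "(\<Sum>f\<in>F. B ^ w f) div B ^ N mod B = card {f \<in> F. w f = N}"
proof -
  have B0: "B > 0" using B by simp
  \<comment> \<open>With fewer than \<open>B\<close> summands no digit overflows: the powers below
    position \<open>N\<close> sum to less than \<open>B ^ N\<close>, and those above form a multiple
    of \<open>B ^ Suc N\<close>.\<close>
  define L where "L = (\<Sum>f\<in>{f \<in> F. w f < N}. B ^ w f)"
  define H where "H = (\<Sum>f\<in>{f \<in> F. w f > N}. B ^ (w f - Suc N))"
  have H: "(\<Sum>f\<in>{f \<in> F. w f > N}. B ^ w f) = H * B * B ^ N"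
    unfolding H_def sum_distrib_right
    by (rule sum.cong) (auto simp: power_Suc2[symmetric] power_add[symmetric] simp del: power_Suc)
  have "F = {f \<in> F. w f < N} \<union> ({f \<in> F. w f = N} \<union> {f \<in> F. w f > N})" by auto
  then have "(\<Sum>f\<in>F. B ^ w f) = (\<Sum>f\<in>{f \<in> F. w f < N} \<union> ({f \<in> F. w f = N} \<union> {f \<in> F. w f > N}). B ^ w f)"
    by simp
  also have "\<dots> = L + ((\<Sum>f\<in>{f \<in> F. w f = N}. B ^ w f) + (\<Sum>f\<in>{f \<in> F. w f > N}. B ^ w f))"
    unfolding L_def using F by (subst sum.union_disjoint; (subst sum.union_disjoint)?; force)
  also have "\<dots> = (card {f \<in> F. w f = N} + H * B) * B ^ N + L"
    unfolding H by (simp add: algebra_simps)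
  finally have eq: "(\<Sum>f\<in>F. B ^ w f) = (card {f \<in> F. w f = N} + H * B) * B ^ N + L" .
  have "L < B ^ N"
  proof (cases N)
    case (Suc M)
    have "L \<le> (\<Sum>f\<in>{f \<in> F. w f < N}. B ^ M)"
      unfolding L_def using B0 Suc by (intro sum_mono power_increasing) auto
    also have "\<dots> \<le> card F * B ^ M" using F by (auto intro!: mult_right_mono card_mono)
    also have "\<dots> < B * B ^ M" using B B0 by simp
    finally show ?thesis using Suc by simp
  qed (simp add: L_def)
  then have "(\<Sum>f\<in>F. B ^ w f) div B ^ N = card {f \<in> F. w f = N} + H * B"
    unfolding eq using B0 by simp
  moreover have "card {f \<in> F. w f = N} < B"
    using card_mono[OF F, of "{f \<in> F. w f = N}"] B by auto
  ultimately show ?thesis by simp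
qed

text \<open>A digit in base \<open>2 ^ s\<close> is a block of \<open>s\<close> bits and is nonzero
  if one of them is set. Hence single bits can be tested, without computing any coefficient.\<close>

lemma power_sum_bit:
  fixes w :: "'a \<Rightarrow> nat"
  assumes F: "finite F" and B: "card F < 2 ^ s"
  shows "(\<exists>r<s. bit (\<Sum>f\<in>F. (2::nat) ^ (s * w f)) (s * N + r)) \<longleftrightarrow> (\<exists>f\<in>F. w f = N)"
proof -
  let ?Z = "\<Sum>f\<in>F. (2::nat) ^ (s * w f)"
  have "take_bit s (?Z div 2 ^ (s * N)) = card {f \<in> F. w f = N}"
    using power_sum_digit[OF F B, of w N] by (simp add: take_bit_eq_mod power_mult)
  moreover have "take_bit s (?Z div 2 ^ (s * N)) = 0 \<longleftrightarrow> (\<forall>r<s. \<not> bit ?Z (s * N + r))"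
    unfolding drop_bit_eq_div[symmetric]
    by (auto simp: bit_eq_iff bit_take_bit_iff bit_drop_bit_eq)
  moreover have "card {f \<in> F. w f = N} = 0 \<longleftrightarrow> \<not> (\<exists>f\<in>F. w f = N)" using F by auto
  ultimately show ?thesis by auto
qed

section \<open>Trees of bounded degree in the digits of a determinant\<close>

definition edge_weight :: "nat set set \<Rightarrow> (nat \<Rightarrow> nat) \<Rightarrow> nat \<Rightarrow> nat \<Rightarrow> int" where
  "edge_weight E x v u = (if {v, u} \<in> E then 2 ^ (x v + x u) else 0)"

text \<open>The summand 1 accounts for the edges into the sink. It also makes the matrix congruent to the
  identity modulo 2 if all exponents are positive.\<close>

definition forest_matrix :: "nat \<Rightarrow> nat set set \<Rightarrow> (nat \<Rightarrow> nat) \<Rightarrow> nat \<Rightarrow> nat \<Rightarrow> int" where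
  "forest_matrix n E x v u =
     (if v = u then 1 + (\<Sum>t<n. edge_weight E x v t) else - edge_weight E x v u)"

definition forest_exponent :: "nat \<Rightarrow> (nat \<Rightarrow> nat) \<Rightarrow> (nat \<Rightarrow> nat) \<Rightarrow> nat" where
  "forest_exponent n x f = (\<Sum>v = 0..<n. if f v = n then 0 else x v + x (f v))"

definition forest_poly :: "nat \<Rightarrow> nat set set \<Rightarrow> (nat \<Rightarrow> nat) \<Rightarrow> nat" where
  "forest_poly n E x = (\<Sum>f | parent_forest n E f. 2 ^ forest_exponent n x f)"

definition group_degree :: "nat \<Rightarrow> (nat \<Rightarrow> nat) \<Rightarrow> (nat \<Rightarrow> nat) \<Rightarrow> nat \<Rightarrow> nat" where
  "group_degree n g f j = (\<Sum>v | v < n \<and> g v = j. forest_degree n f v)"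

lemma finite_rooted_forests [simp]: "finite (rooted_forests n)"
  by (rule finite_subset[of _ "{0..<n} \<rightarrow>\<^sub>E {0..n}"]) (auto simp: rooted_forests_def intro: finite_PiE)

lemma finite_parent_forests [simp]: "finite {f. parent_forest n E f}"
  by (rule finite_subset[of _ "rooted_forests n"]) (auto simp: parent_forest_def)

text \<open>This bound is the origin of the block length \<open>n * n\<close>. The inequality
  \<open>n + 1 < 2 ^ n\<close> behind it starts at \<open>n = 2\<close>.\<close>

lemma card_parent_forests_less:
  assumes "n \<ge> 2"
  shows "card {f. parent_forest n E f} < 2 ^ (n * n)"
proof -
  have "card {f. parent_forest n E f} \<le> card ({0..<n} \<rightarrow>\<^sub>E {0..n})"
    by (rule card_mono) (auto simp: parent_forest_def rooted_forests_def intro: finite_PiE)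
  also have "\<dots> = (n + 1) ^ n" by (simp add: card_PiE)
  also have "\<dots> < (2 ^ n) ^ n"
  proof (rule power_strict_mono)
    show "n + 1 < 2 ^ n" using assms by (induction n rule: dec_induct) auto
  qed (use assms in auto)
  finally show ?thesis by (simp add: power_mult)
qed

text \<open>\<open>matrix_forest\<close> with weight 1 into the sink. Without loops the weight from
  \<open>v\<close> to \<open>v\<close> is 0, which gives the diagonal its form. All signs are gone
  on the right, so forests cannot cancel each other.\<close>

lemma det_of_forest_matrix:
  assumes loopfree: "\<And>v. {v} \<notin> E"
  shows "det_of n (forest_matrix n E x) = int (forest_poly n E x)"
proof -
  define w where "w v t = (if t = n then 1 else edge_weight E x v t)" for v t
  have entry: "(\<Sum>t = 0..n. w v t * step_row v t u) = forest_matrix n E x v u"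
    if "v < n" "u < n" for v u
  proof -
    have "(\<Sum>t = 0..n. w v t * step_row v t u) =
        (\<Sum>t = 0..n. of_bool (u = v) * w v t) - (\<Sum>t = 0..n. if t = u then w v t else 0)"
      unfolding sum_subtractf[symmetric] by (rule sum.cong) (auto simp: step_row_def)
    also have "\<dots> = of_bool (u = v) * (\<Sum>t = 0..n. w v t) - w v u"
      using that by (simp add: sum_distrib_left)
    also have "(\<Sum>t = 0..n. w v t) = 1 + (\<Sum>t<n. edge_weight E x v t)"
      by (simp add: w_def atLeast0AtMost lessThan_Suc_atMost[symmetric])
    finally show ?thesis
      using that loopfree by (auto simp: forest_matrix_def w_def edge_weight_def)
  qed
  have "det_of n (forest_matrix n E x) = det_of n (\<lambda>v u. \<Sum>t = 0..n. w v t * step_row v t u)"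
    unfolding det_of_def by (intro arg_cong[where f = Determinant.det] eq_matI) (simp_all add: entry)
  also have "\<dots> = (\<Sum>f\<in>rooted_forests n. \<Prod>v = 0..<n. w v (f v))"
    by (rule matrix_forest)
  also have "\<dots> = (\<Sum>f\<in>rooted_forests n. if parent_forest n E f then 2 ^ forest_exponent n x f else 0)"
  proof (rule sum.cong[OF refl])
    fix f assume f: "f \<in> rooted_forests n"
    show "(\<Prod>v = 0..<n. w v (f v)) = (if parent_forest n E f then 2 ^ forest_exponent n x f else 0)"
    proof (cases "parent_forest n E f")
      case True
      then have "(\<Prod>v = 0..<n. w v (f v)) = (\<Prod>v = 0..<n. 2 ^ (if f v = n then 0 else x v + x (f v)))"
        by (intro prod.cong refl) (auto simp: parent_forest_def w_def edge_weight_def)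
      then show ?thesis using True by (simp add: forest_exponent_def power_sum)
    next
      case False
      then obtain v where "v < n" "w v (f v) = 0"
        using f by (auto simp: parent_forest_def w_def edge_weight_def)
      then show ?thesis using False by auto
    qed
  qed
  also have "\<dots> = (\<Sum>f\<in>rooted_forests n \<inter> {f. parent_forest n E f}. 2 ^ forest_exponent n x f)"
    by (subst sum.inter_restrict) auto
  also have "rooted_forests n \<inter> {f. parent_forest n E f} = {f. parent_forest n E f}"
    by (auto simp: parent_forest_def)
  finally show ?thesis by (simp add: forest_poly_def)
qed

text \<open>The weighted handshake lemma, with the vertices collected by groups.\<close>

lemma forest_exponent_groups:
  assumes f: "f \<in> rooted_forests n" and g: "\<And>v. v < n \<Longrightarrow> g v < m"
  shows "forest_exponent n (\<lambda>v. s * q ^ g v) f = s * (\<Sum>j<m. group_degree n g f j * q ^ j)"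
proof -
  have "forest_exponent n (\<lambda>v. s * q ^ g v) f = (\<Sum>v = 0..<n. forest_degree n f v * (s * q ^ g v))"
    unfolding forest_exponent_def by (rule sum_forest_degree_weighted[OF f, symmetric])
  also have "\<dots> = (\<Sum>j<m. \<Sum>v | v \<in> {0..<n} \<and> g v = j. forest_degree n f v * (s * q ^ g v))"
    using g by (intro sum.group[symmetric]) auto
  also have "\<dots> = (\<Sum>j<m. s * (group_degree n g f j * q ^ j))"
    unfolding group_degree_def sum_distrib_right sum_distrib_left
    by (intro sum.cong) auto
  finally show ?thesis by (simp add: sum_distrib_left)
qed

lemma sum_group_degree:
  assumes f: "f \<in> rooted_forests n" and g: "\<And>v. v < n \<Longrightarrow> g v < m"
  shows "(\<Sum>j<m. group_degree n g f j) = 2 * card {v \<in> {0..<n}. f v \<noteq> n}"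
proof -
  have "(\<Sum>j<m. group_degree n g f j) = (\<Sum>j<m. \<Sum>v | v \<in> {0..<n} \<and> g v = j. forest_degree n f v)"
    unfolding group_degree_def by (intro sum.cong) auto
  also have "\<dots> = (\<Sum>v = 0..<n. forest_degree n f v)"
    using g by (intro sum.group) auto
  finally show ?thesis using sum_forest_degree[OF f] by simp
qed

lemma forest_poly_bit:
  assumes n: "n \<ge> 2" and g: "\<And>v. v < n \<Longrightarrow> g v < m"
  shows "(\<exists>r<n * n. bit (forest_poly n E (\<lambda>v. n * n * q ^ g v)) (n * n * N + r)) \<longleftrightarrow>
    (\<exists>f. parent_forest n E f \<and> (\<Sum>j<m. group_degree n g f j * q ^ j) = N)"
proof -
  have "forest_poly n E (\<lambda>v. n * n * q ^ g v) =
      (\<Sum>f | parent_forest n E f. 2 ^ (n * n * (\<Sum>j<m. group_degree n g f j * q ^ j)))"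
    unfolding forest_poly_def
    using forest_exponent_groups[OF _ g, where s = "n * n" and q = q]
    by (intro sum.cong) (auto simp: parent_forest_def)
  then show ?thesis
    using power_sum_bit[OF finite_parent_forests card_parent_forests_less[OF n]] by simp
qed

text \<open>Soundness for every grouping, good or bad. The bit yields a forest with
  \<open>2 * n - 2 \<le>\<close> sum of the group degrees, while a forest has total degree at most
  \<open>2 * n - 2\<close>. Equality makes it a tree and excludes carries, so each group degree, and
  with it each vertex degree, is at most \<open>d\<close>.\<close>

lemma bit_imp_bounded_tree:
  assumes n: "n \<ge> 2" and d: "d \<ge> 1" and g: "\<And>v. v < n \<Longrightarrow> g v < m"
    and b: "b < n * n * (d + 1) ^ m" "bit (forest_poly n E (\<lambda>v. n * n * (d + 1) ^ g v)) b"
    and len: "length (power_terms (d + 1) m (b div (n * n))) = 2 * n - 2"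
  shows "\<exists>f. parent_tree n E f \<and> (\<forall>v<n. forest_degree n f v \<le> d)"
proof -
  let ?N = "b div (n * n)"
  have "bit (forest_poly n E (\<lambda>v. n * n * (d + 1) ^ g v)) (n * n * ?N + b mod (n * n))"
    using b(2) by simp
  moreover have "b mod (n * n) < n * n" using n by simp
  ultimately obtain f where f: "parent_forest n E f"
      and N: "(\<Sum>j<m. group_degree n g f j * (d + 1) ^ j) = ?N"
    using forest_poly_bit[OF n, where g = g and m = m] g by blast
  have rf: "f \<in> rooted_forests n" using f by (simp add: parent_forest_def)
  have "?N < (d + 1) ^ m" using b(1) by (simp add: less_mult_imp_div_less mult.commute)
  then have L: "2 * n - 2 \<le> (\<Sum>j<m. group_degree n g f j)"
      "2 * n - 2 = (\<Sum>j<m. group_degree n g f j) \<Longrightarrow> \<forall>j<m. group_degree n g f j < d + 1"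
    using length_power_terms_le[of "d + 1" ?N m "group_degree n g f" 0] d N len by auto
  have "(\<Sum>j<m. group_degree n g f j) = 2 * card {v \<in> {0..<n}. f v \<noteq> n}"
    using sum_group_degree[OF rf, of g m] g by blast
  moreover have "card {v \<in> {0..<n}. f v \<noteq> n} \<le> n - 1" using card_nonroots_le[OF rf] n by simp
  ultimately have c: "card {v \<in> {0..<n}. f v \<noteq> n} = n - 1"
    and eq: "2 * n - 2 = (\<Sum>j<m. group_degree n g f j)"
    using L(1) n by linarith+
  have "forest_degree n f v \<le> d" if v: "v < n" for v
  proof -
    have "forest_degree n f v \<le> group_degree n g f (g v)"
      unfolding group_degree_def using v by (intro member_le_sum) auto
    then show ?thesis using L(2)[OF eq] g[OF v] by fastforce
  qed
  then show ?thesis using f c by (auto simp: parent_tree_def)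
qed

text \<open>Completeness for a good grouping: group degrees of at most \<open>d\<close> are
  themselves the digits of the position.\<close>

lemma bounded_tree_imp_bit:
  assumes n: "n \<ge> 2" and d: "d \<ge> 1" and g: "\<And>v. v < n \<Longrightarrow> g v < m"
    and f: "parent_tree n E f" and deg: "\<And>j. group_degree n g f j \<le> d"
  shows "\<exists>b < n * n * (d + 1) ^ m. bit (forest_poly n E (\<lambda>v. n * n * (d + 1) ^ g v)) b \<and>
    length (power_terms (d + 1) m (b div (n * n))) = 2 * n - 2"
proof -
  let ?N = "\<Sum>j<m. group_degree n g f j * (d + 1) ^ j"
  have pf: "parent_forest n E f" and rf: "f \<in> rooted_forests n"
    and c: "card {v \<in> {0..<n}. f v \<noteq> n} = n - 1"
    using f by (auto simp: parent_tree_def parent_forest_def)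
  obtain r where r: "r < n * n" "bit (forest_poly n E (\<lambda>v. n * n * (d + 1) ^ g v)) (n * n * ?N + r)"
    using forest_poly_bit[OF n, where g = g and m = m and N = ?N and q = "d + 1"] g pf by blast
  have deg': "group_degree n g f j < d + 1" for j using deg[of j] by simp
  have N: "?N < (d + 1) ^ m" "length (power_terms (d + 1) m ?N) = 2 * n - 2"
    using length_power_terms_sum[of "d + 1" m "group_degree n g f"] d deg' c n
      sum_group_degree[OF rf g] by auto
  have "n * n * ?N + r < n * n * (?N + 1)" using r(1) by simp
  also have "\<dots> \<le> n * n * (d + 1) ^ m" using N(1) by (intro mult_left_mono) auto
  finally have "n * n * ?N + r < n * n * (d + 1) ^ m" .
  moreover have "(n * n * ?N + r) div (n * n) = ?N" using r(1) n by simp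
  ultimately show ?thesis using r(2) N(2) by metis
qed

text \<open>An isolated vertex would be the only root and have no children; then a vertex of least
  rank among the others has no possible parent. Next fit needs the lower bound 1 to limit the sizes
  of the groups.\<close>

lemma parent_tree_degree_pos:
  assumes n: "n \<ge> 2" and f: "parent_tree n E f" and v: "v < n"
  shows "forest_degree n f v \<ge> 1"
proof (rule ccontr)
  assume "\<not> ?thesis"
  then have zero: "of_bool (f v \<noteq> n) + card {u \<in> {0..<n}. f u = v} = 0"
    unfolding forest_degree_def by linarith
  then have root: "f v = n" by (cases "f v = n") simp_all
  have "{u \<in> {0..<n}. f u = v} = {}" using zero by (subst card_0_eq[symmetric]) auto
  then have leaf: "f u \<noteq> v" if "u < n" for u using that by auto
  have rf: "f \<in> rooted_forests n" and c: "card {v \<in> {0..<n}. f v \<noteq> n} = n - 1"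
    using f by (auto simp: parent_tree_def parent_forest_def)
  have nonroots: "{u \<in> {0..<n}. f u \<noteq> n} = {0..<n} - {v}"
    using root v c by (intro card_subset_eq) auto
  have only: "f u \<noteq> n" if "u < n" "u \<noteq> v" for u
  proof -
    have "u \<in> {u \<in> {0..<n}. f u \<noteq> n}" unfolding nonroots using that by simp
    then show ?thesis by simp
  qed
  obtain h :: "nat \<Rightarrow> nat" where h: "\<And>v. v < n \<Longrightarrow> h (f v) < h v"
    using rf reaches_sink_rank[of n f] by (auto simp: rooted_forests_def)
  have "\<exists>u. u < n \<and> u \<noteq> v"
    using n v by (intro exI[of _ "if v = 0 then 1 else 0"]) auto
  then obtain u where u: "u < n" "u \<noteq> v" and least: "\<And>u'. u' < n \<Longrightarrow> u' \<noteq> v \<Longrightarrow> h u \<le> h u'"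
    using ex_has_least_nat[of "\<lambda>u. u < n \<and> u \<noteq> v" _ h] by blast
  have "f u < n" using rooted_forests_le[OF rf u(1)] only[OF u] by simp
  then show False using least[of "f u"] leaf[OF u(1)] h[OF u(1)] by simp
qed

text \<open>Next fit with \<open>2 * k\<close> groups applies because the total degree
  \<open>2 * n - 2\<close> is less than \<open>2 * n \<le> k * (d + 1)\<close>.\<close>

lemma bounded_tree_grouping:
  assumes n: "n \<ge> 2" and d: "d \<ge> 1" and k: "2 * n \<le> k * (d + 1)"
    and f: "parent_tree n E f" and deg: "\<And>v. v < n \<Longrightarrow> forest_degree n f v \<le> d"
  shows "\<exists>K < (d + 1) ^ (2 * k). n \<le> length (power_terms (d + 1) (2 * k) K) \<and>
    (\<forall>j. group_degree n (\<lambda>v. power_terms (d + 1) (2 * k) K ! v) f j \<le> d)"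
proof -
  have rf: "f \<in> rooted_forests n" and c: "card {v \<in> {0..<n}. f v \<noteq> n} = n - 1"
    using f by (auto simp: parent_tree_def parent_forest_def)
  have "sum_list (map (forest_degree n f) [0..<n]) = (\<Sum>v = 0..<n. forest_degree n f v)"
    by (simp add: interv_sum_list_conv_sum_set_nat)
  also have "\<dots> < k * (d + 1)" using sum_forest_degree[OF rf] c k n by simp
  finally have total: "sum_list (map (forest_degree n f) [0..<n]) < k * (d + 1)" .
  have range: "1 \<le> x \<and> x \<le> d" if "x \<in> set (map (forest_degree n f) [0..<n])" for x
    using that deg parent_tree_degree_pos[OF n f] by auto
  obtain K where "K < (d + 1) ^ (2 * k)" "n \<le> length (power_terms (d + 1) (2 * k) K)"
      "\<And>j. group_sum j (power_terms (d + 1) (2 * k) K) (map (forest_degree n f) [0..<n]) \<le> d"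
    using next_fit[OF d range total] by auto
  then show ?thesis
    using group_sum_conv_sum[of n "power_terms (d + 1) (2 * k) K"] by (auto simp: group_degree_def)
qed

section \<open>A program logic with loop bounds\<close>

text \<open>A static bound that is independent of the state: both branches of a conditional are
  added up, and each loop is charged \<open>L\<close> iterations.\<close>

fun cost :: "nat \<Rightarrow> com \<Rightarrow> nat" where
  "cost L Skip = 1"
| "cost L (Assign x i a) = acost i + acost a + 1"
| "cost L (Flip x i) = acost i + 1"
| "cost L (Seq c1 c2) = cost L c1 + cost L c2"
| "cost L (If b c1 c2) = bcost b + 1 + (cost L c1 + cost L c2)"
| "cost L (While b c) = L * (bcost b + 1 + cost L c) + (bcost b + 1)"

fun mods :: "com \<Rightarrow> vname set" where
  "mods Skip = {}"
| "mods (Assign x i a) = {x}"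
| "mods (Flip x i) = {x}"
| "mods (Seq c1 c2) = mods c1 \<union> mods c2"
| "mods (If b c1 c2) = mods c1 \<union> mods c2"
| "mods (While b c) = mods c"

text \<open>The only time analysis needed: for a fixed program it remains to bound the iterations of
  every loop by a common \<open>L\<close>.\<close>

lemma cost_polynomial: "\<exists>C k. \<forall>L\<ge>1. cost L c \<le> C * L ^ k"
proof (induction c)
  case Skip
  then show ?case by (intro exI[of _ 1] exI[of _ 0]) simp
next
  case (Assign x i a)
  then show ?case by (intro exI[of _ "acost i + acost a + 1"] exI[of _ 0]) simp
next
  case (Flip x i)
  then show ?case by (intro exI[of _ "acost i + 1"] exI[of _ 0]) simp
next
  case (Seq c1 c2)
  then obtain C1 k1 C2 k2 where *: "\<And>L. L \<ge> 1 \<Longrightarrow> cost L c1 \<le> C1 * L ^ k1"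
      "\<And>L. L \<ge> 1 \<Longrightarrow> cost L c2 \<le> C2 * L ^ k2" by metis
  have "cost L (Seq c1 c2) \<le> (C1 + C2) * L ^ (k1 + k2)" if "L \<ge> 1" for L
  proof -
    have "C1 * L ^ k1 \<le> C1 * L ^ (k1 + k2)" "C2 * L ^ k2 \<le> C2 * L ^ (k1 + k2)"
      using that by (auto intro!: mult_left_mono power_increasing)
    then show ?thesis using *[OF that] unfolding cost.simps add_mult_distrib by linarith
  qed
  then show ?case by blast
next
  case (If b c1 c2)
  then obtain C1 k1 C2 k2 where *: "\<And>L. L \<ge> 1 \<Longrightarrow> cost L c1 \<le> C1 * L ^ k1"
      "\<And>L. L \<ge> 1 \<Longrightarrow> cost L c2 \<le> C2 * L ^ k2" by metis
  have "cost L (If b c1 c2) \<le> (bcost b + 1 + C1 + C2) * L ^ (k1 + k2)" if "L \<ge> 1" for L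
  proof -
    have "C1 * L ^ k1 \<le> C1 * L ^ (k1 + k2)" "C2 * L ^ k2 \<le> C2 * L ^ (k1 + k2)"
      using that by (auto intro!: mult_left_mono power_increasing)
    moreover have "1 \<le> L ^ (k1 + k2)" using that by simp
    then have "bcost b + 1 \<le> (bcost b + 1) * L ^ (k1 + k2)"
      using mult_le_mono2[of 1 "L ^ (k1 + k2)" "bcost b + 1"] by simp
    ultimately have "cost L (If b c1 c2) \<le>
        (bcost b + 1) * L ^ (k1 + k2) + (C1 * L ^ (k1 + k2) + C2 * L ^ (k1 + k2))"
      unfolding cost.simps using *[OF that] by (intro add_mono) (meson order_trans)+
    then show ?thesis by (simp only: add_mult_distrib add.assoc)
  qed
  then show ?case by blast
next
  case (While b c)
  then obtain C k where *: "\<And>L. L \<ge> 1 \<Longrightarrow> cost L c \<le> C * L ^ k" by metis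
  have "cost L (While b c) \<le> (2 * (bcost b + 1) + C) * L ^ Suc k" if "L \<ge> 1" for L
  proof -
    have "1 \<le> L ^ Suc k" "L \<le> L ^ Suc k" using that by auto
    then have "(bcost b + 1) * 1 \<le> (bcost b + 1) * L ^ Suc k"
        "L * (bcost b + 1) \<le> (bcost b + 1) * L ^ Suc k"
      by (metis mult_le_mono2, metis mult.commute mult_le_mono2)
    moreover have "L * cost L c \<le> C * L ^ Suc k"
      using mult_le_mono2[OF *[OF that], of L] by (simp add: ac_simps)
    ultimately show ?thesis unfolding cost.simps by (simp add: algebra_simps del: power_Suc)
  qed
  then show ?case by blast
qed

text \<open>Total correctness of runs that flip no coins; \<open>L\<close> bounds the number of iterations of every
  single loop.\<close>

definition wp :: "nat \<Rightarrow> com \<Rightarrow> state \<Rightarrow> (state \<Rightarrow> bool) \<Rightarrow> bool" where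
  "wp L c s Q \<longleftrightarrow> (\<exists>s' t. (\<forall>\<omega>. exec c s \<omega> t s' \<omega>) \<and> t \<le> cost L c \<and> Q s')"

lemma wp_mono: "wp L c s Q \<Longrightarrow> (\<And>s'. Q s' \<Longrightarrow> Q' s') \<Longrightarrow> wp L c s Q'"
  unfolding wp_def by blast

lemma wp_Skip: "Q s \<Longrightarrow> wp L Skip s Q"
  unfolding wp_def cost.simps by (blast intro: exec_Skip)

lemma wp_Assign: "Q (update s x (aval i s) (aval a s)) \<Longrightarrow> wp L (Assign x i a) s Q"
  unfolding wp_def cost.simps by (blast intro: exec.intros)

lemma wp_Seq:
  assumes "wp L c1 s (\<lambda>s'. wp L c2 s' Q)"
  shows "wp L (Seq c1 c2) s Q"
proof -
  obtain s1 t1 where 1: "\<And>\<omega>. exec c1 s \<omega> t1 s1 \<omega>" "t1 \<le> cost L c1" "wp L c2 s1 Q"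
    using assms unfolding wp_def by blast
  then obtain s2 t2 where 2: "\<And>\<omega>. exec c2 s1 \<omega> t2 s2 \<omega>" "t2 \<le> cost L c2" "Q s2"
    unfolding wp_def by blast
  have "exec (Seq c1 c2) s \<omega> (t1 + t2) s2 \<omega>" for \<omega> using 1(1) 2(1) by (rule exec_Seq)
  moreover have "t1 + t2 \<le> cost L (Seq c1 c2)" using 1(2) 2(2) by simp
  ultimately show ?thesis unfolding wp_def using 2(3) by blast
qed

lemma wp_If:
  assumes "bval b s \<Longrightarrow> wp L c1 s Q" "\<not> bval b s \<Longrightarrow> wp L c2 s Q"
  shows "wp L (If b c1 c2) s Q"
proof (cases "bval b s")
  case True
  then obtain s' t where *: "\<And>\<omega>. exec c1 s \<omega> t s' \<omega>" "t \<le> cost L c1" "Q s'"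
    using assms(1) unfolding wp_def by blast
  have "exec (If b c1 c2) s \<omega> (bcost b + 1 + t) s' \<omega>" for \<omega> using True *(1) by (rule exec_IfTrue)
  moreover have "bcost b + 1 + t \<le> cost L (If b c1 c2)" using *(2) by simp
  ultimately show ?thesis unfolding wp_def using *(3) by blast
next
  case False
  then obtain s' t where *: "\<And>\<omega>. exec c2 s \<omega> t s' \<omega>" "t \<le> cost L c2" "Q s'"
    using assms(2) unfolding wp_def by blast
  have "exec (If b c1 c2) s \<omega> (bcost b + 1 + t) s' \<omega>" for \<omega> using False *(1) by (rule exec_IfFalse)
  moreover have "bcost b + 1 + t \<le> cost L (If b c1 c2)" using *(2) by simp
  ultimately show ?thesis unfolding wp_def using *(3) by blast
qed

lemma exec_mods: "exec c s \<omega> t s' \<omega>' \<Longrightarrow> x \<notin> mods c \<Longrightarrow> s' x = s x"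
  by (induction rule: exec.induct) (auto simp: update_def)

definition agree :: "vname set \<Rightarrow> state \<Rightarrow> state \<Rightarrow> bool" where
  "agree X s s' \<longleftrightarrow> (\<forall>x. x \<notin> X \<longrightarrow> s' x = s x)"

lemma agreeD: "agree X s s' \<Longrightarrow> x \<notin> X \<Longrightarrow> s' x = s x"
  by (simp add: agree_def)

lemma wp_frame: "wp L c s Q \<Longrightarrow> wp L c s (\<lambda>s'. Q s' \<and> agree (mods c) s s')"
  unfolding wp_def agree_def using exec_mods by blast

abbreviation seq_infix :: "com \<Rightarrow> com \<Rightarrow> com" (infixr ";;" 60) where "c1 ;; c2 \<equiv> Seq c1 c2"

abbreviation Var :: "vname \<Rightarrow> aexp" where "Var x \<equiv> Get x (Lit 0)"

abbreviation Set :: "vname \<Rightarrow> aexp \<Rightarrow> com" where "Set x a \<equiv> Assign x (Lit 0) a"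

definition For :: "vname \<Rightarrow> aexp \<Rightarrow> com \<Rightarrow> com" where
  "For i e c = Seq (Set i (Lit 0)) (While (Less (Var i) e) (Seq c (Set i (Add (Var i) (Lit 1)))))"

lemma mods_For [simp]: "mods (For i e c) = insert i (mods c)"
  by (auto simp: For_def)

text \<open>The counter is set and incremented outside \<open>c\<close>, so \<open>I\<close> must
  not depend on its cell (\<open>upd\<close>). Agreement with the initial state on unmodified arrays
  is carried along, which keeps such facts out of the invariants.\<close>

lemma wp_For:
  assumes N: "N \<le> L" and i: "i \<notin> mods c"
    and e: "\<And>s'. agree (insert i (mods c)) s s' \<Longrightarrow> aval e s' = int N"
    and step: "\<And>k s'. k < N \<Longrightarrow> agree (insert i (mods c)) s s' \<Longrightarrow> s' i 0 = int k \<Longrightarrow> I k s' \<Longrightarrow>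
      wp L c s' (I (Suc k))"
    and upd: "\<And>k s' v. I k s' \<Longrightarrow> I k (update s' i 0 v)"
    and init: "I 0 s"
  shows "wp L (For i e c) s (\<lambda>s'. I N s' \<and> agree (insert i (mods c)) s s')"
proof -
  let ?b = "Less (Var i) e"
  let ?body = "Seq c (Set i (Add (Var i) (Lit 1)))"
  let ?X = "insert i (mods c)"
  have loop: "\<exists>s'' t. (\<forall>\<omega>. exec (While ?b ?body) s' \<omega> t s'' \<omega>) \<and>
      t \<le> (N - k) * (bcost ?b + 1 + cost L ?body) + (bcost ?b + 1) \<and> I N s'' \<and> agree ?X s s''"
    if "k \<le> N" "agree ?X s s'" "s' i 0 = int k" "I k s'" for k s'
    using that
  proof (induction "N - k" arbitrary: k s')
    case 0
    then have "\<not> bval ?b s'" using e[OF 0(3)] by simp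
    then have "exec (While ?b ?body) s' \<omega> (bcost ?b + 1) s' \<omega>" for \<omega> by (rule exec_WhileFalse)
    then show ?case using 0 by auto
  next
    case (Suc r)
    then have kN: "k < N" by simp
    then have b: "bval ?b s'" using e[OF Suc.prems(2)] Suc.prems(3) by simp
    obtain s1 t1 where 1: "\<And>\<omega>. exec c s' \<omega> t1 s1 \<omega>" "t1 \<le> cost L c" "I (Suc k) s1"
        "agree (mods c) s' s1"
      using wp_frame[OF step[OF kN Suc.prems(2-4)]] unfolding wp_def by blast
    let ?s2 = "update s1 i 0 (s1 i 0 + 1)"
    have "exec (Set i (Add (Var i) (Lit 1))) s1 \<omega> (cost L (Set i (Add (Var i) (Lit 1)))) ?s2 \<omega>" for \<omega>
      using exec_Assign[of i "Lit 0" "Add (Var i) (Lit 1)" s1 \<omega>] by simp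
    then have body: "exec ?body s' \<omega> (t1 + cost L (Set i (Add (Var i) (Lit 1)))) ?s2 \<omega>" for \<omega>
      using 1(1) by (rule exec_Seq[rotated])
    have "s1 i 0 = int k" using agreeD[OF 1(4) i] Suc.prems(3) by simp
    then have i2: "?s2 i 0 = int (Suc k)" by (simp add: update_def)
    have agree2: "agree ?X s ?s2"
      using Suc.prems(2) 1(4) by (auto simp: agree_def update_def)
    have "r = N - Suc k" using Suc.hyps(2) by simp
    from Suc.hyps(1)[OF this Suc_leI[OF kN] agree2 i2 upd[OF 1(3)]]
    obtain s3 t3 where 3: "\<And>\<omega>. exec (While ?b ?body) ?s2 \<omega> t3 s3 \<omega>"
        "t3 \<le> (N - Suc k) * (bcost ?b + 1 + cost L ?body) + (bcost ?b + 1)" "I N s3" "agree ?X s s3"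
      by blast
    have "exec (While ?b ?body) s' \<omega> (bcost ?b + 1 + (t1 + cost L (Set i (Add (Var i) (Lit 1)))) + t3) s3 \<omega>"
      for \<omega> using b body 3(1) by (rule exec_WhileTrue)
    moreover have "N - k = Suc (N - Suc k)" using kN by simp
    then have "bcost ?b + 1 + (t1 + cost L (Set i (Add (Var i) (Lit 1)))) + t3
        \<le> (N - k) * (bcost ?b + 1 + cost L ?body) + (bcost ?b + 1)"
      using 1(2) 3(2) by simp
    ultimately show ?case using 3(3,4) by blast
  qed
  let ?s0 = "update s i 0 0"
  have "agree ?X s ?s0" "?s0 i 0 = int 0" by (auto simp: agree_def update_def)
  from loop[OF _ this upd[OF init]] obtain s' t where 4:
      "\<And>\<omega>. exec (While ?b ?body) ?s0 \<omega> t s' \<omega>"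
      "t \<le> N * (bcost ?b + 1 + cost L ?body) + (bcost ?b + 1)" "I N s'" "agree ?X s s'" by auto
  have "exec (Set i (Lit 0)) s \<omega> (cost L (Set i (Lit 0))) ?s0 \<omega>" for \<omega>
    using exec_Assign[of i "Lit 0" "Lit 0" s \<omega>] by simp
  then have "exec (For i e c) s \<omega> (cost L (Set i (Lit 0)) + t) s' \<omega>" for \<omega>
    unfolding For_def using 4(1) by (rule exec_Seq)
  moreover have "cost L (Set i (Lit 0)) + t \<le> cost L (For i e c)"
    using 4(2) mult_right_mono[OF N, of "bcost ?b + 1 + cost L ?body"]
    unfolding For_def cost.simps(4,6) by simp
  ultimately show ?thesis unfolding wp_def using 4(3,4) by blast
qed

section \<open>Modular multiplication and decoding of groupings\<close>

text \<open>The arrays are \<open>ex\<close> with the exponents \<open>n\<^sup>2 (d + 1)\<^sup>j\<close> of 2 that stand for the variables of the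
  groups \<open>j\<close>, \<open>p2\<close> with the powers of 2, \<open>x\<close> with the exponents of the vertices, and \<open>A\<close> with the
  matrix; \<open>L\<close> is the number of bits of the modulus \<open>M\<close>.\<close>

definition reduce :: "vname \<Rightarrow> com" where
  "reduce x = If (Less (Var x) (Var ''M'')) Skip (Set x (Sub (Var x) (Var ''M'')))"

text \<open>One Horner step of double-and-add: the bits of \<open>mb\<close> are peeled off from the
  top by comparison with the table of powers.\<close>

definition mul_body :: com where
  "mul_body =
     Set ''mr'' (Add (Var ''mr'') (Var ''mr'')) ;;
     reduce ''mr'' ;;
     Set ''mk'' (Sub (Sub (Var ''L'') (Var ''mi'')) (Lit 1)) ;;
     If (Less (Var ''mb'') (Get ''p2'' (Var ''mk''))) Skip
       (Set ''mb'' (Sub (Var ''mb'') (Get ''p2'' (Var ''mk''))) ;;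
        Set ''mr'' (Add (Var ''mr'') (Var ''ma'')) ;;
        reduce ''mr'')"

definition mul :: com where
  "mul =
     Set ''mr'' (Lit 0) ;;
     For ''mi'' (Var ''L'') mul_body"

definition mul_to :: "vname \<Rightarrow> aexp \<Rightarrow> aexp \<Rightarrow> com" where
  "mul_to x a b = Set ''ma'' a ;; Set ''mb'' b ;; mul ;; Set x (Var ''mr'')"

text \<open>Greedy extraction of a digit by repeated subtraction. A step that cannot subtract
  changes nothing, so \<open>d\<close> repetitions handle any digit up to \<open>d\<close>. The
  counter \<open>v\<close> ends up as the digit sum.\<close>

definition decode_step :: "vname \<Rightarrow> com" where
  "decode_step a =
     If (Less (Var ''K'') (Get ''ex'' (Var ''dg''))) Skip
       (Set ''K'' (Sub (Var ''K'') (Get ''ex'' (Var ''dg''))) ;;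
        Assign a (Var ''v'') (Get ''ex'' (Var ''dg'')) ;;
        Set ''v'' (Add (Var ''v'') (Lit 1)))"

definition decode_body :: "vname \<Rightarrow> com" where
  "decode_body a =
     Set ''dg'' (Sub (Sub (Var ''m'') (Var ''dj'')) (Lit 1)) ;;
     For ''dt'' (Var ''d'') (decode_step a)"

definition decode :: "vname \<Rightarrow> com" where
  "decode a = Set ''v'' (Lit 0) ;; For ''dj'' (Var ''m'') (decode_body a)"

lemma mods_reduce [simp]: "mods (reduce x) = {x}" by (simp add: reduce_def)

lemma mods_mul_body [simp]: "mods mul_body = {''mr'', ''mk'', ''mb''}"
  by (auto simp: mul_body_def)

lemma mods_mul [simp]: "mods mul = {''mr'', ''mi'', ''mk'', ''mb''}"
  by (auto simp: mul_def)

lemma mods_mul_to [simp]: "mods (mul_to x a b) = {''ma'', ''mb'', ''mr'', ''mi'', ''mk'', x}"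
  by (auto simp: mul_to_def)

lemma mods_decode_step [simp]: "mods (decode_step a) = {''K'', a, ''v''}"
  by (auto simp: decode_step_def)

lemma mods_decode_body [simp]: "mods (decode_body a) = {''dg'', ''dt'', ''K'', a, ''v''}"
  by (auto simp: decode_body_def)

lemma mods_decode [simp]: "mods (decode a) = {''v'', ''dj'', ''dg'', ''dt'', ''K'', a}"
  by (auto simp: decode_def)

lemma mod_mult_div_eq: "0 < b \<Longrightarrow> a mod (b * c) div b = a div b mod c" for a b c :: nat
  by (simp add: mod_mult2_eq)

lemma mod_if_less_double:
  fixes x M :: int
  assumes "0 \<le> x" "x < 2 * M"
  shows "x mod M = (if x < M then x else x - M)"
proof (cases "x < M")
  case False
  then have "x mod M = (x - M) mod M" by simp
  also have "\<dots> = x - M" using False assms by (intro mod_pos_pos_trivial) auto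
  finally show ?thesis using False by simp
qed (use assms in simp)

lemma wp_reduce:
  assumes "s ''M'' 0 = M" "0 \<le> s x 0" "s x 0 < 2 * M" "x \<noteq> ''M''"
    and "Q (update s x 0 (s x 0 mod M))"
  shows "wp L (reduce x) s Q"
  unfolding reduce_def
proof (rule wp_If)
  assume "bval (Less (Var x) (Var ''M'')) s"
  then have "update s x 0 (s x 0 mod M) = s"
    using assms by (simp add: update_def)
  then show "wp L Skip s Q" using assms(5) by (intro wp_Skip) simp
next
  assume "\<not> bval (Less (Var x) (Var ''M'')) s"
  then have "s x 0 mod M = s x 0 - M"
    using assms mod_if_less_double[of "s x 0" M] by simp
  then show "wp L (Set x (Sub (Var x) (Var ''M''))) s Q"
    using assms by (intro wp_Assign) simp
qed

text \<open>Comparing the low \<open>r + 1\<close> bits with \<open>2 ^ r\<close> reads bit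
  \<open>r\<close>; both the multiplication and the scan of the determinant work in this
  way.\<close>

lemma top_bit_step:
  fixes b :: int
  assumes "b \<ge> 0"
  shows "b mod 2 ^ Suc r < 2 ^ r \<Longrightarrow> b mod 2 ^ r = b mod 2 ^ Suc r \<and> b div 2 ^ r = 2 * (b div 2 ^ Suc r)"
    and "\<not> b mod 2 ^ Suc r < 2 ^ r \<Longrightarrow>
      b mod 2 ^ r = b mod 2 ^ Suc r - 2 ^ r \<and> b div 2 ^ r = 2 * (b div 2 ^ Suc r) + 1"
proof -
  define c where "c = b div 2 ^ r"
  have 1: "b mod 2 ^ Suc r = 2 ^ r * (c mod 2) + b mod 2 ^ r"
    using mod_mult2_eq'[of b "2 ^ r" 2] by (simp add: c_def mult.commute zmod_zmult2_eq)
  have 2: "b div 2 ^ Suc r = c div 2"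
    unfolding c_def power_Suc2 by (rule zdiv_zmult2_eq) simp
  define x where "x = b mod 2 ^ r"
  have 3: "0 \<le> x" "x < 2 ^ r" by (simp_all add: x_def)
  have 4: "c mod 2 = 0 \<and> c = 2 * (c div 2) \<or> c mod 2 = 1 \<and> c = 2 * (c div 2) + 1" by presburger
  show "b mod 2 ^ Suc r < 2 ^ r \<Longrightarrow> b mod 2 ^ r = b mod 2 ^ Suc r \<and> b div 2 ^ r = 2 * (b div 2 ^ Suc r)"
    using 3 4 unfolding 1 2 c_def[symmetric] x_def[symmetric] by auto
  show "\<not> b mod 2 ^ Suc r < 2 ^ r \<Longrightarrow>
      b mod 2 ^ r = b mod 2 ^ Suc r - 2 ^ r \<and> b div 2 ^ r = 2 * (b div 2 ^ Suc r) + 1"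
    using 3 4 unfolding 1 2 c_def[symmetric] x_def[symmetric] by auto
qed

locale machine =
  fixes n d m :: nat and E :: "nat set set"
  assumes n: "n \<ge> 2" and d: "1 \<le> d" "d \<le> n" and m: "1 \<le> m" and E: "simple_graph {0..<n} E"
begin

text \<open>One block of \<open>n * n\<close> bits for each of the \<open>(d + 1) ^ m\<close>
  positions. The same number serves as the bound for all loops and as the number of guesses.\<close>

definition B :: nat where "B = n * n * (d + 1) ^ m"

text \<open>The table \<open>ex\<close> includes index \<open>m\<close>, because \<open>ex\<close>
  at \<open>m\<close> is \<open>B\<close> and provides the value of \<open>L\<close>.\<close>

definition env :: "state \<Rightarrow> bool" where
  "env s \<longleftrightarrow> s ''n'' 0 = int n \<and> s ''d'' 0 = int d \<and> s ''m'' 0 = int m \<and>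
     (\<forall>j\<le>m. s ''ex'' (int j) = int (n * n * (d + 1) ^ j)) \<and> s ''L'' 0 = int B \<and>
     (\<forall>i\<le>B. s ''p2'' (int i) = 2 ^ i) \<and> s ''M'' 0 = 2 ^ B \<and>
     (\<forall>u<n. \<forall>v<n. s ''adj'' (int (u * n + v)) = of_bool ({u, v} \<in> E))"

lemma envD:
  assumes "env s"
  shows "s ''n'' 0 = int n" "s ''d'' 0 = int d" "s ''m'' 0 = int m" "s ''L'' 0 = int B"
    "s ''M'' 0 = 2 ^ B" "j \<le> m \<Longrightarrow> s ''ex'' (int j) = int (n * n * (d + 1) ^ j)"
    "i \<le> B \<Longrightarrow> s ''p2'' (int i) = 2 ^ i"
    "u < n \<Longrightarrow> v < n \<Longrightarrow> s ''adj'' (int (u * n + v)) = of_bool ({u, v} \<in> E)"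
  using assms by (auto simp: env_def)

lemma env_agree:
  assumes "env s" "agree X s s'" "X \<inter> {''n'', ''d'', ''m'', ''ex'', ''L'', ''p2'', ''M'', ''adj''} = {}"
  shows "env s'"
proof -
  have "s' x = s x" if "x \<in> {''n'', ''d'', ''m'', ''ex'', ''L'', ''p2'', ''M'', ''adj''}" for x
    using assms(2,3) that by (auto simp: agree_def)
  then show ?thesis using assms(1) unfolding env_def by simp
qed

lemma bounds: "n \<le> B" "2 * n \<le> B" "m \<le> B" "d \<le> B" "d + 1 \<le> B" "1 \<le> B"
proof -
  have "m < 2 ^ m" by simp
  also have "(2::nat) ^ m \<le> (d + 1) ^ m" using d by (intro power_mono) auto
  finally have 1: "m < (d + 1) ^ m" .
  have "(d + 1) ^ 1 \<le> (d + 1) ^ m" using m by (intro power_increasing) auto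
  then have 2: "d + 1 \<le> (d + 1) ^ m" by simp
  have 3: "(d + 1) ^ m \<le> B" unfolding B_def using n by simp
  have "2 * n * 1 \<le> n * n * (d + 1) ^ m" using n by (intro mult_mono) auto
  then show "2 * n \<le> B" by (simp add: B_def)
  then show "n \<le> B" "1 \<le> B" using n by auto
  show "m \<le> B" "d \<le> B" "d + 1 \<le> B" using 1 2 3 by auto
qed

text \<open>The first factor may be equal to \<open>2 ^ B\<close>: factors of the form
  \<open>M - y\<close> with a reduced \<open>y\<close> are used as they are, and \<open>y\<close>
  can be 0.\<close>

lemma wp_mul:
  assumes "env s" "0 \<le> s ''ma'' 0" "s ''ma'' 0 \<le> 2 ^ B" "0 \<le> s ''mb'' 0" "s ''mb'' 0 < 2 ^ B"
    and Q: "\<And>s'. s' ''mr'' 0 = (s ''ma'' 0 * s ''mb'' 0) mod 2 ^ B \<Longrightarrow>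
      agree {''mr'', ''mi'', ''mk'', ''mb''} s s' \<Longrightarrow> Q s'"
  shows "wp B mul s Q"
proof -
  let ?a = "s ''ma'' 0" and ?b = "s ''mb'' 0" and ?M = "2 ^ B :: int"
  let ?X = "{''mr'', ''mi'', ''mk'', ''mb''}"
  define I where "I k s' \<longleftrightarrow> s' ''mr'' 0 = (?a * (?b div 2 ^ (B - k))) mod ?M \<and>
      s' ''mb'' 0 = ?b mod 2 ^ (B - k)" for k and s' :: state
  show ?thesis
    unfolding mul_def
  proof (rule wp_Seq, rule wp_Assign, rule wp_mono[OF wp_For[where N = B and I = I]])
    let ?s0 = "update s ''mr'' (aval (Lit 0) s) (aval (Lit 0) s)"
    show "I 0 ?s0" using assms by (simp add: I_def update_def div_pos_pos_trivial)
    show "I k (update s' ''mi'' 0 v)" if "I k s'" for k s' v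
      using that by (simp add: I_def update_def)
    fix k s'
    assume k: "k < B" and "agree (insert ''mi'' (mods mul_body)) ?s0 s'" and mi: "s' ''mi'' 0 = int k" and I: "I k s'"
    then have ag: "agree ?X s s'" by (auto simp: agree_def update_def)
    have env: "env s'" by (rule env_agree[OF assms(1) ag]) simp
    have ma: "s' ''ma'' 0 = ?a" by (simp add: agreeD[OF ag])
    define r where "r = B - Suc k"
    have Bk: "B - k = Suc r" "r \<le> B" using k by (auto simp: r_def)
    have mk: "int B - int k - 1 = int r" using k by (simp add: r_def)
    have mr: "s' ''mr'' 0 = (?a * (?b div 2 ^ Suc r)) mod ?M" and mb: "s' ''mb'' 0 = ?b mod 2 ^ Suc r"
      using I by (simp_all add: I_def Bk)
    have range: "0 \<le> s' ''mr'' 0" "s' ''mr'' 0 < ?M" unfolding mr by simp_all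
    have doubled: "(2 * s' ''mr'' 0) mod ?M = (?a * (2 * (?b div 2 ^ Suc r))) mod ?M"
      unfolding mr by (simp add: mod_simps algebra_simps)
    have plus: "((2 * s' ''mr'' 0) mod ?M + ?a) mod ?M = (?a * (2 * (?b div 2 ^ Suc r) + 1)) mod ?M"
      unfolding doubled by (simp add: mod_simps algebra_simps)
    have small: "(2 * s' ''mr'' 0) mod ?M + ?a < 2 * ?M"
    proof -
      have "(2 * s' ''mr'' 0) mod ?M < ?M" by simp
      then show ?thesis using assms(3) by linarith
    qed
    note step = top_bit_step[OF assms(4), of r]
    show "wp B mul_body s' (I (Suc k))"
    proof (cases "?b mod 2 ^ Suc r < 2 ^ r")
      case True
      note bits = step(1)[OF True, THEN conjunct1] step(1)[OF True, THEN conjunct2]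
      show ?thesis
        unfolding mul_body_def
        by (intro wp_Seq wp_Assign wp_reduce[where M = ?M] wp_If wp_Skip)
          (simp_all add: update_def envD[OF env] mi mk mb ma Bk I_def r_def[symmetric] True bits
            range doubled del: power_Suc)
    next
      case False
      note bits = step(2)[OF False, THEN conjunct1] step(2)[OF False, THEN conjunct2]
      show ?thesis
        unfolding mul_body_def
        using False small assms(2)
        by (intro wp_Seq wp_Assign wp_reduce[where M = ?M] wp_If wp_Skip)
          (simp_all add: update_def envD[OF env] mi mk mb ma Bk I_def r_def[symmetric] bits
            range plus del: power_Suc)
    qed
  qed (use bounds assms envD[OF assms(1)] Q in \<open>auto simp: I_def update_def agree_def\<close>)
qed


text \<open>Cells beyond the list keep their old contents: a grouping that is too short leaves
  exponents of an earlier one behind.\<close>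

definition stored :: "(int \<Rightarrow> int) \<Rightarrow> nat list \<Rightarrow> int \<Rightarrow> int" where
  "stored old l i =
     (if 0 \<le> i \<and> i < int (length l) then int (n * n * (d + 1) ^ (l ! nat i)) else old i)"

lemma stored_Nil [simp]: "stored old [] = old"
  by (auto simp: stored_def)

lemma stored_snoc: "(stored old l)(int (length l) := int (n * n * (d + 1) ^ j)) = stored old (l @ [j])"
  by (auto simp: stored_def fun_eq_iff nth_append)

lemma wp_decode_step:
  assumes env: "env s" and W: "W = n * n * (d + 1) ^ j" and j: "j \<le> m"
    and a: "a \<notin> {''v'', ''K''}"
    and s: "s ''dg'' 0 = int j" "s ''K'' 0 = int (R - min t (R div W) * W)"
      "s ''v'' 0 = int (length l + min t (R div W))"
      "s a = stored old (l @ replicate (min t (R div W)) j)"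
  shows "wp L (decode_step a) s (\<lambda>s'. s' ''K'' 0 = int (R - min (Suc t) (R div W) * W) \<and>
      s' ''v'' 0 = int (length l + min (Suc t) (R div W)) \<and>
      s' a = stored old (l @ replicate (min (Suc t) (R div W)) j))"
proof -
  let ?D = "R div W"
  have "''v'' \<noteq> a" "''K'' \<noteq> a" using a by auto
  note a = a this
  have W0: "W > 0" using W n by simp
  have ex: "s ''ex'' (int j) = int W" using envD(6)[OF env j] W by simp
  show ?thesis
  proof (cases "t < ?D")
    case True
    then have "Suc t * W \<le> R" using W0 by (metis Suc_leI less_eq_div_iff_mult_less_eq)
    then have le: "W \<le> R - t * W" and eq: "R - Suc t * W = R - t * W - W" by auto
    have mins: "min t ?D = t" "min (Suc t) ?D = Suc t" using True by auto
    have "replicate (Suc t) j = replicate t j @ [j]" by (simp add: replicate_append_same)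
    then have "(stored old (l @ replicate t j))(int (length l + t) := int W) =
        stored old (l @ replicate (Suc t) j)"
      using stored_snoc[of old "l @ replicate t j" j] W by simp
    then show ?thesis
      unfolding decode_step_def using s le a
      by (intro wp_If wp_Seq wp_Assign wp_Skip)
        (simp_all add: update_def mins eq ex of_nat_diff del: replicate_Suc mult_Suc)
  next
    case False
    have "int R < int W + int ?D * int W"
      using dividend_less_div_times[OF W0, of R]
      unfolding of_nat_mult[symmetric] of_nat_add[symmetric] of_nat_less_iff .
    moreover have "min t ?D = ?D" "min (Suc t) ?D = ?D" using False by auto
    ultimately show ?thesis
      unfolding decode_step_def using s
      by (intro wp_If wp_Seq wp_Assign wp_Skip) (simp_all add: update_def ex)
  qed
qed

lemma wp_decode:
  assumes env: "env s" and K: "s ''K'' 0 = int K" "K < B"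
    and a: "a \<notin> {''v'', ''dj'', ''dg'', ''dt'', ''K'', ''n'', ''d'', ''m'', ''ex'', ''L'', ''p2'', ''M'', ''adj''}"
    and Q: "\<And>s'. s' ''v'' 0 = int (length (power_terms (d + 1) m (K div (n * n)))) \<Longrightarrow>
      s' a = stored (s a) (power_terms (d + 1) m (K div (n * n))) \<Longrightarrow>
      agree {''v'', ''dj'', ''dg'', ''dt'', ''K'', a} s s' \<Longrightarrow> Q s'"
  shows "wp B (decode a) s Q"
proof -
  have "''v'' \<noteq> a" "''dj'' \<noteq> a" "''dg'' \<noteq> a" "''dt'' \<noteq> a" "''K'' \<noteq> a" "''d'' \<noteq> a" "''m'' \<noteq> a"
    using a by auto
  note a = a this
  let ?q = "d + 1" and ?S = "n * n"
  let ?X = "{''v'', ''dj'', ''dg'', ''dt'', ''K'', a}"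
  \<comment> \<open>\<open>l\<close> is the output so far and \<open>R\<close> what remains of
    \<open>K\<close>. All subtracted weights are multiples of \<open>n * n\<close>, so the residue
    of \<open>K\<close> modulo \<open>n * n\<close> survives in \<open>R\<close> and only
    \<open>K div (n * n)\<close> is decoded.\<close>
  define I where "I k s' \<longleftrightarrow> (\<exists>l R. power_terms ?q m (K div ?S) = l @ power_terms ?q (m - k) (R div ?S) \<and>
      R < ?S * ?q ^ (m - k) \<and> s' ''K'' 0 = int R \<and> s' ''v'' 0 = int (length l) \<and>
      s' a = stored (s a) l)" for k and s' :: state
  have final: "Q s'" if "I m s'" "agree ?X s s'" for s'
    using that by (intro Q) (auto simp: I_def)
  show ?thesis
    unfolding decode_def
  proof (rule wp_Seq, rule wp_Assign, rule wp_mono[OF wp_For[where N = m and I = I]])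
    let ?s0 = "update s ''v'' (aval (Lit 0) s) (aval (Lit 0) s)"
    show "m \<le> B" by (rule bounds)
    show "''dj'' \<notin> mods (decode_body a)" using a by simp
    show "aval (Var ''m'') s' = int m" if "agree (insert ''dj'' (mods (decode_body a))) ?s0 s'" for s'
      using a agreeD[OF that, of "''m''"] envD(3)[OF env] by (simp add: update_def)
    show "I 0 ?s0" unfolding I_def
      using a K by (intro exI[of _ "[]"] exI[of _ K]) (auto simp: update_def B_def)
    show "I k (update s' ''dj'' 0 v)" if "I k s'" for k s' v
      using that a by (simp add: I_def update_def)
    show "Q s'" if "I m s' \<and> agree (insert ''dj'' (mods (decode_body a))) ?s0 s'" for s'
      using that by (intro final) (auto simp: agree_def update_def)
    fix k s'
    assume k: "k < m" and "agree (insert ''dj'' (mods (decode_body a))) ?s0 s'"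
      and dj: "s' ''dj'' 0 = int k" and I: "I k s'"
    then have ag: "agree ?X s s'" by (auto simp: agree_def update_def)
    have env': "env s'" by (rule env_agree[OF env ag]) (use a in auto)
    define j where "j = m - Suc k"
    have mk: "m - k = Suc j" "m - Suc k = j" "j \<le> m" using k by (auto simp: j_def)
    define W where "W = ?S * ?q ^ j"
    from I obtain l R where l: "power_terms ?q m (K div ?S) = l @ power_terms ?q (Suc j) (R div ?S)"
      and R: "R < ?S * ?q ^ Suc j" and s': "s' ''K'' 0 = int R" "s' ''v'' 0 = int (length l)"
        "s' a = stored (s a) l"
      unfolding I_def mk by blast
    let ?D = "R div W"
    \<comment> \<open>The current digit is at most \<open>d\<close>, so the \<open>d\<close>
      repetitions exhaust it.\<close>
    have "R < ?q * W" using R by (simp add: W_def mult_ac)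
    then have "?D < ?q" by (rule less_mult_imp_div_less)
    then have D: "min d ?D = ?D" by simp
    define J where "J t s'' \<longleftrightarrow> s'' ''K'' 0 = int (R - min t ?D * W) \<and>
      s'' ''v'' 0 = int (length l + min t ?D) \<and>
      s'' a = stored (s a) (l @ replicate (min t ?D) j)" for t and s'' :: state
    show "wp B (decode_body a) s' (I (Suc k))"
      unfolding decode_body_def
    proof (rule wp_Seq, rule wp_Assign, rule wp_mono[OF wp_For[where N = d and I = J]])
      let ?s1 = "update s' ''dg'' (aval (Lit 0) s')
          (aval (Sub (Sub (Var ''m'') (Var ''dj'')) (Lit 1)) s')"
      have dg: "?s1 ''dg'' 0 = int j"
        using k by (simp add: update_def envD[OF env'] dj j_def)
      have env1: "env ?s1"
        by (rule env_agree[OF env', of "{''dg''}"]) (auto simp: agree_def update_def)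
      show "d \<le> B" by (rule bounds)
      show "''dt'' \<notin> mods (decode_step a)" using a by simp
      show "aval (Var ''d'') s'' = int d" if "agree (insert ''dt'' (mods (decode_step a))) ?s1 s''" for s''
        using a agreeD[OF that, of "''d''"] envD(2)[OF env1] by simp
      show "J 0 ?s1" using s' a by (simp add: J_def update_def)
      show "J t (update s'' ''dt'' 0 v)" if "J t s''" for t s'' v
        using that a by (simp add: J_def update_def)
      show "wp B (decode_step a) s'' (J (Suc t))"
        if "agree (insert ''dt'' (mods (decode_step a))) ?s1 s''" "J t s''" for t s''
      proof -
        have "env s''" by (rule env_agree[OF env1 that(1)]) (use a in auto)
        moreover have "s'' ''dg'' 0 = int j" using a agreeD[OF that(1), of "''dg''"] dg by simp
        ultimately show ?thesis
          using that(2) a mk(3) unfolding J_def by (intro wp_decode_step) (auto simp: W_def)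
      qed
      show "I (Suc k) s''" if "J d s'' \<and> agree (insert ''dt'' (mods (decode_step a))) ?s1 s''" for s''
      proof -
        have "R div ?S div ?q ^ j = ?D" by (simp only: W_def div_mult2_eq)
        moreover have "R div ?S mod ?q ^ j = R mod W div ?S"
          unfolding W_def using n by (intro mod_mult_div_eq[symmetric]) simp
        ultimately have "power_terms ?q m (K div ?S) = (l @ replicate ?D j) @ power_terms ?q j (R mod W div ?S)"
          unfolding l power_terms.simps by simp
        moreover have "R mod W < ?S * ?q ^ j" unfolding W_def using n by (intro mod_less_divisor) simp
        moreover have "R - ?D * W = R mod W" by (rule minus_div_mult_eq_mod)
        ultimately show ?thesis
          using that unfolding I_def J_def mk D
          by (intro exI[of _ "l @ replicate ?D j"] exI[of _ "R mod W"]) simp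
      qed
    qed
  qed
qed


text \<open>\<open>b\<close> is evaluated after \<open>ma\<close> has been overwritten, so its value
  must not depend on \<open>ma\<close>.\<close>

lemma wp_mul_to:
  assumes env: "env s" and a: "0 \<le> aval a s" "aval a s \<le> 2 ^ B"
    and b: "0 \<le> aval b s" "aval b s < 2 ^ B" "\<And>v. aval b (update s ''ma'' 0 v) = aval b s"
    and x: "x \<notin> {''n'', ''d'', ''m'', ''ex'', ''L'', ''p2'', ''M'', ''adj''}"
    and Q: "\<And>s'. s' x 0 = (aval a s * aval b s) mod 2 ^ B \<Longrightarrow>
      agree {''ma'', ''mb'', ''mr'', ''mi'', ''mk'', x} s s' \<Longrightarrow> env s' \<Longrightarrow> Q s'"
  shows "wp B (mul_to x a b) s Q"
  unfolding mul_to_def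
proof (intro wp_Seq wp_Assign)
  let ?s1 = "update s ''ma'' (aval (Lit 0) s) (aval a s)"
  let ?s2 = "update ?s1 ''mb'' (aval (Lit 0) ?s1) (aval b ?s1)"
  have ag: "agree {''ma'', ''mb''} s ?s2" by (auto simp: agree_def update_def)
  have env2: "env ?s2" by (rule env_agree[OF env ag]) simp
  have ab: "?s2 ''ma'' 0 = aval a s" "?s2 ''mb'' 0 = aval b s" using b(3) by (simp_all add: update_def)
  show "wp B mul ?s2 (\<lambda>s'. wp B (Set x (Var ''mr'')) s' Q)"
  proof (rule wp_mul[OF env2])
    fix s' assume s': "s' ''mr'' 0 = (?s2 ''ma'' 0 * ?s2 ''mb'' 0) mod 2 ^ B"
      "agree {''mr'', ''mi'', ''mk'', ''mb''} ?s2 s'"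
    let ?s3 = "update s' x (aval (Lit 0) s') (aval (Var ''mr'') s')"
    have ag3: "agree {''ma'', ''mb'', ''mr'', ''mi'', ''mk'', x} s ?s3"
      using ag s'(2) by (auto simp: agree_def update_def)
    have "env ?s3" by (rule env_agree[OF env ag3]) (use x in auto)
    moreover have "?s3 x 0 = (aval a s * aval b s) mod 2 ^ B"
      using s'(1) unfolding ab by (simp add: update_def)
    ultimately show "wp B (Set x (Var ''mr'')) s' Q" using ag3 by (intro wp_Assign Q)
  qed (use a b ab in simp_all)
qed

end

section \<open>The matrix and its determinant modulo a power of 2\<close>

text \<open>\<open>ro\<close> is the offset of the current row, maintained by additions since there
  is no multiplication. The sum for the diagonal is accumulated in \<open>bd\<close>.\<close>

definition build_entry :: com where
  "build_entry =
     If (Less (Lit 0) (Get ''adj'' (Add (Var ''ro'') (Var ''w''))))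
       (Set ''bw'' (Get ''p2'' (Add (Get ''x'' (Var ''u'')) (Get ''x'' (Var ''w'')))) ;;
        Assign ''A'' (Add (Var ''ro'') (Var ''w'')) (Sub (Var ''M'') (Var ''bw'')) ;;
        Set ''bd'' (Add (Var ''bd'') (Var ''bw'')) ;;
        reduce ''bd'')
       (Assign ''A'' (Add (Var ''ro'') (Var ''w'')) (Lit 0))"

definition build_row :: com where
  "build_row =
     Set ''bd'' (Lit 1) ;;
     For ''w'' (Var ''n'') build_entry ;;
     Assign ''A'' (Add (Var ''ro'') (Var ''u'')) (Var ''bd'') ;;
     Set ''ro'' (Add (Var ''ro'') (Var ''n''))"

definition build :: com where
  "build = Set ''ro'' (Lit 0) ;; For ''u'' (Var ''n'') build_row"

lemma mods_build_entry [simp]: "mods build_entry = {''bw'', ''A'', ''bd''}"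
  by (auto simp: build_entry_def)

lemma mods_build_row [simp]: "mods build_row = {''bw'', ''A'', ''bd'', ''w'', ''ro''}"
  by (auto simp: build_row_def)

lemma mods_build [simp]: "mods build = {''bw'', ''A'', ''bd'', ''w'', ''ro'', ''u''}"
  by (auto simp: build_def)

lemma minus_mod_eq: "0 < b \<Longrightarrow> b \<le> M \<Longrightarrow> (- b) mod M = M - b" for b M :: int
  using mod_pos_pos_trivial[of "M - b" M] by (simp add: mod_simps)

context machine
begin

lemma index_eq_iff:
  assumes "v < n" "v' < n"
  shows "int u * int n + int v = int u' * int n + int v' \<longleftrightarrow> u = u' \<and> v = v'"
proof
  assume "int u * int n + int v = int u' * int n + int v'"
  then have eq: "u * n + v = u' * n + v'" by (metis of_nat_add of_nat_eq_iff of_nat_mult)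
  have "(u * n + v) div n = u" "(u' * n + v') div n = u'" using assms by auto
  with eq show "u = u' \<and> v = v'" by auto
qed simp

lemma adj_index:
  assumes "env s" "u < n" "v < n"
  shows "s ''adj'' (int u * int n + int v) = of_bool ({u, v} \<in> E)"
  using envD(8)[OF assms] by simp

definition represents :: "state \<Rightarrow> (nat \<Rightarrow> nat \<Rightarrow> int) \<Rightarrow> bool" where
  "represents s a \<longleftrightarrow> (\<forall>i<n. \<forall>j<n. s ''A'' (int i * int n + int j) = a i j)"

text \<open>The sum of two exponents is looked up in \<open>p2\<close>, which ends at index
  \<open>B\<close>; this is the reason for the bound on \<open>xs\<close>.\<close>

lemma wp_build:
  assumes env: "env s" and x: "\<And>v. v < n \<Longrightarrow> s ''x'' (int v) = int (xs v)"
    and xs: "\<And>u v. u < n \<Longrightarrow> v < n \<Longrightarrow> xs u + xs v \<le> B"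
    and Q: "\<And>s'. represents s' (\<lambda>u v. forest_matrix n E xs u v mod 2 ^ B) \<Longrightarrow>
      agree {''bw'', ''A'', ''bd'', ''w'', ''ro'', ''u''} s s' \<Longrightarrow> Q s'"
  shows "wp B build s Q"
proof -
  let ?X = "{''bw'', ''A'', ''bd'', ''w'', ''ro'', ''u''}"
  let ?M = "2 ^ B :: int"
  let ?ew = "edge_weight E xs"
  have M1: "1 < ?M" using bounds(6) by (intro one_less_power) auto
  have loop: "{v, v} \<notin> E" for v using E unfolding simple_graph_def by (metis doubleton_eq_iff)
  have rows: "int u * int n + int v < int u' * int n" if "u < u'" "v < n" for u v u'
  proof -
    have "int u * int n + int v < (int u + 1) * int n" using that by (simp add: algebra_simps)
    also have "\<dots> \<le> int u' * int n" using that by (intro mult_right_mono) auto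
    finally show ?thesis .
  qed
  define I where "I u s' \<longleftrightarrow> s' ''ro'' 0 = int u * int n \<and>
      (\<forall>i<u. \<forall>j<n. s' ''A'' (int i * int n + int j) = forest_matrix n E xs i j mod ?M)"
    for u and s' :: state
  show ?thesis
    unfolding build_def
  proof (rule wp_Seq, rule wp_Assign, rule wp_mono[OF wp_For[where N = n and I = I]])
    let ?s0 = "update s ''ro'' (aval (Lit 0) s) (aval (Lit 0) s)"
    show "n \<le> B" by (rule bounds)
    show "''u'' \<notin> mods build_row" by simp
    show "aval (Var ''n'') s' = int n" if "agree (insert ''u'' (mods build_row)) ?s0 s'" for s'
      using agreeD[OF that, of "''n''"] envD(1)[OF env] by (simp add: update_def)
    show "I 0 ?s0" by (simp add: I_def update_def)
    show "I k (update s' ''u'' 0 v)" if "I k s'" for k s' v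
      using that by (simp add: I_def update_def)
    show "Q s'" if "I n s' \<and> agree (insert ''u'' (mods build_row)) ?s0 s'" for s'
      using that by (intro Q) (auto simp: I_def represents_def agree_def update_def)
    fix u s'
    assume u: "u < n" and "agree (insert ''u'' (mods build_row)) ?s0 s'"
      and su: "s' ''u'' 0 = int u" and I: "I u s'"
    then have ag: "agree ?X s s'" by (auto simp: agree_def update_def)
    have env': "env s'" by (rule env_agree[OF env ag]) simp
    have x': "s' ''x'' (int v) = int (xs v)" if "v < n" for v
      using x[OF that] agreeD[OF ag, of "''x''"] by simp
    \<comment> \<open>In the absence of loops the diagonal cell receives 0 at first; it gets
      \<open>bd\<close> when the row is complete. The last clause protects the earlier rows.\<close>
    define J where "J t s'' \<longleftrightarrow> s'' ''bd'' 0 = (1 + (\<Sum>v<t. ?ew u v)) mod ?M \<and>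
        (\<forall>v<t. s'' ''A'' (int u * int n + int v) = (- ?ew u v) mod ?M) \<and>
        (\<forall>i<int u * int n. s'' ''A'' i = s' ''A'' i)" for t and s'' :: state
    show "wp B build_row s' (I (Suc u))"
      unfolding build_row_def
    proof (rule wp_Seq, rule wp_Assign, rule wp_Seq, rule wp_mono[OF wp_For[where N = n and I = J]])
      let ?s1 = "update s' ''bd'' (aval (Lit 0) s') (aval (Lit 1) s')"
      show "n \<le> B" by (rule bounds)
      show "''w'' \<notin> mods build_entry" by simp
      show "aval (Var ''n'') s'' = int n" if "agree (insert ''w'' (mods build_entry)) ?s1 s''" for s''
        using agreeD[OF that, of "''n''"] envD(1)[OF env'] by (simp add: update_def)
      show "J 0 ?s1" using M1 bounds(6) by (simp add: J_def update_def)
      show "J t (update s'' ''w'' 0 v)" if "J t s''" for t s'' v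
        using that by (simp add: J_def update_def)
      {
        fix t s''
        assume t: "t < n" and "agree (insert ''w'' (mods build_entry)) ?s1 s''"
          and w: "s'' ''w'' 0 = int t" and J: "J t s''"
        then have ag2: "agree {''bw'', ''A'', ''bd'', ''w''} s' s''" by (auto simp: agree_def update_def)
        have env2: "env s''" by (rule env_agree[OF env' ag2]) simp
        have ro: "s'' ''ro'' 0 = int u * int n" and u2: "s'' ''u'' 0 = int u"
          using I su agreeD[OF ag2, of "''ro''"] agreeD[OF ag2, of "''u''"] by (auto simp: I_def)
        have x2: "s'' ''x'' (int v) = int (xs v)" if "v < n" for v
          using x'[OF that] agreeD[OF ag2, of "''x''"] by simp
        have adj: "s'' ''adj'' (int u * int n + int t) = of_bool ({u, t} \<in> E)"
          by (rule adj_index[OF env2 u t])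
        show "wp B build_entry s'' (J (Suc t))"
        proof (cases "{u, t} \<in> E")
          case False
          then have "?ew u t = 0" by (simp add: edge_weight_def)
          then show ?thesis
            unfolding build_entry_def using J False
            by (intro wp_If wp_Assign)
              (auto simp: update_def ro w adj J_def less_Suc_eq)
        next
          case True
          let ?e = "2 ^ (xs u + xs t) :: int"
          have ew: "?ew u t = ?e" using True by (simp add: edge_weight_def)
          have p2: "s'' ''p2'' (int (xs u) + int (xs t)) = ?e"
            using envD(7)[OF env2 xs[OF u t]] by simp
          have le: "?e \<le> ?M" using xs[OF u t] by (intro power_increasing) auto
          have neg: "?M - ?e = (- ?ew u t) mod ?M" unfolding ew using le by (simp add: minus_mod_eq)
          have bd: "s'' ''bd'' 0 = (1 + (\<Sum>v<t. ?ew u v)) mod ?M" using J by (simp add: J_def)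
          have range: "0 \<le> s'' ''bd'' 0" "s'' ''bd'' 0 < ?M" unfolding bd by simp_all
          have sum: "(s'' ''bd'' 0 + ?e) mod ?M = (1 + (\<Sum>v<Suc t. ?ew u v)) mod ?M"
            unfolding bd ew[symmetric] by (simp add: mod_simps add.assoc)
          have step: "J (Suc t) (update (update (update (update s'' ''bw'' 0 ?e) ''A''
              (int u * int n + int t) (?M - ?e)) ''bd'' 0 (s'' ''bd'' 0 + ?e)) ''bd'' 0
              ((s'' ''bd'' 0 + ?e) mod ?M))"
            using J unfolding sum neg by (auto simp: J_def update_def less_Suc_eq)
          have lt: "s'' ''bd'' 0 + ?e < 2 * ?M" using range le by linarith
          show ?thesis
            unfolding build_entry_def
            using True range lt step
            by (intro wp_If wp_Seq wp_Assign wp_reduce[where M = ?M])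
              (simp_all add: update_def envD[OF env2] ro w u2 adj x2[OF u] x2[OF t] p2)
        qed
      }
      fix s2
      assume "J n s2 \<and> agree (insert ''w'' (mods build_entry)) ?s1 s2"
      then have J: "J n s2" and ag2: "agree {''bw'', ''A'', ''bd'', ''w''} s' s2"
        by (auto simp: agree_def update_def)
      have s2: "s2 ''ro'' 0 = int u * int n" "s2 ''u'' 0 = int u" "s2 ''n'' 0 = int n"
        using I su envD(1)[OF env'] agreeD[OF ag2, of "''ro''"] agreeD[OF ag2, of "''u''"]
          agreeD[OF ag2, of "''n''"] by (auto simp: I_def)
      have bd: "s2 ''bd'' 0 = forest_matrix n E xs u u mod ?M"
        using J by (simp add: J_def forest_matrix_def)
      have "I (Suc u) (update (update s2 ''A'' (int u * int n + int u) (s2 ''bd'' 0)) ''ro'' 0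
          (int u * int n + int n))"
        unfolding I_def
      proof (intro conjI allI impI, goal_cases)
        case 1
        then show ?case by (simp add: update_def algebra_simps)
      next
        case (2 i j)
        show ?case
        proof (cases "i = u")
          case True
          then show ?thesis using 2 u J bd loop
            by (auto simp: update_def index_eq_iff J_def forest_matrix_def)
        next
          case False
          then have "i < u" using 2 by simp
          then have "s2 ''A'' (int i * int n + int j) = s' ''A'' (int i * int n + int j)"
            using J rows[of i u j] 2 by (simp add: J_def)
          then show ?thesis using False 2 u I \<open>i < u\<close> by (simp add: update_def index_eq_iff I_def)
        qed
      qed
      then show "wp B (Assign ''A'' (Add (Var ''ro'') (Var ''u'')) (Var ''bd'') ;;
          Set ''ro'' (Add (Var ''ro'') (Var ''n''))) s2 (I (Suc u))"
        using s2 by (intro wp_Seq wp_Assign) (simp add: update_def)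
    qed
  qed
qed

end

section \<open>Gaussian elimination modulo a power of 2\<close>

definition elim_entry :: com where
  "elim_entry =
     mul_to ''e'' (Var ''c'') (Get ''A'' (Add (Var ''rk'') (Var ''j''))) ;;
     Set ''e'' (Add (Get ''A'' (Add (Var ''ri'') (Var ''j''))) (Var ''e'')) ;;
     reduce ''e'' ;;
     Assign ''A'' (Add (Var ''ri'') (Var ''j'')) (Var ''e'')"

definition elim_row :: com where
  "elim_row =
     If (Less (Var ''k'') (Var ''i''))
       (mul_to ''c'' (Get ''A'' (Add (Var ''ri'') (Var ''k''))) (Var ''iv'') ;;
        Set ''c'' (Sub (Var ''M'') (Var ''c'')) ;;
        For ''j'' (Var ''n'') elim_entry)
       Skip ;;
     Set ''ri'' (Add (Var ''ri'') (Var ''n''))"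

definition invert_step :: com where
  "invert_step =
     mul_to ''iv'' (Sub (Add (Var ''M'') (Lit 1)) (Var ''p'')) (Var ''iv'') ;;
     Set ''iv'' (Add (Var ''iv'') (Lit 1)) ;;
     reduce ''iv''"

definition elim_col :: com where
  "elim_col =
     Set ''p'' (Get ''A'' (Add (Var ''rk'') (Var ''k''))) ;;
     mul_to ''det'' (Var ''det'') (Var ''p'') ;;
     Set ''iv'' (Lit 1) ;;
     For ''t'' (Var ''L'') invert_step ;;
     Set ''ri'' (Lit 0) ;;
     For ''i'' (Var ''n'') elim_row ;;
     Set ''rk'' (Add (Var ''rk'') (Var ''n''))"

definition elim :: com where
  "elim = Set ''det'' (Lit 1) ;; Set ''rk'' (Lit 0) ;; For ''k'' (Var ''n'') elim_col"

lemma mods_elim_entry [simp]: "mods elim_entry = {''ma'', ''mb'', ''mr'', ''mi'', ''mk'', ''e'', ''A''}"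
  by (auto simp: elim_entry_def)

lemma mods_elim_row [simp]:
  "mods elim_row = {''ma'', ''mb'', ''mr'', ''mi'', ''mk'', ''e'', ''A'', ''c'', ''j'', ''ri''}"
  by (auto simp: elim_row_def)

lemma mods_invert_step [simp]: "mods invert_step = {''ma'', ''mb'', ''mr'', ''mi'', ''mk'', ''iv''}"
  by (auto simp: invert_step_def)

lemma mods_elim_col [simp]:
  "mods elim_col = {''ma'', ''mb'', ''mr'', ''mi'', ''mk'', ''e'', ''A'', ''c'', ''j'', ''ri'', ''i'',
     ''iv'', ''t'', ''p'', ''det'', ''rk''}"
  by (auto simp: elim_col_def)

lemma mods_elim [simp]:
  "mods elim = {''ma'', ''mb'', ''mr'', ''mi'', ''mk'', ''e'', ''A'', ''c'', ''j'', ''ri'', ''i'',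
     ''iv'', ''t'', ''p'', ''det'', ''rk'', ''k''}"
  by (auto simp: elim_def)

text \<open>Row \<open>k\<close> itself never changes, so the rows below it can be treated one at a
  time.\<close>

lemma det_of_row_reduce:
  assumes "k < n"
  shows "det_of n (\<lambda>r j. if k < r \<and> r < i then a r j - c r * a k j else a r j) = det_of n a"
proof (induction i)
  case 0
  then show ?case by simp
next
  case (Suc i)
  let ?b = "\<lambda>r j. if k < r \<and> r < i then a r j - c r * a k j else a r j"
  show ?case
  proof (cases "k < i")
    case True
    have "(\<lambda>r j. if k < r \<and> r < Suc i then a r j - c r * a k j else a r j) =
        ?b(i := \<lambda>j. ?b i j + (- c i) * ?b k j)"
      using True by (auto simp: fun_eq_iff less_Suc_eq)
    then show ?thesis using det_of_row_op[OF assms, of i ?b "- c i"] True Suc by simp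
  next
    case False
    then have "(\<lambda>r j. if k < r \<and> r < Suc i then a r j - c r * a k j else a r j) = ?b"
      by (auto simp: fun_eq_iff less_Suc_eq)
    then show ?thesis using Suc by simp
  qed
qed

text \<open>The iteration \<open>x \<mapsto> 1 + (1 - p) x\<close> computes the inverse of an odd number by its 2-adic
  geometric series.\<close>

lemma inverse_step:
  fixes p x M :: int
  assumes "[p * x = 1 - (1 - p) ^ k] (mod M)"
  shows "[p * (1 + (1 - p) * x) = 1 - (1 - p) ^ Suc k] (mod M)"
proof -
  have "p * (1 + (1 - p) * x) = p + (1 - p) * (p * x)" by (simp add: algebra_simps)
  moreover have "[p + (1 - p) * (p * x) = p + (1 - p) * (1 - (1 - p) ^ k)] (mod M)"
    using assms by (intro cong_add cong_mult cong_refl)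
  moreover have "p + (1 - p) * (1 - (1 - p) ^ k) = 1 - (1 - p) ^ Suc k" by (simp add: algebra_simps)
  ultimately show ?thesis by simp
qed

context machine
begin

abbreviation M :: int where "M \<equiv> 2 ^ B"

lemma even_M: "even M"
  using bounds(6) by simp

lemma mod_M_even: "even (x mod M) \<longleftrightarrow> even x"
  using even_M by (metis dvd_mod_iff)

text \<open>The matrix during the elimination of column \<open>k\<close>, when the rows before
  \<open>i\<close> have been dealt with.\<close>

definition reduced :: "nat \<Rightarrow> int \<Rightarrow> (nat \<Rightarrow> nat \<Rightarrow> int) \<Rightarrow> nat \<Rightarrow> nat \<Rightarrow> nat \<Rightarrow> int" where
  "reduced k iv a i = (\<lambda>r j. if k < r \<and> r < i then (a r j - a r k * iv * a k j) mod M else a r j)"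

definition in_range :: "(nat \<Rightarrow> nat \<Rightarrow> int) \<Rightarrow> bool" where
  "in_range a \<longleftrightarrow> (\<forall>i<n. \<forall>j<n. 0 \<le> a i j \<and> a i j < M)"

text \<open>The identity modulo 2. Odd diagonal entries alone would not be preserved by row
  operations.\<close>

definition odd_diagonal :: "(nat \<Rightarrow> nat \<Rightarrow> int) \<Rightarrow> bool" where
  "odd_diagonal a \<longleftrightarrow> (\<forall>i<n. \<forall>j<n. odd (a i j) \<longleftrightarrow> i = j)"

definition eliminated :: "nat \<Rightarrow> (nat \<Rightarrow> nat \<Rightarrow> int) \<Rightarrow> bool" where
  "eliminated k a \<longleftrightarrow> (\<forall>i<n. \<forall>j<k. j < i \<longrightarrow> a i j = 0)"

lemma in_range_reduced: "in_range a \<Longrightarrow> in_range (reduced k iv a i)"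
  by (auto simp: in_range_def reduced_def)

text \<open>Below the pivot \<open>a r k\<close> is even, so a row changes by an even multiple of
  the pivot row; the reduction preserves parity since \<open>M\<close> is even.\<close>

lemma odd_diagonal_reduced:
  assumes "odd_diagonal a" "k < n"
  shows "odd_diagonal (reduced k iv a i)"
  using assms by (auto simp: odd_diagonal_def reduced_def mod_M_even)

lemma eliminated_reduced:
  assumes "eliminated k a" "k < n" "[a k k * iv = 1] (mod M)"
  shows "eliminated (Suc k) (reduced k iv a n)"
  unfolding eliminated_def
proof (intro allI impI)
  fix i j assume ij: "i < n" "j < Suc k" "j < i"
  show "reduced k iv a n i j = 0"
  proof (cases "j = k")
    case True
    have "[a i k - a i k * (a k k * iv) = a i k - a i k * 1] (mod M)"
      using assms(3) by (intro cong_diff cong_mult cong_refl)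
    then have "(a i k - a i k * iv * a k k) mod M = 0"
      by (simp add: cong_def ac_simps)
    then show ?thesis using ij True by (simp add: reduced_def)
  next
    case False
    then have "a i j = 0" "a k j = 0" using assms(1,2) ij by (auto simp: eliminated_def)
    then show ?thesis by (simp add: reduced_def)
  qed
qed

lemma det_of_reduced: "k < n \<Longrightarrow> [det_of n (reduced k iv a i) = det_of n a] (mod M)"
  using det_of_cong_mod[of n "reduced k iv a i"
      "\<lambda>r j. if k < r \<and> r < i then a r j - a r k * iv * a k j else a r j" M]
    det_of_row_reduce[of k n i a "\<lambda>r. a r k * iv"]
  by (simp add: reduced_def cong_def)

lemma representsD: "represents s a \<Longrightarrow> i < n \<Longrightarrow> j < n \<Longrightarrow> s ''A'' (int i * int n + int j) = a i j"
  by (simp add: represents_def)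

lemma represents_agree: "represents s a \<Longrightarrow> agree X s s' \<Longrightarrow> ''A'' \<notin> X \<Longrightarrow> represents s' a"
  by (simp add: represents_def agree_def)

lemma represents_update:
  assumes "represents s a" "i < n" "j < n"
  shows "represents (update s ''A'' (int i * int n + int j) v) (a(i := (a i)(j := v)))"
  using assms by (auto simp: represents_def update_def index_eq_iff)

lemma wp_elim_entry:
  assumes env: "env s" and rep: "represents s a" and a: "in_range a"
    and s: "s ''c'' 0 = c" "0 \<le> c" "c \<le> M" "s ''rk'' 0 = int k * int n" "s ''ri'' 0 = int i * int n"
      "s ''j'' 0 = int j"
    and ijk: "i < n" "j < n" "k < n"
  shows "wp B elim_entry s (\<lambda>s'. represents s' (a(i := (a i)(j := (a i j + c * a k j) mod M))))"
  unfolding elim_entry_def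
proof (rule wp_Seq, rule wp_mul_to[OF env])
  have akj: "aval (Get ''A'' (Add (Var ''rk'') (Var ''j''))) s = a k j"
    using representsD[OF rep ijk(3,2)] s by simp
  then show "0 \<le> aval (Get ''A'' (Add (Var ''rk'') (Var ''j''))) s"
    "aval (Get ''A'' (Add (Var ''rk'') (Var ''j''))) s < M"
    using a ijk by (auto simp: in_range_def)
  fix s'
  assume e: "s' ''e'' 0 = (aval (Var ''c'') s * aval (Get ''A'' (Add (Var ''rk'') (Var ''j''))) s) mod M"
    and ag: "agree {''ma'', ''mb'', ''mr'', ''mi'', ''mk'', ''e''} s s'" and env': "env s'"
  have rep': "represents s' a" by (rule represents_agree[OF rep ag]) simp
  have e': "s' ''e'' 0 = (c * a k j) mod M" unfolding e akj using s by simp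
  have s': "s' ''ri'' 0 = int i * int n" "s' ''j'' 0 = int j" "s' ''M'' 0 = M"
    using s envD(5)[OF env'] agreeD[OF ag, of "''ri''"] agreeD[OF ag, of "''j''"] by auto
  have aij: "s' ''A'' (int i * int n + int j) = a i j" by (rule representsD[OF rep' ijk(1,2)])
  have range: "0 \<le> a i j" "a i j < M" using a ijk by (auto simp: in_range_def)
  have "0 \<le> (c * a k j) mod M" "(c * a k j) mod M < M" by simp_all
  then have lt: "0 \<le> a i j + (c * a k j) mod M" "a i j + (c * a k j) mod M < 2 * M"
    using range by linarith+
  let ?v = "(a i j + (c * a k j) mod M) mod M"
  let ?s2 = "update s' ''e'' 0 (a i j + (c * a k j) mod M)"
  let ?s3 = "update ?s2 ''e'' 0 ?v"
  have "represents ?s3 a"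
    by (rule represents_agree[OF rep', of "{''e''}"]) (auto simp: agree_def update_def)
  from represents_update[OF this ijk(1,2), of ?v]
  have fin: "represents (update ?s3 ''A'' (int i * int n + int j) ?v)
      (a(i := (a i)(j := (a i j + c * a k j) mod M)))"
    by (simp add: mod_simps)
  show "wp B (Set ''e'' (Add (Get ''A'' (Add (Var ''ri'') (Var ''j''))) (Var ''e'')) ;;
     reduce ''e'' ;;
     Assign ''A'' (Add (Var ''ri'') (Var ''j'')) (Var ''e'')) s'
     (\<lambda>s'. represents s' (a(i := (a i)(j := (a i j + c * a k j) mod M))))"
    using lt fin
    by (intro wp_Seq wp_Assign wp_reduce[where M = M]) (simp_all add: update_def s' e' aij)
qed (use s in \<open>simp_all add: update_def\<close>)

lemma wp_elim_row:
  assumes env: "env s" and a: "in_range a" and rep: "represents s (reduced k iv a i)"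
    and s: "s ''iv'' 0 = iv" "0 \<le> iv" "iv < M" "s ''k'' 0 = int k" "s ''i'' 0 = int i"
      "s ''rk'' 0 = int k * int n" "s ''ri'' 0 = int i * int n"
    and ik: "i < n" "k < n"
  shows "wp B elim_row s (\<lambda>s'. represents s' (reduced k iv a (Suc i)) \<and>
    s' ''ri'' 0 = int (Suc i) * int n)"
proof -
  let ?Q = "\<lambda>s'. represents s' (reduced k iv a (Suc i)) \<and> s' ''ri'' 0 = int (Suc i) * int n"
  have last: "wp B (Set ''ri'' (Add (Var ''ri'') (Var ''n''))) s' ?Q"
    if "env s'" "represents s' (reduced k iv a (Suc i))" "s' ''ri'' 0 = int i * int n" for s'
  proof (rule wp_Assign)
    let ?s2 = "update s' ''ri'' (aval (Lit 0) s') (aval (Add (Var ''ri'') (Var ''n'')) s')"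
    have "represents ?s2 (reduced k iv a (Suc i))"
      by (rule represents_agree[OF that(2), of "{''ri''}"]) (auto simp: agree_def update_def)
    moreover have "?s2 ''ri'' 0 = int (Suc i) * int n"
      using that envD(1)[OF that(1)] by (simp add: update_def algebra_simps)
    ultimately show "?Q ?s2" by blast
  qed
  show ?thesis
    unfolding elim_row_def
  proof (rule wp_Seq, rule wp_If)
    assume "\<not> bval (Less (Var ''k'') (Var ''i'')) s"
    then have "\<not> k < i" using s by simp
    then have "reduced k iv a (Suc i) = reduced k iv a i"
      by (auto simp: reduced_def fun_eq_iff less_Suc_eq)
    then show "wp B Skip s (\<lambda>s'. wp B (Set ''ri'' (Add (Var ''ri'') (Var ''n''))) s' ?Q)"
      using env rep s by (intro wp_Skip last) auto
  next
    assume "bval (Less (Var ''k'') (Var ''i'')) s"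
    then have ki: "k < i" using s by simp
    have row_i: "reduced k iv a i i = a i" and row_k: "reduced k iv a i k = a k"
      by (auto simp: reduced_def)
    have aik: "aval (Get ''A'' (Add (Var ''ri'') (Var ''k''))) s = a i k"
      using representsD[OF rep ik] s row_i by simp
    \<comment> \<open>A representative of \<open>- a i k * iv\<close>, so that adding
      \<open>c\<close> times the pivot row subtracts. It equals \<open>M\<close> if the product is 0
      modulo \<open>M\<close>.\<close>
    define c where "c = M - (a i k * iv) mod M"
    have c: "0 \<le> c" "c \<le> M"
    proof -
      have "0 \<le> (a i k * iv) mod M" "(a i k * iv) mod M < M" by simp_all
      then show "0 \<le> c" "c \<le> M" unfolding c_def by linarith+
    qed
    have entry: "(a i j + c * a k j) mod M = (a i j - a i k * iv * a k j) mod M" for j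
    proof -
      have "[c = 0 - a i k * iv] (mod M)"
        unfolding c_def by (intro cong_diff) (simp_all add: cong_def)
      then have "[a i j + c * a k j = a i j + (0 - a i k * iv) * a k j] (mod M)"
        by (intro cong_add cong_mult cong_refl)
      then show ?thesis by (simp add: cong_def)
    qed
    \<comment> \<open>Row \<open>i\<close> with its first \<open>t\<close> columns updated. The
      multiplier is already stored in \<open>c\<close>, because the entry in column \<open>k\<close>
      is overwritten on the way.\<close>
    define b where "b t = (reduced k iv a i)(i := \<lambda>j. if j < t then (a i j + c * a k j) mod M else a i j)"
      for t
    have b0: "b 0 = reduced k iv a i" unfolding b_def by (auto simp: fun_eq_iff row_i[symmetric])
    have bn: "represents s' (reduced k iv a (Suc i))" if "represents s' (b n)" for s'
      using that ki entry unfolding represents_def b_def reduced_def by (auto simp: less_Suc_eq)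
    have b_Suc: "b (Suc t) = (b t)(i := (b t i)(t := (b t i t + c * b t k t) mod M))" for t
      using ki row_k by (auto simp: b_def fun_eq_iff less_Suc_eq)
    have b_range: "in_range (b t)" for t
      using in_range_reduced[OF a, of k iv i] a ik unfolding in_range_def b_def by auto
    show "wp B (mul_to ''c'' (Get ''A'' (Add (Var ''ri'') (Var ''k''))) (Var ''iv'') ;;
        Set ''c'' (Sub (Var ''M'') (Var ''c'')) ;;
        For ''j'' (Var ''n'') elim_entry) s
        (\<lambda>s'. wp B (Set ''ri'' (Add (Var ''ri'') (Var ''n''))) s' ?Q)"
    proof (rule wp_Seq, rule wp_mul_to[OF env])
      show "0 \<le> aval (Get ''A'' (Add (Var ''ri'') (Var ''k''))) s"
        "aval (Get ''A'' (Add (Var ''ri'') (Var ''k''))) s \<le> M"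
        unfolding aik using a ik by (auto simp: in_range_def intro: less_imp_le)
      fix s'
      assume c': "s' ''c'' 0 = (aval (Get ''A'' (Add (Var ''ri'') (Var ''k''))) s * aval (Var ''iv'') s) mod M"
        and ag: "agree {''ma'', ''mb'', ''mr'', ''mi'', ''mk'', ''c''} s s'" and env': "env s'"
      let ?s1 = "update s' ''c'' (aval (Lit 0) s') (aval (Sub (Var ''M'') (Var ''c'')) s')"
      have ag1: "agree {''ma'', ''mb'', ''mr'', ''mi'', ''mk'', ''c''} s ?s1"
        using ag by (auto simp: agree_def update_def)
      have env1: "env ?s1" by (rule env_agree[OF env ag1]) simp
      have c1: "?s1 ''c'' 0 = c" using c' unfolding aik
        using s envD(5)[OF env'] by (simp add: update_def c_def)
      have rep1: "represents ?s1 (b 0)" unfolding b0 by (rule represents_agree[OF rep ag1]) simp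
      show "wp B (Set ''c'' (Sub (Var ''M'') (Var ''c'')) ;; For ''j'' (Var ''n'') elim_entry) s'
        (\<lambda>s'. wp B (Set ''ri'' (Add (Var ''ri'') (Var ''n''))) s' ?Q)"
      proof (rule wp_Seq, rule wp_Assign,
          rule wp_mono[OF wp_For[where N = n and I = "\<lambda>t s'. represents s' (b t)"]])
        let ?X = "insert ''j'' (mods elim_entry)"
        show "n \<le> B" by (rule bounds)
        show "''j'' \<notin> mods elim_entry" by simp
        show "aval (Var ''n'') s'' = int n" if "agree ?X ?s1 s''" for s''
          using agreeD[OF that, of "''n''"] envD(1)[OF env1] by simp
        show "represents ?s1 (b 0)" by (rule rep1)
        show "represents (update s'' ''j'' 0 v) (b t)" if "represents s'' (b t)" for s'' v t
          by (rule represents_agree[OF that, of "{''j''}"]) (auto simp: agree_def update_def)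
        show "wp B elim_entry s'' (\<lambda>s'. represents s' (b (Suc t)))"
          if "t < n" "agree ?X ?s1 s''" "s'' ''j'' 0 = int t" "represents s'' (b t)" for s'' t
        proof -
          have "env s''" by (rule env_agree[OF env1 that(2)]) simp
          moreover have "s'' ''c'' 0 = c" "s'' ''rk'' 0 = int k * int n" "s'' ''ri'' 0 = int i * int n"
            using s c1 agreeD[OF that(2), of "''c''"] agreeD[OF that(2), of "''rk''"]
              agreeD[OF that(2), of "''ri''"] agreeD[OF ag1, of "''rk''"] agreeD[OF ag1, of "''ri''"]
            by auto
          ultimately show ?thesis
            unfolding b_Suc using that c ik by (intro wp_elim_entry b_range) auto
        qed
        fix s2 assume s2: "represents s2 (b n) \<and> agree ?X ?s1 s2"
        then have ag2: "agree ?X ?s1 s2" by blast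
        have "env s2" by (rule env_agree[OF env1 ag2]) simp
        moreover have "s2 ''ri'' 0 = int i * int n"
          using s agreeD[OF ag2, of "''ri''"] agreeD[OF ag1, of "''ri''"] by simp
        ultimately show "wp B (Set ''ri'' (Add (Var ''ri'') (Var ''n''))) s2 ?Q"
          using s2 bn by (intro last) auto
      qed
    qed (use s in \<open>simp_all add: update_def\<close>)
  qed
qed

text \<open>The error is a power of the even number \<open>1 - p\<close>. After \<open>B\<close>
  rounds its exponent is \<open>B + 1\<close>, so it vanishes modulo \<open>2 ^ B\<close>.\<close>

lemma wp_invert:
  assumes env: "env s" and p: "s ''p'' 0 = p" "0 \<le> p" "p < M" "odd p" and iv: "s ''iv'' 0 = 1"
    and Q: "\<And>s' iv. s' ''iv'' 0 = iv \<Longrightarrow> 0 \<le> iv \<Longrightarrow> iv < M \<Longrightarrow> [p * iv = 1] (mod M) \<Longrightarrow>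
      agree {''ma'', ''mb'', ''mr'', ''mi'', ''mk'', ''iv'', ''t''} s s' \<Longrightarrow> Q s'"
  shows "wp B (For ''t'' (Var ''L'') invert_step) s Q"
proof -
  \<comment> \<open>The exponent is \<open>Suc t\<close> because the start value 1 already has error
    \<open>1 - p\<close>.\<close>
  define I where "I t s' \<longleftrightarrow> 0 \<le> s' ''iv'' 0 \<and> s' ''iv'' 0 < M \<and>
      [p * s' ''iv'' 0 = 1 - (1 - p) ^ Suc t] (mod M)" for t and s' :: state
  have M1: "1 < M" using bounds(6) by (intro one_less_power) auto
  show ?thesis
  proof (rule wp_mono[OF wp_For[where N = B and I = I]])
    let ?X = "insert ''t'' (mods invert_step)"
    show "''t'' \<notin> mods invert_step" by simp
    show "aval (Var ''L'') s'' = int B" if "agree ?X s s''" for s''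
      using agreeD[OF that, of "''L''"] envD(4)[OF env] by simp
    show "I 0 s" using M1 iv by (simp add: I_def)
    show "I t (update s'' ''t'' 0 v)" if "I t s''" for s'' v t
      using that by (simp add: I_def update_def)
    show "wp B invert_step s'' (I (Suc t))" if ag: "agree ?X s s''" and I: "I t s''" for s'' t
      unfolding invert_step_def
    proof (rule wp_Seq, rule wp_mul_to)
      show env'': "env s''" by (rule env_agree[OF env ag]) simp
      have p'': "s'' ''p'' 0 = p" using p agreeD[OF ag, of "''p''"] by simp
      have ma: "aval (Sub (Add (Var ''M'') (Lit 1)) (Var ''p'')) s'' = M + 1 - p"
        using p'' envD(5)[OF env''] by simp
      have "p \<ge> 1" using p by (metis even_zero int_one_le_iff_zero_less less_le)
      then show "0 \<le> aval (Sub (Add (Var ''M'') (Lit 1)) (Var ''p'')) s''"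
        "aval (Sub (Add (Var ''M'') (Lit 1)) (Var ''p'')) s'' \<le> M"
        unfolding ma using p by auto
      show "0 \<le> aval (Var ''iv'') s''" "aval (Var ''iv'') s'' < M" using I by (auto simp: I_def)
      fix s1
      assume iv1: "s1 ''iv'' 0 = (aval (Sub (Add (Var ''M'') (Lit 1)) (Var ''p'')) s'' * aval (Var ''iv'') s'') mod M"
        and env1: "env s1"
      define x where "x = s'' ''iv'' 0"
      have x1: "s1 ''iv'' 0 = ((M + 1 - p) * x) mod M" using iv1 unfolding ma by (simp add: x_def)
      let ?y = "(s1 ''iv'' 0 + 1) mod M"
      have "[?y = (M + 1 - p) * x + 1] (mod M)" unfolding x1 by (simp add: cong_def mod_simps)
      also have "(M + 1 - p) * x + 1 = (1 + (1 - p) * x) + M * x" by (simp add: algebra_simps)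
      also have "[(1 + (1 - p) * x) + M * x = 1 + (1 - p) * x] (mod M)" by (simp add: cong_def)
      finally have "[p * ?y = p * (1 + (1 - p) * x)] (mod M)" by (intro cong_mult cong_refl)
      also have "[p * (1 + (1 - p) * x) = 1 - (1 - p) ^ Suc (Suc t)] (mod M)"
        using I by (intro inverse_step) (simp add: I_def x_def)
      finally have y: "[p * ?y = 1 - (1 - p) ^ Suc (Suc t)] (mod M)" .
      have range: "0 \<le> s1 ''iv'' 0" "s1 ''iv'' 0 < M" unfolding x1 by simp_all
      have "I (Suc t) (update (update s1 ''iv'' 0 (s1 ''iv'' 0 + 1)) ''iv'' 0 ?y)"
        using y by (simp add: I_def update_def)
      then show "wp B (Set ''iv'' (Add (Var ''iv'') (Lit 1)) ;; reduce ''iv'') s1 (I (Suc t))"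
        using range M1 envD(5)[OF env1]
        by (intro wp_Seq wp_Assign wp_reduce[where M = M]) (simp_all add: update_def)
    qed (simp_all add: update_def)
    show "Q s'" if "I B s' \<and> agree ?X s s'" for s'
    proof (rule Q[OF refl])
      have "even (1 - p)" using p by simp
      then have "M dvd (1 - p) ^ B" by (rule dvd_power_same)
      then have "M dvd (1 - p) ^ Suc B" by (simp add: dvd_mult)
      then have "[1 - (1 - p) ^ Suc B = 1 - 0] (mod M)"
        by (intro cong_diff cong_refl) (simp add: cong_0_iff del: power_Suc)
      with that show "[p * s' ''iv'' 0 = 1] (mod M)"
        using cong_trans by (auto simp: I_def simp del: power_Suc)
      show "agree {''ma'', ''mb'', ''mr'', ''mi'', ''mk'', ''iv'', ''t''} s s'"
        using that by (auto simp: agree_def)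
    qed (use that in \<open>auto simp: I_def\<close>)
  qed simp
qed

lemma wp_elim_col:
  assumes env: "env s" and a: "in_range a" "odd_diagonal a" and el: "eliminated k a"
    and rep: "represents s a"
    and s: "s ''k'' 0 = int k" "s ''rk'' 0 = int k * int n" "s ''det'' 0 = (\<Prod>t<k. a t t) mod M"
    and k: "k < n"
  shows "wp B elim_col s (\<lambda>s'. \<exists>b. represents s' b \<and> in_range b \<and> odd_diagonal b \<and>
    eliminated (Suc k) b \<and> [det_of n b = det_of n a] (mod M) \<and>
    s' ''det'' 0 = (\<Prod>t<Suc k. b t t) mod M \<and> s' ''rk'' 0 = int (Suc k) * int n)"
    (is "wp B elim_col s ?Q")
  unfolding elim_col_def
proof (rule wp_Seq, rule wp_Assign, rule wp_Seq, rule wp_mul_to)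
  let ?s1 = "update s ''p'' (aval (Lit 0) s) (aval (Get ''A'' (Add (Var ''rk'') (Var ''k''))) s)"
  have p: "?s1 ''p'' 0 = a k k"
    using representsD[OF rep k k] s by (simp add: update_def)
  have range: "0 \<le> a k k" "a k k < M" and odd: "odd (a k k)"
    using a k by (auto simp: in_range_def odd_diagonal_def)
  have ag1: "agree {''p''} s ?s1" by (auto simp: agree_def update_def)
  show env1: "env ?s1" by (rule env_agree[OF env ag1]) simp
  show "0 \<le> aval (Var ''det'') ?s1" "aval (Var ''det'') ?s1 \<le> M"
    using s(3) by (auto simp: update_def intro: less_imp_le)
  show "0 \<le> aval (Var ''p'') ?s1" "aval (Var ''p'') ?s1 < M"
    using range p by auto
  fix s2
  assume det2: "s2 ''det'' 0 = (aval (Var ''det'') ?s1 * aval (Var ''p'') ?s1) mod M"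
    and ag2: "agree {''ma'', ''mb'', ''mr'', ''mi'', ''mk'', ''det''} ?s1 s2" and env2: "env s2"
  have det: "s2 ''det'' 0 = (\<Prod>t<Suc k. a t t) mod M"
    unfolding det2 using p s(3) by (simp add: update_def mod_simps mult.commute)
  let ?s3 = "update s2 ''iv'' (aval (Lit 0) s2) (aval (Lit 1) s2)"
  have ag3: "agree {''iv''} s2 ?s3" by (auto simp: agree_def update_def)
  have env3: "env ?s3" by (rule env_agree[OF env2 ag3]) simp
  show "wp B (Set ''iv'' (Lit 1) ;; For ''t'' (Var ''L'') invert_step ;; Set ''ri'' (Lit 0) ;;
      For ''i'' (Var ''n'') elim_row ;; Set ''rk'' (Add (Var ''rk'') (Var ''n''))) s2 ?Q"
  proof (rule wp_Seq, rule wp_Assign, rule wp_Seq, rule wp_invert[OF env3])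
    show "?s3 ''p'' 0 = a k k" using p agreeD[OF ag2, of "''p''"] by (simp add: update_def)
    show "0 \<le> a k k" "a k k < M" "odd (a k k)" by (fact range odd)+
    show "?s3 ''iv'' 0 = 1" by (simp add: update_def)
    fix s4 iv
    assume iv: "s4 ''iv'' 0 = iv" "0 \<le> iv" "iv < M" "[a k k * iv = 1] (mod M)"
      and ag4: "agree {''ma'', ''mb'', ''mr'', ''mi'', ''mk'', ''iv'', ''t''} ?s3 s4"
    let ?s5 = "update s4 ''ri'' (aval (Lit 0) s4) (aval (Lit 0) s4)"
    have ag5: "agree {''p'', ''ma'', ''mb'', ''mr'', ''mi'', ''mk'', ''det'', ''iv'', ''t'', ''ri''} s ?s5"
      using ag1 ag2 ag3 ag4 by (auto simp: agree_def update_def)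
    have env5: "env ?s5" by (rule env_agree[OF env ag5]) simp
    have rep5: "represents ?s5 a" by (rule represents_agree[OF rep ag5]) simp
    have s5: "?s5 ''iv'' 0 = iv" "?s5 ''k'' 0 = int k" "?s5 ''rk'' 0 = int k * int n"
      "?s5 ''ri'' 0 = int 0 * int n" "?s5 ''det'' 0 = (\<Prod>t<Suc k. a t t) mod M"
      using iv(1) s agreeD[OF ag5, of "''k''"] agreeD[OF ag5, of "''rk''"] det
        agreeD[OF ag3, of "''det''"] agreeD[OF ag4, of "''det''"] by (auto simp: update_def)
    define I where "I i s' \<longleftrightarrow> represents s' (reduced k iv a i) \<and> s' ''ri'' 0 = int i * int n"
      for i and s' :: state
    show "wp B (Set ''ri'' (Lit 0) ;; For ''i'' (Var ''n'') elim_row ;;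
        Set ''rk'' (Add (Var ''rk'') (Var ''n''))) s4 ?Q"
    proof (rule wp_Seq, rule wp_Assign, rule wp_Seq, rule wp_mono[OF wp_For[where N = n and I = I]])
      let ?X = "insert ''i'' (mods elim_row)"
      show "n \<le> B" by (rule bounds)
      show "''i'' \<notin> mods elim_row" by simp
      show "aval (Var ''n'') s' = int n" if "agree ?X ?s5 s'" for s'
        using agreeD[OF that, of "''n''"] envD(1)[OF env5] by simp
      have "reduced k iv a 0 = a" by (simp add: reduced_def)
      then show "I 0 ?s5" using rep5 s5 unfolding I_def by metis
      show "I i (update s' ''i'' 0 v)" if "I i s'" for i s' v
        using that represents_agree[of s' _ "{''i''}" "update s' ''i'' 0 v"]
        by (auto simp: I_def agree_def update_def)
      show "wp B elim_row s' (I (Suc i))"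
        if "i < n" "agree ?X ?s5 s'" "s' ''i'' 0 = int i" "I i s'" for i s'
      proof -
        have "env s'" by (rule env_agree[OF env5 that(2)]) simp
        moreover have "s' ''iv'' 0 = iv" "s' ''k'' 0 = int k" "s' ''rk'' 0 = int k * int n"
          using s5 agreeD[OF that(2), of "''iv''"] agreeD[OF that(2), of "''k''"]
            agreeD[OF that(2), of "''rk''"] by auto
        ultimately show ?thesis
          using that iv k a(1) unfolding I_def by (intro wp_elim_row) auto
      qed
      fix s6
      assume s6: "I n s6 \<and> agree ?X ?s5 s6"
      then have ag6: "agree ?X ?s5 s6" and rep6: "represents s6 (reduced k iv a n)"
        by (auto simp: I_def)
      have env6: "env s6" by (rule env_agree[OF env5 ag6]) simp
      \<comment> \<open>The rows up to \<open>k\<close> are unchanged, so the product of pivots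
        recorded for \<open>a\<close> is also the one for the reduced matrix.\<close>
      have diag: "reduced k iv a n t t = a t t" if "t < Suc k" for t
        using that by (simp add: reduced_def)
      let ?s7 = "update s6 ''rk'' (aval (Lit 0) s6) (aval (Add (Var ''rk'') (Var ''n'')) s6)"
      have "represents ?s7 (reduced k iv a n)"
        by (rule represents_agree[OF rep6, of "{''rk''}"]) (auto simp: agree_def update_def)
      moreover have "?s7 ''rk'' 0 = int (Suc k) * int n"
        using s5 agreeD[OF ag6, of "''rk''"] envD(1)[OF env6] by (simp add: update_def algebra_simps)
      moreover have "?s7 ''det'' 0 = (\<Prod>t<Suc k. reduced k iv a n t t) mod M"
        using s5 agreeD[OF ag6, of "''det''"] diag by (simp add: update_def del: prod.lessThan_Suc)
      ultimately show "wp B (Set ''rk'' (Add (Var ''rk'') (Var ''n''))) s6 ?Q"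
        using in_range_reduced[OF a(1)] odd_diagonal_reduced[OF a(2) k]
          eliminated_reduced[OF el k iv(4)] det_of_reduced[OF k]
        by (intro wp_Assign) blast
    qed
  qed
qed (simp_all add: update_def)

lemma wp_elim:
  assumes env: "env s" and a: "in_range a" "odd_diagonal a" and rep: "represents s a"
    and Q: "\<And>s'. s' ''det'' 0 = det_of n a mod M \<Longrightarrow> agree (mods elim) s s' \<Longrightarrow> Q s'"
  shows "wp B elim s Q"
proof -
  define I where "I k s' \<longleftrightarrow> (\<exists>b. represents s' b \<and> in_range b \<and> odd_diagonal b \<and>
    eliminated k b \<and> [det_of n b = det_of n a] (mod M) \<and>
    s' ''det'' 0 = (\<Prod>t<k. b t t) mod M \<and> s' ''rk'' 0 = int k * int n)" for k and s' :: state
  have M1: "1 < M" using bounds(6) by (intro one_less_power) auto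
  show ?thesis
    unfolding elim_def
  proof (rule wp_Seq, rule wp_Assign, rule wp_Seq, rule wp_Assign,
      rule wp_mono[OF wp_For[where N = n and I = I]])
    let ?s1 = "update s ''det'' (aval (Lit 0) s) (aval (Lit 1) s)"
    let ?s2 = "update ?s1 ''rk'' (aval (Lit 0) ?s1) (aval (Lit 0) ?s1)"
    let ?X = "insert ''k'' (mods elim_col)"
    have ag2: "agree {''det'', ''rk''} s ?s2" by (auto simp: agree_def update_def)
    have env2: "env ?s2" by (rule env_agree[OF env ag2]) simp
    have rep2: "represents ?s2 a" by (rule represents_agree[OF rep ag2]) simp
    show "n \<le> B" by (rule bounds)
    show "''k'' \<notin> mods elim_col" by simp
    show "aval (Var ''n'') s' = int n" if "agree ?X ?s2 s'" for s'
      using agreeD[OF that, of "''n''"] envD(1)[OF env2] by simp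
    show "I 0 ?s2"
      unfolding I_def using rep2 a M1 bounds(6)
      by (intro exI[of _ a]) (auto simp: eliminated_def update_def)
    show "I k (update s' ''k'' 0 v)" if "I k s'" for k s' v
    proof -
      have "represents (update s' ''k'' 0 v) b" if "represents s' b" for b
        by (rule represents_agree[OF that, of "{''k''}"]) (auto simp: agree_def update_def)
      moreover have "update s' ''k'' 0 v ''det'' 0 = s' ''det'' 0" "update s' ''k'' 0 v ''rk'' 0 = s' ''rk'' 0"
        by (simp_all add: update_def)
      ultimately show ?thesis using that unfolding I_def by metis
    qed
    show "wp B elim_col s' (I (Suc k))"
      if kn: "k < n" and ag: "agree ?X ?s2 s'" and sk: "s' ''k'' 0 = int k" and I: "I k s'" for k s'
    proof -
      obtain b where b: "represents s' b" "in_range b" "odd_diagonal b" "eliminated k b"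
        "[det_of n b = det_of n a] (mod M)" "s' ''det'' 0 = (\<Prod>t<k. b t t) mod M" "s' ''rk'' 0 = int k * int n"
        using I unfolding I_def by blast
      have "env s'" by (rule env_agree[OF env2 ag]) simp
      from wp_elim_col[OF this b(2-4,1) sk b(7,6) kn] show ?thesis
        by (rule wp_mono) (use b(5) cong_trans in \<open>unfold I_def, blast\<close>)
    qed
    show "Q s'" if fin: "I n s' \<and> agree ?X ?s2 s'" for s'
    proof (rule Q)
      obtain b where b: "eliminated n b" "[det_of n b = det_of n a] (mod M)"
        "s' ''det'' 0 = (\<Prod>t<n. b t t) mod M"
        using fin unfolding I_def by blast
      have "[det_of n b = (\<Prod>t<n. b t t)] (mod M)"
        using b(1) by (intro det_of_triangular_mod) (auto simp: eliminated_def)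
      then show "s' ''det'' 0 = det_of n a mod M" using b(2,3) by (simp add: cong_def)
      show "agree (mods elim) s s'"
        using fin by (auto simp: agree_def update_def)
    qed
  qed
qed

end

section \<open>The search\<close>

text \<open>The bits of \<open>det\<close> are peeled off from the top. \<open>decode\<close> is
  called for the digit sum in \<open>v\<close> alone; its list goes to the array \<open>y\<close> in
  order to spare \<open>x\<close>.\<close>

definition scan_body :: com where
  "scan_body =
     Set ''b'' (Sub (Sub (Var ''L'') (Var ''i2'')) (Lit 1)) ;;
     If (Less (Var ''det'') (Get ''p2'' (Var ''b''))) Skip
       (Set ''det'' (Sub (Var ''det'') (Get ''p2'' (Var ''b''))) ;;
        Set ''K'' (Var ''b'') ;;
        decode ''y'' ;;
        If (And (Not (Less (Var ''v'') (Sub (Add (Var ''n'') (Var ''n'')) (Lit 2))))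
                (Not (Less (Sub (Add (Var ''n'') (Var ''n'')) (Lit 2)) (Var ''v''))))
          (Set ''answer'' (Lit 1)) Skip)"

definition scan :: com where
  "scan = For ''i2'' (Var ''L'') scan_body"

definition main_body :: com where
  "main_body = Set ''K'' (Var ''kk'') ;; decode ''x'' ;; build ;; elim ;; scan"

text \<open>All numbers below \<open>B\<close> are tried, since \<open>decode\<close> divides by
  \<open>n * n\<close> anyway; each grouping code then occurs \<open>n * n\<close> times, at the
  cost of a polynomial factor.\<close>

definition main :: com where
  "main = For ''kk'' (Var ''L'') main_body"

lemma mods_scan_body [simp]:
  "mods scan_body = {''b'', ''det'', ''K'', ''v'', ''dj'', ''dg'', ''dt'', ''y'', ''answer''}"
  by (auto simp: scan_body_def)

lemma mods_scan [simp]: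
  "mods scan = {''b'', ''det'', ''K'', ''v'', ''dj'', ''dg'', ''dt'', ''y'', ''answer'', ''i2''}"
  by (auto simp: scan_def)

lemma mods_main_body [simp]:
  "mods main_body = {''K'', ''v'', ''dj'', ''dg'', ''dt'', ''x''} \<union> mods build \<union> mods elim \<union> mods scan"
  by (auto simp: main_body_def)

lemma bit_iff_top:
  fixes D :: int
  assumes "D \<ge> 0"
  shows "bit D r \<longleftrightarrow> \<not> D mod 2 ^ Suc r < 2 ^ r"
proof (cases "D mod 2 ^ Suc r < 2 ^ r")
  case True
  from top_bit_step(1)[OF assms True] have "D div 2 ^ r = 2 * (D div 2 ^ Suc r)" by blast
  then show ?thesis using True by (simp add: bit_iff_odd del: power_Suc)
next
  case False
  from top_bit_step(2)[OF assms False] have "D div 2 ^ r = 2 * (D div 2 ^ Suc r) + 1" by blast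
  then show ?thesis using False by (simp add: bit_iff_odd del: power_Suc)
qed

context machine
begin

text \<open>A digit of the determinant is a block of \<open>n\<^sup>2\<close> bits, which cannot overflow as there are fewer
  than \<open>2\<close> to the power \<open>n\<^sup>2\<close> forests; hence the division by \<open>n\<^sup>2\<close>.\<close>

definition tree_position :: "nat \<Rightarrow> bool" where
  "tree_position b \<longleftrightarrow> length (power_terms (d + 1) m (b div (n * n))) = 2 * n - 2"

lemma wp_scan:
  assumes env: "env s" and D: "s ''det'' 0 = D" "0 \<le> D" "D < M"
    and Q: "\<And>s'. s' ''answer'' 0 =
        (if \<exists>b<B. bit D b \<and> tree_position b then 1 else s ''answer'' 0) \<Longrightarrow>
      agree (mods scan) s s' \<Longrightarrow> Q s'"
  shows "wp B scan s Q"
proof -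
  \<comment> \<open>The bits from \<open>B - i\<close> upwards have been inspected. An answer 1 from
    an earlier guess is never reset.\<close>
  define A where "A i = (if \<exists>b<B. B - i \<le> b \<and> bit D b \<and> tree_position b then 1 else s ''answer'' 0)"
    for i
  define I where "I i s' \<longleftrightarrow> s' ''det'' 0 = D mod 2 ^ (B - i) \<and> s' ''answer'' 0 = A i"
    for i and s' :: state
  let ?X = "insert ''i2'' (mods scan_body)"
  show ?thesis
    unfolding scan_def
  proof (rule wp_mono[OF wp_For[where N = B and I = I]])
    show "''i2'' \<notin> mods scan_body" by simp
    show "aval (Var ''L'') s' = int B" if "agree ?X s s'" for s'
      using agreeD[OF that, of "''L''"] envD(4)[OF env] by simp
    show "I 0 s" using D by (auto simp: I_def A_def)
    show "I i (update s' ''i2'' 0 v)" if "I i s'" for i s' v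
      using that by (simp add: I_def update_def)
    show "Q s'" if "I B s' \<and> agree ?X s s'" for s'
    proof (rule Q)
      show "s' ''answer'' 0 = (if \<exists>b<B. bit D b \<and> tree_position b then 1 else s ''answer'' 0)"
        using that by (simp add: I_def A_def)
      show "agree (mods scan) s s'" using that by (auto simp: agree_def)
    qed
    fix i s'
    assume i: "i < B" and ag: "agree ?X s s'" and i2: "s' ''i2'' 0 = int i" and I: "I i s'"
    have env': "env s'" by (rule env_agree[OF env ag]) simp
    define r where "r = B - Suc i"
    have r: "B - i = Suc r" "B - Suc i = r" "r < B" using i by (auto simp: r_def)
    have det: "s' ''det'' 0 = D mod 2 ^ Suc r" and ans: "s' ''answer'' 0 = A i"
      using I by (simp_all add: I_def r)
    have split: "(\<exists>b<B. r \<le> b \<and> P b) \<longleftrightarrow> P r \<or> (\<exists>b<B. Suc r \<le> b \<and> P b)" for P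
      using r(3) by (auto simp: le_less Suc_le_eq)
    have A_Suc: "A (Suc i) = (if bit D r \<and> tree_position r then 1 else A i)"
      unfolding A_def r split by auto
    let ?s1 = "update s' ''b'' (aval (Lit 0) s') (aval (Sub (Sub (Var ''L'') (Var ''i2'')) (Lit 1)) s')"
    have b1: "?s1 ''b'' 0 = int r" using envD(4)[OF env'] i2 i by (simp add: update_def r_def)
    have env1: "env ?s1" by (rule env_agree[OF env', of "{''b''}"]) (auto simp: agree_def update_def)
    have p2: "?s1 ''p2'' (int r) = 2 ^ r" using envD(7)[OF env1] r by simp
    have s1: "?s1 ''det'' 0 = D mod 2 ^ Suc r" "?s1 ''answer'' 0 = A i"
      using det ans by (simp_all add: update_def)
    show "wp B scan_body s' (I (Suc i))"
      unfolding scan_body_def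
    proof (rule wp_Seq, rule wp_Assign, rule wp_If)
      assume "bval (Less (Var ''det'') (Get ''p2'' (Var ''b''))) ?s1"
      then have less: "D mod 2 ^ Suc r < 2 ^ r" using b1 p2 s1 by simp
      then have "\<not> bit D r" using bit_iff_top[OF D(2)] by blast
      then have "A (Suc i) = A i" using A_Suc by simp
      moreover have "D mod 2 ^ r = D mod 2 ^ Suc r" using top_bit_step(1)[OF D(2) less] by blast
      ultimately have "I (Suc i) ?s1" using s1 unfolding I_def r by simp
      then show "wp B Skip ?s1 (I (Suc i))" by (intro wp_Skip)
    next
      assume "\<not> bval (Less (Var ''det'') (Get ''p2'' (Var ''b''))) ?s1"
      then have nless: "\<not> D mod 2 ^ Suc r < 2 ^ r" using b1 p2 s1 by simp
      then have "bit D r" using bit_iff_top[OF D(2)] by blast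
      then have A': "A (Suc i) = (if tree_position r then 1 else A i)" using A_Suc by simp
      have D': "D mod 2 ^ r = D mod 2 ^ Suc r - 2 ^ r" using top_bit_step(2)[OF D(2) nless] by blast
      let ?s2 = "update ?s1 ''det'' (aval (Lit 0) ?s1) (aval (Sub (Var ''det'') (Get ''p2'' (Var ''b''))) ?s1)"
      let ?s3 = "update ?s2 ''K'' (aval (Lit 0) ?s2) (aval (Var ''b'') ?s2)"
      have ag3: "agree {''det'', ''K''} ?s1 ?s3" by (auto simp: agree_def update_def)
      have env3: "env ?s3" by (rule env_agree[OF env1 ag3]) simp
      have K3: "?s3 ''K'' 0 = int r" using b1 by (simp add: update_def)
      have s3: "?s3 ''det'' 0 = D mod 2 ^ r" "?s3 ''answer'' 0 = A i"
        using s1 b1 p2 D' by (simp_all add: update_def)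
      show "wp B (Set ''det'' (Sub (Var ''det'') (Get ''p2'' (Var ''b''))) ;;
          Set ''K'' (Var ''b'') ;; decode ''y'' ;;
          If (And (Not (Less (Var ''v'') (Sub (Add (Var ''n'') (Var ''n'')) (Lit 2))))
                (Not (Less (Sub (Add (Var ''n'') (Var ''n'')) (Lit 2)) (Var ''v''))))
          (Set ''answer'' (Lit 1)) Skip) ?s1 (I (Suc i))"
      proof (rule wp_Seq, rule wp_Assign, rule wp_Seq, rule wp_Assign, rule wp_Seq,
          rule wp_decode)
        show "env ?s3" "?s3 ''K'' 0 = int r" "r < B" by (fact env3 K3 r(3))+
        fix s4
        assume v: "s4 ''v'' 0 = int (length (power_terms (d + 1) m (r div (n * n))))"
          and ag4: "agree {''v'', ''dj'', ''dg'', ''dt'', ''K'', ''y''} ?s3 s4"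
        have env4: "env s4" by (rule env_agree[OF env3 ag4]) simp
        have s4: "s4 ''det'' 0 = D mod 2 ^ r" "s4 ''answer'' 0 = A i"
          using s3 agreeD[OF ag4, of "''det''"] agreeD[OF ag4, of "''answer''"] by auto
        have test: "bval (And (Not (Less (Var ''v'') (Sub (Add (Var ''n'') (Var ''n'')) (Lit 2))))
                (Not (Less (Sub (Add (Var ''n'') (Var ''n'')) (Lit 2)) (Var ''v'')))) s4 \<longleftrightarrow>
            tree_position r"
          using v envD(1)[OF env4] n unfolding tree_position_def by auto
        show "wp B (If (And (Not (Less (Var ''v'') (Sub (Add (Var ''n'') (Var ''n'')) (Lit 2))))
                (Not (Less (Sub (Add (Var ''n'') (Var ''n'')) (Lit 2)) (Var ''v''))))
          (Set ''answer'' (Lit 1)) Skip) s4 (I (Suc i))"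
          by (intro wp_If wp_Assign wp_Skip; unfold test)
            (use s4 A' in \<open>simp_all add: I_def r update_def\<close>)
      qed simp
    qed
  qed simp
qed

definition tree_exists :: bool where
  "tree_exists \<longleftrightarrow> (\<exists>f. parent_tree n E f \<and> (\<forall>v<n. forest_degree n f v \<le> d))"

text \<open>The length condition ensures that every vertex is assigned a group by \<open>K\<close>
  itself, with no leftover from an earlier guess.\<close>

definition good_guess :: "nat \<Rightarrow> bool" where
  "good_guess K \<longleftrightarrow> n \<le> length (power_terms (d + 1) m (K div (n * n))) \<and>
     (\<exists>f. parent_tree n E f \<and>
       (\<forall>j. group_degree n (\<lambda>v. power_terms (d + 1) m (K div (n * n)) ! v) f j \<le> d))"

lemma det_of_mod: "det_of n (\<lambda>i j. a i j mod M) mod M = det_of n a mod M"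
  using det_of_cong_mod[of n "\<lambda>i j. a i j mod M" a M] by (simp add: cong_def)

lemma bit_mod_M: "b < B \<Longrightarrow> bit (int Z mod M) b \<longleftrightarrow> bit Z b"
  unfolding take_bit_eq_mod[symmetric] by (simp add: bit_take_bit_iff bit_of_nat_iff_bit)

text \<open>A short guess mixes with leftover exponents, but the array still encodes some grouping
  into groups below \<open>m\<close>, and soundness holds for every grouping. So the guesses need
  not be checked.\<close>

lemma wp_main_body:
  assumes env: "env s" and K: "s ''kk'' 0 = int K" "K < B"
    and g: "\<And>v. v < n \<Longrightarrow> g v < m \<and> s ''x'' (int v) = int (n * n * (d + 1) ^ g v)"
    and ans: "s ''answer'' 0 = 0 \<or> s ''answer'' 0 = 1 \<and> tree_exists"
  shows "wp B main_body s (\<lambda>s'.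
    (\<exists>g. \<forall>v<n. g v < m \<and> s' ''x'' (int v) = int (n * n * (d + 1) ^ g v)) \<and>
    (s' ''answer'' 0 = 0 \<or> s' ''answer'' 0 = 1 \<and> tree_exists) \<and>
    (s ''answer'' 0 = 1 \<or> good_guess K \<longrightarrow> s' ''answer'' 0 = 1))"
    (is "wp B main_body s ?Q")
  unfolding main_body_def
proof (rule wp_Seq, rule wp_Assign, rule wp_Seq, rule wp_decode)
  let ?s1 = "update s ''K'' (aval (Lit 0) s) (aval (Var ''kk'') s)"
  let ?l = "power_terms (d + 1) m (K div (n * n))"
  have ag1: "agree {''K''} s ?s1" by (auto simp: agree_def update_def)
  show env1: "env ?s1" by (rule env_agree[OF env ag1]) simp
  show "?s1 ''K'' 0 = int K" using K by (simp add: update_def)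
  show "K < B" by (rule K)
  fix s2
  assume x2: "s2 ''x'' = stored (?s1 ''x'') ?l"
    and ag2: "agree {''v'', ''dj'', ''dg'', ''dt'', ''K'', ''x''} ?s1 s2"
  have ag2': "agree {''v'', ''dj'', ''dg'', ''dt'', ''K'', ''x''} s s2"
    using ag1 ag2 by (auto simp: agree_def)
  have env2: "env s2" by (rule env_agree[OF env ag2']) simp
  define g' where "g' v = (if v < length ?l then ?l ! v else g v)" for v
  have g'm: "g' v < m" if "v < n" for v
    using g[OF that] power_terms_less[of "?l ! v" "d + 1" m "K div (n * n)"] by (auto simp: g'_def)
  define xs where "xs v = n * n * (d + 1) ^ g' v" for v
  have x2': "s2 ''x'' (int v) = int (xs v)" if "v < n" for v
    using g[OF that] by (simp add: x2 stored_def xs_def g'_def update_def)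
  \<comment> \<open>Groups are at most \<open>m - 1\<close> and \<open>2 \<le> d + 1\<close>, so two
    exponents together do not exceed \<open>B\<close>.\<close>
  have xs_le: "xs u + xs v \<le> B" if "u < n" "v < n" for u v
  proof -
    have le: "xs v \<le> n * n * (d + 1) ^ (m - 1)" if "v < n" for v
      using g'm[OF that] unfolding xs_def by (intro mult_left_mono power_increasing) auto
    have "xs u + xs v \<le> 2 * (n * n * (d + 1) ^ (m - 1))" using le[OF that(1)] le[OF that(2)] by simp
    also have "\<dots> \<le> (d + 1) * (n * n * (d + 1) ^ (m - 1))" using d by (intro mult_right_mono) auto
    also have "\<dots> = B" unfolding B_def using m by (cases m) (auto simp: ac_simps)
    finally show ?thesis .
  qed
  have xs_pos: "xs v > 0" for v using n by (simp add: xs_def)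
  show "wp B (build ;; elim ;; scan) s2 ?Q"
  proof (rule wp_Seq, rule wp_build[OF env2 x2' xs_le])
    fix s3
    assume rep: "represents s3 (\<lambda>u v. forest_matrix n E xs u v mod M)"
      and ag3: "agree {''bw'', ''A'', ''bd'', ''w'', ''ro'', ''u''} s2 s3"
    have env3: "env s3" by (rule env_agree[OF env2 ag3]) simp
    show "wp B (elim ;; scan) s3 ?Q"
    proof (rule wp_Seq, rule wp_elim[OF env3 _ _ rep])
      show "in_range (\<lambda>u v. forest_matrix n E xs u v mod M)" by (simp add: in_range_def)
      have "even (edge_weight E xs u v)" for u v
        using xs_pos[of u] by (simp add: edge_weight_def)
      then show "odd_diagonal (\<lambda>u v. forest_matrix n E xs u v mod M)"
        unfolding odd_diagonal_def mod_M_even forest_matrix_def by (auto simp: dvd_sum)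
      fix s4
      assume det: "s4 ''det'' 0 = det_of n (\<lambda>u v. forest_matrix n E xs u v mod M) mod M"
        and ag4: "agree (mods elim) s3 s4"
      have env4: "env s4" by (rule env_agree[OF env3 ag4]) simp
      have loopfree: "{v} \<notin> E" for v
        using E unfolding simple_graph_def by (metis doubleton_eq_iff insert_absorb2)
      have det': "s4 ''det'' 0 = int (forest_poly n E xs) mod M"
        unfolding det det_of_mod det_of_forest_matrix[OF loopfree] ..
      have s4: "s4 ''answer'' 0 = s ''answer'' 0" "s4 ''x'' = s2 ''x''"
        using agreeD[OF ag2', of "''answer''"] agreeD[OF ag3, of "''answer''"] agreeD[OF ag4, of "''answer''"]
          agreeD[OF ag3, of "''x''"] agreeD[OF ag4, of "''x''"] by auto
      have poly: "forest_poly n E xs = forest_poly n E (\<lambda>v. n * n * (d + 1) ^ g' v)"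
        unfolding xs_def ..
      show "wp B scan s4 ?Q"
      proof (rule wp_scan[OF env4 det'])
        fix s5
        assume ans5: "s5 ''answer'' 0 = (if \<exists>b<B. bit (int (forest_poly n E xs) mod M) b \<and> tree_position b
            then 1 else s4 ''answer'' 0)" and ag5: "agree (mods scan) s4 s5"
        have "s5 ''x'' = s2 ''x''" using s4 agreeD[OF ag5, of "''x''"] by simp
        then have "\<forall>v<n. g' v < m \<and> s5 ''x'' (int v) = int (n * n * (d + 1) ^ g' v)"
          using x2' g'm by (simp add: xs_def)
        moreover have "tree_exists" if ex: "\<exists>b<B. bit (int (forest_poly n E xs) mod M) b \<and> tree_position b"
        proof -
          obtain b where b: "b < B" "bit (int (forest_poly n E xs) mod M) b" "tree_position b"
            using ex by blast
          then have "bit (forest_poly n E (\<lambda>v. n * n * (d + 1) ^ g' v)) b"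
            using bit_mod_M unfolding poly by blast
          then show ?thesis
            unfolding tree_exists_def
            using b(1,3) g'm unfolding B_def tree_position_def by (intro bit_imp_bounded_tree[OF n d(1)])
        qed
        moreover have "\<exists>b<B. bit (int (forest_poly n E xs) mod M) b \<and> tree_position b" if good: "good_guess K"
        proof -
          have l: "n \<le> length ?l" using good by (simp add: good_guess_def)
          then have "group_degree n (\<lambda>v. ?l ! v) f j = group_degree n g' f j" for f j
            unfolding group_degree_def by (intro sum.cong) (auto simp: g'_def)
          then obtain f where "parent_tree n E f" "\<And>j. group_degree n g' f j \<le> d"
            using good unfolding good_guess_def by auto
          then obtain b where b: "b < B" "tree_position b"
              "bit (forest_poly n E (\<lambda>v. n * n * (d + 1) ^ g' v)) b"
            using bounded_tree_imp_bit[OF n d(1), of g' m E f] g'm unfolding B_def tree_position_def by blast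
          then have "bit (int (forest_poly n E xs) mod M) b"
            using bit_mod_M unfolding poly by blast
          with b show ?thesis by blast
        qed
        ultimately show "?Q s5" using ans ans5 s4(1) by auto
      qed simp_all
    qed
  qed
qed simp

lemma wp_main:
  assumes env: "env s" and x: "\<And>v. v < n \<Longrightarrow> s ''x'' (int v) = int (n * n)"
    and ans: "s ''answer'' 0 = 0" and k: "m = 2 * k" "2 * n \<le> k * (d + 1)"
  shows "wp B main s (\<lambda>s'. s' ''answer'' 0 = of_bool tree_exists)"
proof -
  define I where "I K s' \<longleftrightarrow> (\<exists>g. \<forall>v<n. g v < m \<and> s' ''x'' (int v) = int (n * n * (d + 1) ^ g v)) \<and>
    (s' ''answer'' 0 = 0 \<or> s' ''answer'' 0 = 1 \<and> tree_exists) \<and>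
    (\<forall>K'<K. good_guess K' \<longrightarrow> s' ''answer'' 0 = 1)" for K and s' :: state
  let ?X = "insert ''kk'' (mods main_body)"
  show ?thesis
    unfolding main_def
  proof (rule wp_mono[OF wp_For[where N = B and I = I]])
    show "''kk'' \<notin> mods main_body" by simp
    show "aval (Var ''L'') s' = int B" if "agree ?X s s'" for s'
      using agreeD[OF that, of "''L''"] envD(4)[OF env] by simp
    show "I 0 s" unfolding I_def using x ans m by (auto intro!: exI[of _ "\<lambda>_. 0"])
    show "I K (update s' ''kk'' 0 v)" if "I K s'" for K s' v
      using that by (simp add: I_def update_def)
    show "wp B main_body s' (I (Suc K))"
      if KB: "K < B" and ag: "agree ?X s s'" and kk: "s' ''kk'' 0 = int K" and I: "I K s'" for K s'
    proof -
      have env': "env s'" by (rule env_agree[OF env ag]) simp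
      obtain g where g: "\<And>v. v < n \<Longrightarrow> g v < m \<and> s' ''x'' (int v) = int (n * n * (d + 1) ^ g v)"
        using I unfolding I_def by blast
      have "s' ''answer'' 0 = 0 \<or> s' ''answer'' 0 = 1 \<and> tree_exists" using I unfolding I_def by blast
      from wp_main_body[OF env' kk KB g this] show ?thesis
        by (rule wp_mono) (use I in \<open>auto simp: I_def less_Suc_eq\<close>)
    qed
    show "s' ''answer'' 0 = of_bool tree_exists" if "I B s' \<and> agree ?X s s'" for s'
    proof (cases tree_exists)
      case True
      then obtain f where f: "parent_tree n E f" "\<And>v. v < n \<Longrightarrow> forest_degree n f v \<le> d"
        unfolding tree_exists_def by blast
      obtain K where K: "K < (d + 1) ^ m" "n \<le> length (power_terms (d + 1) m K)"
          "\<And>j. group_degree n (\<lambda>v. power_terms (d + 1) m K ! v) f j \<le> d"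
        using bounded_tree_grouping[OF n d(1) k(2) f] unfolding k(1) by blast
      \<comment> \<open>The factor \<open>n * n\<close> compensates for the division in
        \<open>decode\<close>.\<close>
      have "n * n * K < B" unfolding B_def using K(1) n by simp
      moreover have "n * n * K div (n * n) = K" using n by simp
      then have "good_guess (n * n * K)" unfolding good_guess_def using K f(1) by metis
      ultimately show ?thesis using that True unfolding I_def by auto
    next
      case False
      then show ?thesis using that unfolding I_def by auto
    qed
  qed simp
qed

end

section \<open>The complete program\<close>

text \<open>Repeated addition of \<open>d + 1\<close> yields \<open>m\<close> as twice the ceiling
  of \<open>2 * n / (d + 1)\<close>; \<open>2 * n\<close> rounds are always enough.\<close>

definition setup_dims :: com where
  "setup_dims =
     If (Less (Var ''n'') (Var ''d'')) (Set ''d'' (Var ''n'')) Skip ;;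
     Set ''q'' (Add (Var ''d'') (Lit 1)) ;;
     Set ''tt'' (Lit 0) ;;
     Set ''m'' (Lit 0) ;;
     For ''i'' (Add (Var ''n'') (Var ''n''))
       (If (Less (Var ''tt'') (Add (Var ''n'') (Var ''n'')))
          (Set ''tt'' (Add (Var ''tt'') (Var ''q'')) ;; Set ''m'' (Add (Var ''m'') (Lit 2))) Skip)"

definition setup_powers :: com where
  "setup_powers =
     Set ''s'' (Lit 0) ;;
     For ''i'' (Var ''n'') (Set ''s'' (Add (Var ''s'') (Var ''n''))) ;;
     Assign ''ex'' (Lit 0) (Var ''s'') ;;
     For ''i'' (Var ''m'')
       (Set ''acc'' (Lit 0) ;;
        For ''j'' (Var ''q'') (Set ''acc'' (Add (Var ''acc'') (Get ''ex'' (Var ''i'')))) ;;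
        Assign ''ex'' (Add (Var ''i'') (Lit 1)) (Var ''acc''))"

definition setup_bits :: com where
  "setup_bits =
     Set ''L'' (Get ''ex'' (Var ''m'')) ;;
     Assign ''p2'' (Lit 0) (Lit 1) ;;
     For ''i'' (Var ''L'')
       (Assign ''p2'' (Add (Var ''i'') (Lit 1)) (Add (Get ''p2'' (Var ''i'')) (Get ''p2'' (Var ''i'')))) ;;
     Set ''M'' (Get ''p2'' (Var ''L''))"

text \<open>Every vertex starts in group 0, so \<open>x\<close> encodes a legal grouping before the
  first guess.\<close>

definition setup_groups :: com where
  "setup_groups = For ''i'' (Var ''n'') (Assign ''x'' (Var ''i'') (Get ''ex'' (Lit 0)))"

text \<open>For \<open>d = 1\<close> the bound is polynomial in \<open>n\<close> while the search takes exponential time, so the case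
  \<open>n > 2\<close> is excluded beforehand; degrees above \<open>n\<close> are replaced by \<open>n\<close> in \<open>setup_dims\<close>.\<close>

definition program :: com where
  "program =
     If (Less (Var ''n'') (Lit 2))
       (If (Less (Var ''d'') (Lit 0)) Skip (Set ''answer'' (Lit 1)))
       (If (And (Less (Lit 0) (Var ''d'')) (Not (And (Less (Var ''d'') (Lit 2)) (Less (Lit 2) (Var ''n'')))))
          (setup_dims ;; setup_powers ;; setup_bits ;; setup_groups ;; main) Skip)"

definition plain_input :: "nat \<Rightarrow> nat set set \<Rightarrow> state \<Rightarrow> bool" where
  "plain_input n E s \<longleftrightarrow> s ''n'' 0 = int n \<and> s ''answer'' 0 = 0 \<and>
     (\<forall>u<n. \<forall>v<n. s ''adj'' (int (u * n + v)) = of_bool ({u, v} \<in> E))"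

lemma plain_input_agree:
  assumes "plain_input n E s" "agree X s s'" "X \<inter> {''n'', ''answer'', ''adj''} = {}"
  shows "plain_input n E s'"
proof -
  have "s' x = s x" if "x \<in> {''n'', ''answer'', ''adj''}" for x
    using assms(2,3) that by (auto simp: agree_def)
  then show ?thesis using assms(1) unfolding plain_input_def by simp
qed

text \<open>The existential over index pairs in \<open>input_state\<close> is unambiguous, because
  division by \<open>n\<close> recovers the row from the index.\<close>

lemma plain_input_state: "plain_input n E (input_state n d E)"
proof -
  have "(\<exists>u'<n. \<exists>v'<n. int (u * n + v) = int (u' * n + v') \<and> {u', v'} \<in> E) \<longleftrightarrow> {u, v} \<in> E"
    if "u < n" "v < n" for u v
  proof -
    have "u' = u \<and> v' = v" if "u * n + v = u' * n + v'" "v' < n" for u' v'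
    proof -
      have "(u * n + v) div n = u" using \<open>v < n\<close> by simp
      moreover have "(u' * n + v') div n = u'" using that(2) by simp
      ultimately have "u' = u" using that(1) by metis
      then show ?thesis using that(1) by simp
    qed
    then show ?thesis using that unfolding of_nat_eq_iff by metis
  qed
  then show ?thesis by (simp add: plain_input_def input_state_def)
qed

text \<open>The inequalities make \<open>k\<close> the ceiling of \<open>2 * n / (d + 1)\<close>:
  the first provides enough groups, the second keeps \<open>B\<close> within the time bound.\<close>

locale machine_setup = machine +
  fixes k :: nat
  assumes mk: "m = 2 * k" and k: "2 * n \<le> k * (d + 1)" "(k - 1) * (d + 1) < 2 * n"
begin

lemma k_le: "k \<le> 2 * n"
proof -
  have "k - 1 \<le> (k - 1) * (d + 1)" by simp
  then show ?thesis using k(2) by linarith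
qed

lemma wp_setup_dims:
  assumes s: "plain_input n E s" "s ''d'' 0 = d0" "int d = min d0 (int n)"
    and Q: "\<And>s'. plain_input n E s' \<Longrightarrow> s' ''d'' 0 = int d \<Longrightarrow> s' ''q'' 0 = int d + 1 \<Longrightarrow>
      s' ''m'' 0 = int m \<Longrightarrow> Q s'"
  shows "wp B setup_dims s Q"
proof -
  let ?q = "int d + 1"
  let ?c1 = "If (Less (Var ''n'') (Var ''d'')) (Set ''d'' (Var ''n'')) Skip"
  let ?body = "If (Less (Var ''tt'') (Add (Var ''n'') (Var ''n'')))
          (Set ''tt'' (Add (Var ''tt'') (Var ''q'')) ;; Set ''m'' (Add (Var ''m'') (Lit 2))) Skip"
  have n1: "s ''n'' 0 = int n" using s(1) by (simp add: plain_input_def)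
  have clamp: "wp B ?c1 s (\<lambda>s1. s1 ''d'' 0 = int d \<and> agree {''d''} s s1)"
    using s(2,3) n1
    by (intro wp_If wp_Assign wp_Skip) (auto simp: agree_def update_def)
  \<comment> \<open>After \<open>k\<close> rounds \<open>tt\<close> has reached \<open>2 * n\<close>
    and the loop idles, hence the minimum.\<close>
  define I where "I i s' \<longleftrightarrow> s' ''tt'' 0 = int (min i k) * ?q \<and> s' ''m'' 0 = 2 * int (min i k)"
    for i and s' :: state
  show ?thesis
    unfolding setup_dims_def
  proof (rule wp_Seq, rule wp_mono[OF clamp], elim conjE)
    fix s1 assume d1: "s1 ''d'' 0 = int d" and ag1: "agree {''d''} s s1"
    let ?s2 = "update s1 ''q'' (aval (Lit 0) s1) (aval (Add (Var ''d'') (Lit 1)) s1)"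
    let ?s3 = "update ?s2 ''tt'' (aval (Lit 0) ?s2) (aval (Lit 0) ?s2)"
    let ?s4 = "update ?s3 ''m'' (aval (Lit 0) ?s3) (aval (Lit 0) ?s3)"
    have ag4: "agree {''d'', ''q'', ''tt'', ''m''} s ?s4" using ag1 by (auto simp: agree_def update_def)
    have s4: "?s4 ''n'' 0 = int n" "?s4 ''d'' 0 = int d" "?s4 ''q'' 0 = ?q" "I 0 ?s4"
      using d1 n1 agreeD[OF ag4, of "''n''"] by (auto simp: update_def I_def)
    show "wp B (Set ''q'' (Add (Var ''d'') (Lit 1)) ;; Set ''tt'' (Lit 0) ;; Set ''m'' (Lit 0) ;;
        For ''i'' (Add (Var ''n'') (Var ''n'')) ?body) s1 Q"
    proof (rule wp_Seq, rule wp_Assign, rule wp_Seq, rule wp_Assign, rule wp_Seq, rule wp_Assign,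
        rule wp_mono[OF wp_For[where N = "2 * n" and I = I]])
      let ?X = "insert ''i'' (mods ?body)"
      show "2 * n \<le> B" by (rule bounds)
      show "''i'' \<notin> mods ?body" by simp
      show "aval (Add (Var ''n'') (Var ''n'')) s' = int (2 * n)" if "agree ?X ?s4 s'" for s'
        using agreeD[OF that, of "''n''"] s4 by simp
      show "I 0 ?s4" by (fact s4)
      show "I i (update s' ''i'' 0 v)" if "I i s'" for i s' v
        using that by (simp add: I_def update_def)
      show "wp B ?body s' (I (Suc i))" if "i < 2 * n" "agree ?X ?s4 s'" "I i s'" for i s'
      proof -
        have s': "s' ''n'' 0 = int n" "s' ''q'' 0 = ?q"
          using agreeD[OF that(2), of "''n''"] agreeD[OF that(2), of "''q''"] s4 by auto
        show ?thesis
        proof (cases "i < k")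
          case True
          then have "i * (d + 1) \<le> (k - 1) * (d + 1)" by (intro mult_right_mono) auto
          then have "i * (d + 1) < 2 * n" using k(2) by linarith
          then have "int (i * (d + 1)) < int (2 * n)" by (simp only: of_nat_less_iff)
          then have "int i * ?q < int n + int n" by (simp add: algebra_simps)
          moreover have "min i k = i" "min (Suc i) k = Suc i" using True by auto
          ultimately show ?thesis
            using that(3) s' by (intro wp_If wp_Seq wp_Assign wp_Skip)
              (simp_all add: I_def update_def algebra_simps)
        next
          case False
          have "int (2 * n) \<le> int (k * (d + 1))" using k(1) by (simp only: of_nat_le_iff)
          then have "int n + int n \<le> int k * ?q" by (simp add: algebra_simps)
          moreover have "min i k = k" "min (Suc i) k = k" using False by auto
          ultimately show ?thesis
            using that(3) s' by (intro wp_If wp_Seq wp_Assign wp_Skip)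
              (simp_all add: I_def update_def)
        qed
      qed
      show "Q s'" if fin: "I (2 * n) s' \<and> agree ?X ?s4 s'" for s'
      proof (rule Q)
        have ag: "agree ?X ?s4 s'" using fin by blast
        have "agree {''d'', ''q'', ''tt'', ''m'', ''i''} s s'"
          using ag4 ag by (auto simp: agree_def)
        then show "plain_input n E s'" by (rule plain_input_agree[OF s(1)]) simp
        show "s' ''d'' 0 = int d" "s' ''q'' 0 = ?q"
          using agreeD[OF ag, of "''d''"] agreeD[OF ag, of "''q''"] s4 by auto
        show "s' ''m'' 0 = int m" using fin k_le mk by (simp add: I_def min_def)
      qed
    qed
  qed
qed

lemma wp_setup_powers:
  assumes s: "plain_input n E s" "s ''d'' 0 = int d" "s ''q'' 0 = int d + 1" "s ''m'' 0 = int m"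
    and Q: "\<And>s'. plain_input n E s' \<Longrightarrow> s' ''d'' 0 = int d \<Longrightarrow> s' ''m'' 0 = int m \<Longrightarrow>
      (\<forall>j\<le>m. s' ''ex'' (int j) = int (n * n * (d + 1) ^ j)) \<Longrightarrow> Q s'"
  shows "wp B setup_powers s Q"
proof -
  let ?c1 = "Set ''s'' (Add (Var ''s'') (Var ''n''))"
  let ?c2 = "Set ''acc'' (Add (Var ''acc'') (Get ''ex'' (Var ''i'')))"
  let ?body = "Set ''acc'' (Lit 0) ;; For ''j'' (Var ''q'') ?c2 ;;
      Assign ''ex'' (Add (Var ''i'') (Lit 1)) (Var ''acc'')"
  have n1: "s ''n'' 0 = int n" using s(1) by (simp add: plain_input_def)
  define I where "I i s' \<longleftrightarrow> (\<forall>j\<le>i. s' ''ex'' (int j) = int (n * n * (d + 1) ^ j))"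
    for i and s' :: state
  show ?thesis
    unfolding setup_powers_def
  proof (rule wp_Seq, rule wp_Assign, rule wp_Seq,
      rule wp_mono[OF wp_For[where N = n and I = "\<lambda>i s'. s' ''s'' 0 = int i * int n"]])
    let ?s1 = "update s ''s'' (aval (Lit 0) s) (aval (Lit 0) s)"
    let ?X1 = "insert ''i'' (mods ?c1)"
    show "n \<le> B" by (rule bounds)
    show "''i'' \<notin> mods ?c1" by simp
    show "aval (Var ''n'') s' = int n" if "agree ?X1 ?s1 s'" for s'
      using agreeD[OF that, of "''n''"] n1 by (simp add: update_def)
    show "?s1 ''s'' 0 = int 0 * int n" by (simp add: update_def)
    show "update s' ''i'' 0 v ''s'' 0 = int i * int n" if "s' ''s'' 0 = int i * int n" for i s' v
      using that by (simp add: update_def)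
    show "wp B ?c1 s' (\<lambda>s'. s' ''s'' 0 = int (Suc i) * int n)"
      if "agree ?X1 ?s1 s'" "s' ''s'' 0 = int i * int n" for i s'
      using agreeD[OF that(1), of "''n''"] n1 that(2)
      by (intro wp_Assign) (simp add: update_def algebra_simps)
    fix s2
    assume s2: "s2 ''s'' 0 = int n * int n \<and> agree ?X1 ?s1 s2"
    let ?s3 = "update s2 ''ex'' (aval (Lit 0) s2) (aval (Var ''s'') s2)"
    have ag3: "agree {''s'', ''i'', ''ex''} s ?s3" using s2 by (auto simp: agree_def update_def)
    have s3: "?s3 ''q'' 0 = int (d + 1)" "?s3 ''m'' 0 = int m" "?s3 ''d'' 0 = int d"
      using s agreeD[OF ag3, of "''q''"] agreeD[OF ag3, of "''m''"] agreeD[OF ag3, of "''d''"] by auto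
    show "wp B (Assign ''ex'' (Lit 0) (Var ''s'') ;; For ''i'' (Var ''m'') ?body) s2 Q"
    proof (rule wp_Seq, rule wp_Assign, rule wp_mono[OF wp_For[where N = m and I = I]])
      let ?X = "insert ''i'' (mods ?body)"
      show "m \<le> B" by (rule bounds)
      show "''i'' \<notin> mods ?body" by simp
      show "aval (Var ''m'') s' = int m" if "agree ?X ?s3 s'" for s'
        using agreeD[OF that, of "''m''"] s3 by simp
      show "I 0 ?s3" using s2 by (simp add: I_def update_def)
      show "I i (update s' ''i'' 0 v)" if "I i s'" for i s' v
        using that by (simp add: I_def update_def)
      show "Q s'" if fin: "I m s' \<and> agree ?X ?s3 s'" for s'
      proof (rule Q)
        have ag: "agree ?X ?s3 s'" using fin by blast
        have "agree {''s'', ''i'', ''ex'', ''acc'', ''j''} s s'"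
          using ag3 ag by (auto simp: agree_def)
        then show "plain_input n E s'" by (rule plain_input_agree[OF s(1)]) simp
        show "s' ''d'' 0 = int d" "s' ''m'' 0 = int m"
          using agreeD[OF ag, of "''d''"] agreeD[OF ag, of "''m''"] s3 by auto
        show "\<forall>j\<le>m. s' ''ex'' (int j) = int (n * n * (d + 1) ^ j)" using fin by (simp add: I_def)
      qed
      fix i s4
      assume i: "i < m" and ag4: "agree ?X ?s3 s4" and si: "s4 ''i'' 0 = int i" and I: "I i s4"
      let ?s5 = "update s4 ''acc'' (aval (Lit 0) s4) (aval (Lit 0) s4)"
      let ?v = "int (n * n * (d + 1) ^ i)"
      have v: "?s5 ''ex'' (int i) = ?v" using I by (simp add: I_def update_def)
      have s5: "?s5 ''q'' 0 = int (d + 1)" "?s5 ''i'' 0 = int i"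
        using s3 si agreeD[OF ag4, of "''q''"] by (simp_all add: update_def)
      show "wp B ?body s4 (I (Suc i))"
      proof (rule wp_Seq, rule wp_Assign, rule wp_Seq,
          rule wp_mono[OF wp_For[where N = "d + 1" and I = "\<lambda>j s'. s' ''acc'' 0 = int j * ?v"]])
        let ?X2 = "insert ''j'' (mods ?c2)"
        show "d + 1 \<le> B" by (rule bounds)
        show "''j'' \<notin> mods ?c2" by simp
        show "aval (Var ''q'') s' = int (d + 1)" if "agree ?X2 ?s5 s'" for s'
          using agreeD[OF that, of "''q''"] s5 by simp
        show "?s5 ''acc'' 0 = int 0 * ?v" by (simp add: update_def)
        show "update s' ''j'' 0 w ''acc'' 0 = int j * ?v" if "s' ''acc'' 0 = int j * ?v" for j s' w
          using that by (simp add: update_def)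
        show "wp B ?c2 s' (\<lambda>s'. s' ''acc'' 0 = int (Suc j) * ?v)"
          if "agree ?X2 ?s5 s'" "s' ''acc'' 0 = int j * ?v" for j s'
        proof (rule wp_Assign)
          have "s' ''ex'' (int i) = ?v" "s' ''i'' 0 = int i"
            using agreeD[OF that(1), of "''ex''"] agreeD[OF that(1), of "''i''"] v s5 by auto
          then show "update s' ''acc'' (aval (Lit 0) s')
              (aval (Add (Var ''acc'') (Get ''ex'' (Var ''i''))) s') ''acc'' 0 = int (Suc j) * ?v"
            using that(2) by (simp add: update_def algebra_simps)
        qed
        fix s6
        assume s6: "s6 ''acc'' 0 = int (d + 1) * ?v \<and> agree ?X2 ?s5 s6"
        then have ag6: "agree ?X2 ?s5 s6" by blast
        have i6: "s6 ''i'' 0 = int i" using agreeD[OF ag6, of "''i''"] s5 by simp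
        have ex6: "s6 ''ex'' = s4 ''ex''" using agreeD[OF ag6, of "''ex''"] by (simp add: update_def)
        have acc6: "s6 ''acc'' 0 = int (n * n * (d + 1) ^ Suc i)" using s6 by (simp add: algebra_simps)
        show "wp B (Assign ''ex'' (Add (Var ''i'') (Lit 1)) (Var ''acc'')) s6 (I (Suc i))"
        proof (rule wp_Assign)
          have "update s6 ''ex'' (aval (Add (Var ''i'') (Lit 1)) s6) (aval (Var ''acc'') s6) ''ex'' (int j) =
              int (n * n * (d + 1) ^ j)" if "j \<le> Suc i" for j
          proof (cases "j = Suc i")
            case True
            then show ?thesis using acc6 i6 by (simp add: update_def)
          next
            case False
            then show ?thesis using that i6 ex6 I by (simp add: update_def I_def)
          qed
          then show "I (Suc i) (update s6 ''ex'' (aval (Add (Var ''i'') (Lit 1)) s6) (aval (Var ''acc'') s6))"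
            unfolding I_def by blast
        qed
      qed
    qed
  qed
qed

lemma wp_setup_bits:
  assumes s: "plain_input n E s" "s ''d'' 0 = int d" "s ''m'' 0 = int m"
    and ex: "\<forall>j\<le>m. s ''ex'' (int j) = int (n * n * (d + 1) ^ j)"
    and Q: "\<And>s'. env s' \<Longrightarrow> s' ''answer'' 0 = 0 \<Longrightarrow> Q s'"
  shows "wp B setup_bits s Q"
proof -
  let ?body = "Assign ''p2'' (Add (Var ''i'') (Lit 1)) (Add (Get ''p2'' (Var ''i'')) (Get ''p2'' (Var ''i'')))"
  define I where "I i s' \<longleftrightarrow> (\<forall>j\<le>i. s' ''p2'' (int j) = 2 ^ j)" for i and s' :: state
  let ?s1 = "update s ''L'' (aval (Lit 0) s) (aval (Get ''ex'' (Var ''m'')) s)"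
  let ?s2 = "update ?s1 ''p2'' (aval (Lit 0) ?s1) (aval (Lit 1) ?s1)"
  have ag2: "agree {''L'', ''p2''} s ?s2" by (auto simp: agree_def update_def)
  have L: "?s2 ''L'' 0 = int B" using s(3) ex by (simp add: update_def B_def)
  show ?thesis
    unfolding setup_bits_def
  proof (rule wp_Seq, rule wp_Assign, rule wp_Seq, rule wp_Assign, rule wp_Seq,
      rule wp_mono[OF wp_For[where N = B and I = I]])
    let ?X = "insert ''i'' (mods ?body)"
    show "''i'' \<notin> mods ?body" by simp
    show "aval (Var ''L'') s' = int B" if "agree ?X ?s2 s'" for s'
      using agreeD[OF that, of "''L''"] L by simp
    show "I 0 ?s2" by (simp add: I_def update_def)
    show "I i (update s' ''i'' 0 v)" if "I i s'" for i s' v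
      using that by (simp add: I_def update_def)
    show "wp B ?body s' (I (Suc i))" if "s' ''i'' 0 = int i" "I i s'" for i s'
    proof (rule wp_Assign)
      have "update s' ''p2'' (aval (Add (Var ''i'') (Lit 1)) s')
          (aval (Add (Get ''p2'' (Var ''i'')) (Get ''p2'' (Var ''i''))) s') ''p2'' (int j) = 2 ^ j"
        if "j \<le> Suc i" for j
        using that \<open>s' ''i'' 0 = int i\<close> \<open>I i s'\<close>
        by (cases "j = Suc i") (simp_all add: update_def I_def)
      then show "I (Suc i) (update s' ''p2'' (aval (Add (Var ''i'') (Lit 1)) s')
          (aval (Add (Get ''p2'' (Var ''i'')) (Get ''p2'' (Var ''i''))) s'))"
        unfolding I_def by blast
    qed
    fix s3 assume s3: "I B s3 \<and> agree ?X ?s2 s3"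
    let ?s4 = "update s3 ''M'' (aval (Lit 0) s3) (aval (Get ''p2'' (Var ''L'')) s3)"
    have ag3: "agree ?X ?s2 s3" using s3 by blast
    have ag4: "agree {''L'', ''p2'', ''i'', ''M''} s ?s4"
      using ag2 ag3 by (auto simp: agree_def update_def)
    have L3: "s3 ''L'' 0 = int B" using agreeD[OF ag3, of "''L''"] L by simp
    have "plain_input n E ?s4" by (rule plain_input_agree[OF s(1) ag4]) simp
    moreover have "?s4 ''M'' 0 = 2 ^ B" "?s4 ''L'' 0 = int B" "\<forall>i\<le>B. ?s4 ''p2'' (int i) = 2 ^ i"
      using s3 L3 by (simp_all add: update_def I_def)
    moreover have "?s4 ''d'' 0 = int d" "?s4 ''m'' 0 = int m"
        "\<forall>j\<le>m. ?s4 ''ex'' (int j) = int (n * n * (d + 1) ^ j)"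
      using s ex agreeD[OF ag4, of "''d''"] agreeD[OF ag4, of "''m''"] agreeD[OF ag4, of "''ex''"]
      by simp_all
    ultimately have "env ?s4" "?s4 ''answer'' 0 = 0" unfolding env_def plain_input_def by simp_all
    then show "wp B (Set ''M'' (Get ''p2'' (Var ''L''))) s3 Q" by (intro wp_Assign Q)
  qed simp
qed

lemma wp_setup_groups:
  assumes env: "env s" and ans: "s ''answer'' 0 = 0"
  shows "wp B (setup_groups ;; main) s (\<lambda>s'. s' ''answer'' 0 = of_bool tree_exists)"
proof -
  let ?body = "Assign ''x'' (Var ''i'') (Get ''ex'' (Lit 0))"
  define I where "I i s' \<longleftrightarrow> (\<forall>v<i. s' ''x'' (int v) = int (n * n))" for i and s' :: state
  show ?thesis
    unfolding setup_groups_def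
  proof (rule wp_Seq, rule wp_mono[OF wp_For[where N = n and I = I]])
    let ?X = "insert ''i'' (mods ?body)"
    show "n \<le> B" by (rule bounds)
    show "''i'' \<notin> mods ?body" by simp
    show "aval (Var ''n'') s' = int n" if "agree ?X s s'" for s'
      using agreeD[OF that, of "''n''"] envD(1)[OF env] by simp
    show "I 0 s" by (simp add: I_def)
    show "I i (update s' ''i'' 0 v)" if "I i s'" for i s' v
      using that by (simp add: I_def update_def)
    show "wp B ?body s' (I (Suc i))" if "agree ?X s s'" "s' ''i'' 0 = int i" "I i s'" for i s'
    proof (rule wp_Assign)
      have "s' ''ex'' 0 = int (n * n)"
        using agreeD[OF that(1), of "''ex''"] envD(6)[OF env, of 0] by simp
      then show "I (Suc i) (update s' ''x'' (aval (Var ''i'') s') (aval (Get ''ex'' (Lit 0)) s'))"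
        using that by (auto simp: I_def update_def less_Suc_eq)
    qed
    fix s2 assume s2: "I n s2 \<and> agree ?X s s2"
    then have ag: "agree ?X s s2" by blast
    have "env s2" by (rule env_agree[OF env ag]) simp
    moreover have "s2 ''answer'' 0 = 0" using ans agreeD[OF ag, of "''answer''"] by simp
    ultimately show "wp B main s2 (\<lambda>s'. s' ''answer'' 0 = of_bool tree_exists)"
      using s2 mk k(1) by (intro wp_main) (auto simp: I_def)
  qed
qed

lemma wp_setup_main:
  assumes "plain_input n E s" "s ''d'' 0 = d0" "int d = min d0 (int n)"
  shows "wp B (setup_dims ;; setup_powers ;; setup_bits ;; setup_groups ;; main) s
    (\<lambda>s'. s' ''answer'' 0 = of_bool tree_exists)"
  by (rule wp_Seq, rule wp_setup_dims[OF assms], rule wp_Seq, rule wp_setup_powers, assumption+,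
      rule wp_Seq, rule wp_setup_bits, assumption+, rule wp_setup_groups)

end

text \<open>Replacing \<open>d\<close> by its minimum with \<open>n\<close> therefore changes
  nothing. A vertex with a parent is not its own child, which saves the one unit for the parent
  edge.\<close>

lemma parent_tree_degree_le:
  assumes f: "parent_tree n E f" and v: "v < n"
  shows "forest_degree n f v \<le> n"
proof (cases "f v = n")
  case True
  have "card {u \<in> {0..<n}. f u = v} \<le> card {0..<n}" by (intro card_mono) auto
  then show ?thesis using True by (simp add: forest_degree_def)
next
  case False
  obtain h :: "nat \<Rightarrow> nat" where "\<And>v. v < n \<Longrightarrow> h (f v) < h v"
    using f reaches_sink_rank[of n f] by (auto simp: parent_tree_def parent_forest_def rooted_forests_def)
  then have "f v \<noteq> v" using v by (metis less_irrefl)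
  then have "card {u \<in> {0..<n}. f u = v} \<le> card ({0..<n} - {v})" by (intro card_mono) auto
  also have "\<dots> = n - 1" using v by simp
  finally show ?thesis using v False by (simp add: forest_degree_def)
qed

text \<open>Degrees of at most 1 give \<open>2 * (n - 1) \<le> n\<close>, that is
  \<open>n \<le> 2\<close>; and bounds below 1 contradict the positive degrees.\<close>

lemma no_bounded_tree:
  assumes n: "n \<ge> 2" and d: "d \<le> 0 \<or> d = 1 \<and> n > 2"
  shows "\<not> (\<exists>f. parent_tree n E f \<and> (\<forall>v<n. int (forest_degree n f v) \<le> d))"
proof
  assume "\<exists>f. parent_tree n E f \<and> (\<forall>v<n. int (forest_degree n f v) \<le> d)"
  then obtain f where f: "parent_tree n E f" and deg: "\<And>v. v < n \<Longrightarrow> int (forest_degree n f v) \<le> d" by blast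
  have rf: "f \<in> rooted_forests n" and c: "card {v \<in> {0..<n}. f v \<noteq> n} = n - 1"
    using f by (auto simp: parent_tree_def parent_forest_def)
  have "forest_degree n f v \<le> 1" if "v < n" for v using deg[OF that] d by linarith
  then have "(\<Sum>v = 0..<n. forest_degree n f v) \<le> (\<Sum>v = 0..<n. 1)" by (intro sum_mono) auto
  then have "n \<le> 2" using sum_forest_degree[OF rf] c by simp
  then have "d \<le> 0" using d by simp
  then show False using parent_tree_degree_pos[OF n f, of 0] deg[of 0] n by simp
qed

section \<open>The running time\<close>

text \<open>From \<open>2 * k \<le> 4 * n / (d + 1) + 2\<close>: for \<open>d \<ge> 2\<close> the
  base \<open>d + 1\<close> is at most the square of \<open>d\<close>, which doubles the exponent to
  \<open>8 * n / d\<close>. The surplus factor, the square of \<open>d + 1\<close>, is at most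
  \<open>4 * n ^ 2\<close>, and \<open>n * n\<close> completes \<open>4 * n ^ 4\<close>.\<close>

lemma bits_bound:
  fixes n d k :: nat
  assumes n: "1 \<le> n" and d: "2 \<le> d" "d \<le> n" and k: "(k - 1) * (d + 1) < 2 * n"
  shows "real (n * n * (d + 1) ^ (2 * k)) \<le> 4 * real n ^ 4 * real d powr (8 * real n / real d)"
proof -
  let ?q = "real d + 1"
  have "real (k - 1) * ?q < 2 * real n"
    using k by (metis of_nat_1 of_nat_add of_nat_less_iff of_nat_mult of_nat_numeral)
  then have "real (k - 1) \<le> 2 * (real n / ?q)" by (simp add: field_simps)
  moreover have "real k \<le> real (k - 1) + 1" by linarith
  ultimately have "real (2 * k) \<le> 4 * (real n / ?q) + 2" by simp
  then have k': "real (2 * k) \<le> 4 * real n / ?q + 2" by simp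
  have sq: "real d powr 2 = real d ^ 2" using d by simp
  have q: "?q \<le> real d powr 2"
    unfolding sq
  proof -
    have "2 * real d \<le> real d ^ 2" using d by (simp add: power2_eq_square)
    then show "real d + 1 \<le> real d ^ 2" using d by linarith
  qed
  have "4 * real n / ?q \<le> 4 * real n / real d" using d by (intro divide_left_mono) auto
  then have "?q powr (4 * real n / ?q) \<le> ?q powr (4 * real n / real d)"
    by (intro powr_mono) auto
  also have "\<dots> \<le> (real d powr 2) powr (4 * real n / real d)"
    using q d by (intro powr_mono2) auto
  also have "\<dots> = real d powr (8 * real n / real d)" unfolding powr_powr by simp
  finally have main: "?q powr (4 * real n / ?q) \<le> real d powr (8 * real n / real d)" .
  have "?q ^ (2 * k) = ?q powr real (2 * k)" by (rule powr_realpow[symmetric]) simp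
  also have "\<dots> \<le> ?q powr (4 * real n / ?q + 2)" using k' by (intro powr_mono) auto
  also have "\<dots> = ?q powr (4 * real n / ?q) * ?q ^ 2" by (simp add: powr_add)
  also have "\<dots> \<le> real d powr (8 * real n / real d) * (2 * real n) ^ 2"
    using main n d by (intro mult_mono power_mono) auto
  finally have "real n ^ 2 * ?q ^ (2 * k) \<le> real n ^ 2 * (real d powr (8 * real n / real d) * (2 * real n) ^ 2)"
    by (intro mult_left_mono) auto
  also have "\<dots> = 4 * real n ^ 4 * real d powr (8 * real n / real d)"
    by (simp add: power_mult_distrib power2_eq_square power4_eq_xxxx)
  finally show ?thesis by (simp add: power2_eq_square add.commute)
qed

text \<open>The constant 64 is the value of \<open>B\<close> for \<open>n = 2\<close> and
  \<open>d = 1\<close>, which \<open>bits_bound\<close> does not cover. The power 12 is needed for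
  \<open>d > n\<close>: the clamped degree \<open>n\<close> turns the power with exponent
  \<open>8 * n / n\<close> into \<open>n ^ 8\<close>, next to the factor
  \<open>n ^ 4\<close>.\<close>

definition iteration_bound :: "nat \<Rightarrow> int \<Rightarrow> real" where
  "iteration_bound n d = 64 * real_of_int (max 1 d) powr (8 * (real n / real_of_int (max 1 d))) * real n ^ 12"

lemma iteration_bound_ge: "n \<ge> 1 \<Longrightarrow> 64 * real n ^ 12 \<le> iteration_bound n d"
  unfolding iteration_bound_def by (simp add: ge_one_powr_ge_zero)

lemma program_correct:
  assumes n: "n \<ge> 1" and E: "simple_graph {0..<n} E"
  shows "\<exists>L\<ge>1. real L \<le> iteration_bound n d \<and>
    wp L program (input_state n d E) (\<lambda>s'. s' ''answer'' 0 =
      of_bool (\<exists>f. parent_tree n E f \<and> (\<forall>v<n. int (forest_degree n f v) \<le> d)))"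
    (is "\<exists>L\<ge>1. _ \<and> wp L program ?s (\<lambda>s'. _ = of_bool ?T)")
proof -
  have s: "?s ''n'' 0 = int n" "?s ''d'' 0 = d" "?s ''answer'' 0 = 0" by (simp_all add: input_state_def)
  have ge64: "64 \<le> iteration_bound n d"
    using iteration_bound_ge[OF n, of d] one_le_power[of "real n" 12] n by linarith
  consider "n = 1" | "n \<ge> 2" "d \<le> 0 \<or> d = 1 \<and> n > 2" | "n \<ge> 2" "d \<ge> 1" "d \<ge> 2 \<or> n = 2"
    using n by linarith
  then show ?thesis
  proof cases
    case 1
    have "?T \<longleftrightarrow> d \<ge> 0"
    proof
      assume ?T
      then obtain f where "int (forest_degree n f 0) \<le> d" using n by auto
      then show "d \<ge> 0" by linarith
    next
      assume "d \<ge> 0"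
      \<comment> \<open>For \<open>n = 1\<close> the sink is 1, so the only vertex is a root of
        degree 0.\<close>
      define f where "f = restrict (\<lambda>_. 1 :: nat) {0..<n}"
      have f0: "f 0 = 1" using n by (simp add: f_def)
      have at0: "f v = n" if "v < n" for v using that 1 f0 by simp
      have "{v \<in> {0..<n}. f v \<noteq> n} = {}" using at0 by auto
      then have "parent_tree n E f"
        using 1 at0 reaches_sink_step[of _ n f]
        by (auto simp: parent_tree_def parent_forest_def rooted_forests_def f_def)
      moreover have "f u \<noteq> 0" if "u \<in> {0..<n}" for u using at0[of u] that n by simp
      then have no_child: "{u \<in> {0..<n}. f u = 0} = {}" by blast
      have "forest_degree n f 0 = 0" unfolding forest_degree_def no_child using 1 f0 by simp
      then have "\<forall>v<n. int (forest_degree n f v) \<le> d" using 1 \<open>d \<ge> 0\<close> by simp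
      ultimately show ?T by blast
    qed
    then have "wp 1 program ?s (\<lambda>s'. s' ''answer'' 0 = of_bool ?T)"
      unfolding program_def using s 1
      by (intro wp_If wp_Assign wp_Skip) (simp_all add: update_def)
    \<comment> \<open>No loop is reached on this path, so a loop bound of 1 suffices.\<close>
    then show ?thesis using ge64 by (intro exI[of _ 1]) simp
  next
    case 2
    have no_tree: "?T = False" using no_bounded_tree[OF 2] by blast
    have "wp 1 program ?s (\<lambda>s'. s' ''answer'' 0 = 0)"
      unfolding program_def
      by (rule wp_If, use s 2 in simp, rule wp_If, use s 2 in force, rule wp_Skip, rule s)
    then show ?thesis unfolding no_tree using ge64 by (intro exI[of _ 1]) simp
  next
    case 3
    define c where "c = nat (min d (int n))"
    have c: "int c = min d (int n)" "1 \<le> c" "c \<le> n" using 3 by (auto simp: c_def)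
    \<comment> \<open>Ceiling division of \<open>2 * n\<close> by \<open>c + 1\<close>, from which
      both inequalities of \<open>machine_setup\<close> follow.\<close>
    define k where "k = (2 * n + c) div (c + 1)"
    have "2 * n < (k + 1) * (c + 1) - c"
      using dividend_less_div_times[of "c + 1" "2 * n + c"] by (simp add: k_def)
    then have k1: "2 * n \<le> k * (c + 1)" by simp
    have "k * (c + 1) \<le> 2 * n + c" unfolding k_def by (rule div_times_less_eq_dividend)
    then have k2: "(k - 1) * (c + 1) < 2 * n" using 3(1) by (cases k) auto
    have "k \<ge> 1" using k1 3(1) by (cases k) auto
    interpret machine_setup n c "2 * k" E k
      using 3(1) c k1 k2 E \<open>k \<ge> 1\<close> by unfold_locales auto
    have "forest_degree n f v \<le> c \<longleftrightarrow> int (forest_degree n f v) \<le> d" if "parent_tree n E f" "v < n" for f v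
      using parent_tree_degree_le[OF that] c(1) by linarith
    then have T: "tree_exists \<longleftrightarrow> ?T" unfolding tree_exists_def by blast
    have "wp B (setup_dims ;; setup_powers ;; setup_bits ;; setup_groups ;; main) ?s
        (\<lambda>s'. s' ''answer'' 0 = of_bool ?T)"
      using wp_setup_main[OF plain_input_state s(2) c(1)] unfolding T .
    then have "wp B program ?s (\<lambda>s'. s' ''answer'' 0 = of_bool ?T)"
      unfolding program_def
      by (intro wp_If) (use s 3 in auto)
    moreover have "real B \<le> iteration_bound n d"
    proof (cases "c = 1")
      case True
      then have "n = 2" using 3 c(1) by linarith
      then have "4 \<le> k * 2" "(k - 1) * 2 < 4" using True k1 k2 by simp_all
      then have "k = 2" by arith
      then have "B = 64" unfolding B_def using True \<open>n = 2\<close> by (simp add: power4_eq_xxxx)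
      then show ?thesis using ge64 by simp
    next
      case False
      then have Bb: "real B \<le> 4 * real n ^ 4 * real c powr (8 * real n / real c)"
        unfolding B_def using c k2 n by (intro bits_bound) auto
      show ?thesis
      proof (cases "d \<le> int n")
        case True
        then have D: "real_of_int (max 1 d) = real c" using c(1) 3(2) by (simp add: c_def)
        have "4 * real n ^ 4 \<le> 64 * real n ^ 12"
          using n by (intro mult_mono power_increasing) auto
        then have "4 * real n ^ 4 * real c powr (8 * real n / real c) \<le>
            64 * real n ^ 12 * real c powr (8 * real n / real c)"
          by (rule mult_right_mono) simp
        also have "\<dots> = iteration_bound n d" unfolding iteration_bound_def D by simp
        finally show ?thesis using Bb by linarith
      next
        case False
        then have "c = n" by (simp add: c_def)
        then have "real B \<le> 4 * real n ^ 4 * real n powr 8" using Bb n by simp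
        also have "real n powr 8 = real n ^ 8" using n by simp
        also have "4 * real n ^ 4 * real n ^ 8 \<le> 64 * real n ^ 12" by simp
        also have "\<dots> \<le> iteration_bound n d" using n by (intro iteration_bound_ge) simp
        finally show ?thesis .
      qed
    qed
    ultimately show ?thesis using bounds(6) by blast
  qed
qed

theorem theorem6p2:
  shows "\<exists>(P :: com) (C :: real) (a :: real) (b :: nat) (p :: real). p > 0 \<and>
    (\<forall>(n :: nat) (d :: int) (E :: nat set set).
      n \<ge> 1 \<and> simple_graph {0..<n} E \<longrightarrow>
        (\<forall>\<omega>. halts_within P (input_state n d E) \<omega> (time_bound C a b n d)) \<and>
        ((\<nexists>T. spanning_tree {0..<n} E T \<and> int (max_degree {0..<n} T) \<le> d) \<longrightarrow>
           (\<forall>\<omega>. \<not> answers_yes P (input_state n d E) \<omega>)) \<and>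
        ((\<exists>T. spanning_tree {0..<n} E T \<and> int (max_degree {0..<n} T) \<le> d) \<longrightarrow>
           prob_yes P (input_state n d E) \<ge> p))"
proof -
  obtain C K where cost: "\<And>L. L \<ge> 1 \<Longrightarrow> cost L program \<le> C * L ^ K"
    using cost_polynomial by blast
  \<comment> \<open>The constants arise from raising \<open>iteration_bound\<close> to the degree
    \<open>K\<close> of the cost polynomial.\<close>
  let ?C = "real C * 64 ^ K" and ?a = "8 * real K" and ?b = "12 * K"
  have claim: "(\<forall>\<omega>. halts_within program (input_state n d E) \<omega> (time_bound ?C ?a ?b n d)) \<and>
      (\<forall>\<omega>. answers_yes program (input_state n d E) \<omega> \<longleftrightarrow>
        (\<exists>T. spanning_tree {0..<n} E T \<and> int (max_degree {0..<n} T) \<le> d))"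
    if n: "n \<ge> 1" and E: "simple_graph {0..<n} E" for n d E
  proof -
    let ?T = "\<exists>T. spanning_tree {0..<n} E T \<and> int (max_degree {0..<n} T) \<le> d"
    obtain L where L: "L \<ge> 1" "real L \<le> iteration_bound n d"
      "wp L program (input_state n d E) (\<lambda>s'. s' ''answer'' 0 = of_bool ?T)"
      using program_correct[OF n E, of d] unfolding bounded_degree_tree_iff[OF n E] by blast
    then obtain s' t where run: "\<And>\<omega>. exec program (input_state n d E) \<omega> t s' \<omega>"
      and t: "t \<le> cost L program" and ans: "s' ''answer'' 0 = of_bool ?T"
      unfolding wp_def by blast
    let ?D = "real_of_int (max 1 d)"
    have "t \<le> C * L ^ K" using t cost[OF L(1)] by simp
    then have "real t \<le> real C * real L ^ K" by (metis of_nat_le_iff of_nat_mult of_nat_power)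
    also have "\<dots> \<le> real C * iteration_bound n d ^ K"
      using L(2) by (intro mult_left_mono power_mono) auto
    also have "\<dots> = time_bound ?C ?a ?b n d"
    proof -
      have "(?D powr (8 * (real n / ?D))) ^ K = ?D powr (?a * (real n / ?D))"
        by (simp add: powr_power mult_ac)
      then show ?thesis
        by (simp add: iteration_bound_def time_bound_def power_mult_distrib power_mult)
    qed
    finally have "halts_within program (input_state n d E) \<omega> (time_bound ?C ?a ?b n d)" for \<omega>
      unfolding halts_within_def using run by blast
    moreover have "answers_yes program (input_state n d E) \<omega> \<longleftrightarrow> ?T" for \<omega>
    proof
      assume "answers_yes program (input_state n d E) \<omega>"
      then have "s' ''answer'' 0 = 1"
        unfolding answers_yes_def using exec_deterministic[OF run] by blast
      then show ?T using ans by (cases ?T) simp_all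
    next
      assume ?T
      then show "answers_yes program (input_state n d E) \<omega>"
        unfolding answers_yes_def using run ans by auto
    qed
    ultimately show ?thesis by blast
  qed
  \<comment> \<open>In a yes instance every coin sequence is accepted, so the probability is the
    total mass and \<open>p = 1\<close> works.\<close>
  have total: "measure coin_space UNIV = 1"
  proof -
    interpret prob_space coin_space
      unfolding coin_space_def by (rule prob_space.prob_space_stream_space[OF prob_space_measure_pmf])
    have "space coin_space = UNIV" by (simp add: coin_space_def space_stream_space)
    then show ?thesis using prob_space by simp
  qed
  show ?thesis
    by (rule exI[of _ program], rule exI[of _ ?C], rule exI[of _ ?a], rule exI[of _ ?b], rule exI[of _ 1])
      (use claim total in \<open>auto simp: prob_yes_def\<close>)
qed

end
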